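(* Suppose $p\in[0,1]$ and $p>1-\beta_c$, where $\beta_c$ is the critical parameter for oriented site percolation on $\mathbb{Z}^2$. Then $\nu_p$ is mixing for the northeast model with flip parameter $p$ in the following sense: for $\nu_p$-almost every initial configuration $\sigma$, and for every finite set $\Lambda\subset\mathbb{Z}^2$ and every configuration $\zeta^\Lambda\in\{0,1\}^\Lambda$, $$\lim_{t\to\infty}P_p^\sigma\{\xi_t^\Lambda=\zeta^\Lambda\}=\nu_p^\Lambda(\zeta^\Lambda).$$
   Context: Northeast model with flip parameter $p$: the Feller Markov process $(\xi_t)_{t\ge 0}$ on the configuration space $X=\{0,1\}^{\mathbb{Z}^2}$ (product topology) in which the spin at site $(x,y)\in\mathbb{Z}^2$ may flip only at times when the spins at the westerly neighbor $(x-1,y)$ and the southerly neighbor $(x,y-1)$ are both $1$; at such times the flip rates are $0\to 1$ at rate $p$ and $1\to 0$ at rate $1-p$. Equivalently, its generator is the closure of the operator defined on functions $f:X\to\mathbb{R}$ depending on finitely many coordinates by $\mathcal{L}f(\sigma)=\sum_{x}\nabla_x f(\sigma)\mathbf{1}\{x\in A(\sigma)\}$, where $A(\sigma)$ is the set of sites whose southerly and westerly nearest neighbors both have spin $1$ in $\sigma$, $\nabla_xf(\sigma)=p\,(f(\sigma_x^+)-f(\sigma_x^-))$ if $\sigma(x)=0$, $\nabla_xf(\sigma)=(1-p)(f(\sigma_x^-)-f(\sigma_x^+))$ if $\sigma(x)=1$, and $\sigma_x^{+},\sigma_x^-$ agree with $\sigma$ off $x$ and have spin $1$, respectively $0$,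 at $x$. $P_p^\sigma$ is the law of the process started from $\xi_0=\sigma$. $\nu_p$ denotes the product Bernoulli-$p$ measure on $X$. For $\Lambda\subset\mathbb{Z}^2$, $\zeta^\Lambda$ denotes the restriction of a configuration $\zeta$ to $\Lambda$, and $\nu_p^\Lambda$ the product Bernoulli-$p$ measure on $\{0,1\}^\Lambda$. Oriented site percolation on $\mathbb{Z}^2$: each site is independently open with probability $\beta$; an oriented path moves at each step to the southerly or to the westerly nearest neighbor (equivalently, by symmetry, northerly or easterly). $\beta_c$ is the supremum of those $\beta$ for which, almost surely, there is no infinite oriented path of open sites. *)

theory Defs
  imports "HOL-Probability.Probability"
begin

section \<open>Feller processes on a topological space\<close>

text \<open>
  Time is \<open>{0..}\<close>; a path is a function on \<open>real\<close> that is \<open>undefined\<close> at negative times.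
\<close>

definition cadlag_paths :: "(real \<Rightarrow> 'a::topological_space) set" where
  "cadlag_paths = {\<omega> \<in> extensional {0..}.
     (\<forall>t\<ge>0. (\<omega> \<longlongrightarrow> \<omega> t) (at_right t)) \<and>
     (\<forall>t>0. \<exists>l. (\<omega> \<longlongrightarrow> l) (at_left t))}"

definition path_space :: "(real \<Rightarrow> 'a::topological_space) measure" where
  "path_space = restrict_space (Pi\<^sub>M {0..} (\<lambda>_. borel)) cadlag_paths"

definition history :: "real \<Rightarrow> (real \<Rightarrow> 'a::topological_space) measure" where
  "history s = vimage_algebra cadlag_paths (\<lambda>\<omega>. restrict \<omega> {0..s}) (Pi\<^sub>M {0..s} (\<lambda>_. borel))"

definition time_shift :: "real \<Rightarrow> (real \<Rightarrow> 'a) \<Rightarrow> (real \<Rightarrow> 'a)" where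
  "time_shift s \<omega> = (\<lambda>u\<in>{0..}. \<omega> (s + u))"

text \<open>
  \<open>P \<sigma>\<close> is the law on path space of the process started from \<open>\<sigma>\<close>. The last clause says that,
  given the history up to time \<open>s\<close>, the shifted path has conditional law \<open>P (\<omega> s)\<close>.
\<close>

definition markov_process :: "('a::topological_space \<Rightarrow> (real \<Rightarrow> 'a) measure) \<Rightarrow> bool" where
  "markov_process P \<longleftrightarrow>
     P \<in> borel \<rightarrow>\<^sub>M prob_algebra path_space \<and>
     (\<forall>\<sigma>. AE \<omega> in P \<sigma>. \<omega> 0 = \<sigma>) \<and>
     (\<forall>\<sigma>. \<forall>s\<ge>0. \<forall>F\<in>sets (history s). \<forall>A\<in>sets path_space.
        emeasure (P \<sigma>) (F \<inter> time_shift s -` A) =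
        (\<integral>\<^sup>+\<omega>\<in>F. emeasure (P (\<omega> s)) A \<partial>P \<sigma>))"

definition feller_process :: "('a::topological_space \<Rightarrow> (real \<Rightarrow> 'a) measure) \<Rightarrow> bool" where
  "feller_process P \<longleftrightarrow> markov_process P \<and>
     (\<forall>t\<ge>0. \<forall>f :: 'a \<Rightarrow>\<^sub>C real. (\<lambda>\<sigma>. \<integral>\<omega>. f (\<omega> t) \<partial>P \<sigma>) \<in> bcontfun)"

text \<open>
  On a compact space \<open>'a \<Rightarrow>\<^sub>C real\<close> is the Banach space of all continuous functions. The
  operator below is meaningful when \<open>P\<close> is a Feller process and \<open>t \<ge> 0\<close>.
\<close>

definition transition_op ::
    "('a::topological_space \<Rightarrow> (real \<Rightarrow> 'a) measure) \<Rightarrow> real \<Rightarrow> ('a \<Rightarrow>\<^sub>C real) \<Rightarrow> ('a \<Rightarrow>\<^sub>C real)" where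
  "transition_op P t f = Bcontfun (\<lambda>\<sigma>. \<integral>\<omega>. f (\<omega> t) \<partial>P \<sigma>)"

text \<open>Unbounded operators are represented by their graphs.\<close>

definition generator_graph ::
    "('a::topological_space \<Rightarrow> (real \<Rightarrow> 'a) measure) \<Rightarrow> (('a \<Rightarrow>\<^sub>C real) \<times> ('a \<Rightarrow>\<^sub>C real)) set" where
  "generator_graph P =
     {(f, g). ((\<lambda>t. (transition_op P t f - f) /\<^sub>R t) \<longlongrightarrow> g) (at_right 0)}"


section \<open>The northeast model\<close>

type_synonym site = "int \<times> int"

text \<open>\<open>True\<close> is spin 1; the function type carries the product of the discrete topologies.\<close>

type_synonym config = "site \<Rightarrow> bool"

definition west :: "site \<Rightarrow> site" where
  "west x = (fst x - 1, snd x)"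

definition south :: "site \<Rightarrow> site" where
  "south x = (fst x, snd x - 1)"

definition flippable :: "config \<Rightarrow> site set" where
  "flippable \<sigma> = {x. \<sigma> (west x) \<and> \<sigma> (south x)}"

definition nabla :: "real \<Rightarrow> site \<Rightarrow> (config \<Rightarrow> real) \<Rightarrow> config \<Rightarrow> real" where
  "nabla p x f \<sigma> =
     (if \<sigma> x then (1 - p) * (f (\<sigma>(x := False)) - f (\<sigma>(x := True)))
      else p * (f (\<sigma>(x := True)) - f (\<sigma>(x := False))))"

definition cylinder_function :: "(config \<Rightarrow> real) \<Rightarrow> bool" where
  "cylinder_function f \<longleftrightarrow>
     (\<exists>\<Lambda>. finite \<Lambda> \<and> (\<forall>\<sigma> \<tau>. (\<forall>x\<in>\<Lambda>. \<sigma> x = \<tau> x) \<longrightarrow> f \<sigma> = f \<tau>))"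

text \<open>For a cylinder function only finitely many terms of the sum are nonzero.\<close>

definition northeast_op :: "real \<Rightarrow> (config \<Rightarrow> real) \<Rightarrow> config \<Rightarrow> real" where
  "northeast_op p f \<sigma> = (\<Sum>\<^sub>\<infinity>x\<in>flippable \<sigma>. nabla p x f \<sigma>)"

definition northeast_process :: "real \<Rightarrow> (config \<Rightarrow> (real \<Rightarrow> config) measure) \<Rightarrow> bool" where
  "northeast_process p P \<longleftrightarrow> feller_process P \<and>
     generator_graph P =
       closure {(f, g). cylinder_function (apply_bcontfun f) \<and>
                        apply_bcontfun g = northeast_op p (apply_bcontfun f)}"

definition bernoulli_field :: "site set \<Rightarrow> real \<Rightarrow> config measure" where
  "bernoulli_field \<Lambda> p = Pi\<^sub>M \<Lambda> (\<lambda>_. measure_pmf (bernoulli_pmf p))"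

abbreviation \<nu> :: "real \<Rightarrow> config measure" where
  "\<nu> p \<equiv> bernoulli_field UNIV p"


section \<open>Oriented site percolation\<close>

definition infinite_open_path :: "config \<Rightarrow> (nat \<Rightarrow> site) \<Rightarrow> bool" where
  "infinite_open_path \<omega> \<gamma> \<longleftrightarrow>
     (\<forall>n. \<omega> (\<gamma> n) \<and> \<gamma> (Suc n) \<in> {south (\<gamma> n), west (\<gamma> n)})"

definition beta_c :: real where
  "beta_c = Sup {\<beta> \<in> {0..1}. AE \<omega> in \<nu> \<beta>. \<not> (\<exists>\<gamma>. infinite_open_path \<omega> \<gamma>)}"

end

theory Submission
  imports Defs
begin

text \<open>
  Write \<open>h x\<close> for the centred spin at \<open>x\<close>. Expanding the indicator of a cylinder event, it suffices that the
  mean at time \<open>t\<close> of every nonempty product of centred spins tends to 0. If \<open>x\<close> is north-east extremal in such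
  a product, the other factors evolve without looking at \<open>x\<close>, while the spin at \<open>x\<close> relaxes to its mean
  whenever \<open>x\<close> is flippable. So the semigroup maps \<open>h x * g\<close> to \<open>h x * k\<close>, where \<open>k\<close> solves the evolution of
  the remaining sites killed at rate \<open>1\<close> while \<open>x\<close> is flippable. By the maximum principle \<open>\<bar>k\<bar>\<close> is dominated by
  the solution started from \<open>g = 1\<close>, which decreases in time to a limit \<open>\<phi>\<close>; it remains to see \<open>\<phi> = 0\<close> almost
  surely. Dissipation of the \<open>L\<^sup>2\<close> norm makes the Dirichlet form vanish at \<open>h x * \<phi>\<close>, which is therefore
  almost surely invariant under legal flips. Zeros do not percolate, so legal flips can fill the finite
  cluster of zeros below \<open>x\<close>, flip \<open>x\<close>, and undo the filling: \<open>h x * \<phi>\<close> is also invariant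
  under the flip of \<open>x\<close>. As \<open>\<phi>\<close> ignores the spin at \<open>x\<close>, this forces \<open>\<phi> = 0\<close>.
\<close>

section \<open>Cylinder functions and the generator\<close>

text \<open>The killed semigroup is never constructed: applying \<open>slope\<close> to the
  evolution of the full process already yields a killed evolution, and the maximum principle
  supplies order and uniqueness. Dissipation is an L2 statement, while the conclusion is pointwise
  in the initial configuration. Monotonicity in time bridges the two: \<phi> exists at every
  configuration, so it suffices that the energy vanishes along one sequence of times. The dominating
  function starts from the single spin at \<open>x\<close>, whatever the other factors are. Hence
  there is one null set per site, and these countably many null sets serve all \<Lambda> and \<zeta>
  at once. Invariance under legal flips is known only almost surely, whereas the filling argument
  visits many configurations. This is repaired by passing to the configurations that remain good
  after every finite list of spin changes; they have full measure when 0 < p < 1, and p = 1 is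
  treated apart. The absence of infinite zero paths is used as well-foundedness of the relation
  along which the fillings are built.\<close>

definition depends_on :: "site set \<Rightarrow> (config \<Rightarrow> 'b) \<Rightarrow> bool" where
  "depends_on S f \<longleftrightarrow> (\<forall>\<sigma> \<tau>. (\<forall>x\<in>S. \<sigma> x = \<tau> x) \<longrightarrow> f \<sigma> = f \<tau>)"

lemma depends_onD: "depends_on S f \<Longrightarrow> (\<And>x. x \<in> S \<Longrightarrow> \<sigma> x = \<tau> x) \<Longrightarrow> f \<sigma> = f \<tau>"
  unfolding depends_on_def by blast

lemma depends_on_mono: "depends_on S f \<Longrightarrow> S \<subseteq> T \<Longrightarrow> depends_on T f"
  unfolding depends_on_def by blast

lemma depends_on_comp2:
  "depends_on S f \<Longrightarrow> depends_on S g \<Longrightarrow> depends_on S (\<lambda>\<sigma>. F (f \<sigma>) (g \<sigma>))"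
  unfolding depends_on_def by metis

lemma depends_on_const: "depends_on S (\<lambda>_. c)"
  unfolding depends_on_def by simp

lemma depends_on_sum:
  "(\<And>i. i \<in> I \<Longrightarrow> depends_on S (f i)) \<Longrightarrow> depends_on S (\<lambda>\<sigma>. \<Sum>i\<in>I. f i \<sigma>)"
  unfolding depends_on_def by (intro allI impI sum.cong[OF refl]) blast

lemma depends_on_prod:
  "(\<And>i. i \<in> I \<Longrightarrow> depends_on S (f i)) \<Longrightarrow> depends_on S (\<lambda>\<sigma>. \<Prod>i\<in>I. f i \<sigma>)"
  unfolding depends_on_def by (intro allI impI prod.cong[OF refl]) blast

lemma depends_on_update: "depends_on S f \<Longrightarrow> depends_on S (\<lambda>\<sigma>. f (\<sigma>(y := b)))"
  by (subst depends_on_def, intro allI impI, erule depends_onD) (simp add: fun_upd_apply)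

lemma cylinder_function_iff: "cylinder_function f \<longleftrightarrow> (\<exists>\<Lambda>. finite \<Lambda> \<and> depends_on \<Lambda> f)"
  unfolding cylinder_function_def depends_on_def ..

lemma cylinder_functionI: "finite \<Lambda> \<Longrightarrow> depends_on \<Lambda> f \<Longrightarrow> cylinder_function f"
  unfolding cylinder_function_iff by blast

lemma cylinder_function_comp2:
  assumes "cylinder_function f" "cylinder_function g"
  shows "cylinder_function (\<lambda>\<sigma>. F (f \<sigma>) (g \<sigma>))"
proof -
  obtain S T where "finite S" "depends_on S f" "finite T" "depends_on T g"
    using assms unfolding cylinder_function_iff by blast
  then show ?thesis
    using depends_on_mono[of S f "S \<union> T"] depends_on_mono[of T g "S \<union> T"]
    by (intro cylinder_functionI[of "S \<union> T"] depends_on_comp2[where F = F and f = f and g = g]) simp_all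
qed

lemma cylinder_function_const: "cylinder_function (\<lambda>_. c)"
  by (rule cylinder_functionI[of "{}"]) (auto intro: depends_on_const)

lemma cylinder_function_prod:
  assumes "finite A" "\<And>i. i \<in> A \<Longrightarrow> cylinder_function (f i)"
  shows "cylinder_function (\<lambda>\<sigma>. \<Prod>i\<in>A. f i \<sigma>)"
  using assms
proof (induction A rule: finite_induct)
  case empty
  then show ?case by (simp add: cylinder_function_const)
next
  case (insert x A)
  then have "cylinder_function (\<lambda>\<sigma>. f x \<sigma> * (\<Prod>i\<in>A. f i \<sigma>))"
    by (intro cylinder_function_comp2[where F = "(*)" and f = "f x"]) auto
  then show ?case using insert by simp
qed

text \<open>Every value is attained at a configuration vanishing off the finite support, and there
  are only finitely many of those.\<close>

lemma cylinder_finite_range: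
  assumes "cylinder_function f" shows "finite (range f)"
proof -
  obtain S where S: "finite S" "depends_on S f" using assms unfolding cylinder_function_iff by blast
  have "range f \<subseteq> (\<lambda>A. f (\<lambda>x. x \<in> A)) ` Pow S"
  proof
    fix r assume "r \<in> range f"
    then obtain \<sigma> where "r = f \<sigma>" by blast
    then have "r = f (\<lambda>x. x \<in> {x\<in>S. \<sigma> x})"
      using depends_onD[OF S(2), of \<sigma> "\<lambda>x. x \<in> {x\<in>S. \<sigma> x}"] by simp
    then show "r \<in> (\<lambda>A. f (\<lambda>x. x \<in> A)) ` Pow S" by blast
  qed
  then show ?thesis using S(1) finite_subset by blast
qed

text \<open>Provides an actual minimiser, at which the maximum principle evaluates the
  generator.\<close>

lemma cylinder_attains_min:
  assumes "cylinder_function f" obtains \<sigma> where "\<And>\<tau>. f \<sigma> \<le> f \<tau>"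
proof -
  have "Min (range f) \<in> range f" using cylinder_finite_range[OF assms] by (intro Min_in) auto
  then obtain \<sigma> where "Min (range f) = f \<sigma>" by blast
  then show ?thesis
    using that[of \<sigma>] Min_le[OF cylinder_finite_range[OF assms]] by (metis rangeI)
qed

lemma cylinder_continuous:
  assumes "cylinder_function f" shows "continuous_on UNIV f"
proof -
  obtain S where S: "finite S" "depends_on S f" using assms unfolding cylinder_function_iff by blast
  have "(f \<longlongrightarrow> f \<sigma>) (at \<sigma>)" for \<sigma>
  proof -
    have "\<forall>\<^sub>F \<tau> in nhds \<sigma>. \<forall>x\<in>S. \<tau> x = \<sigma> x"
      using S(1)
    proof (rule eventually_ball_finite, intro ballI)
      fix x
      have "open ((\<lambda>\<tau>::config. \<tau> x) -` {\<sigma> x})"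
        by (rule open_vimage[OF Topological_Spaces.open_discrete continuous_on_product_coordinates])
      also have "(\<lambda>\<tau>::config. \<tau> x) -` {\<sigma> x} = {\<tau>. \<tau> x = \<sigma> x}" by auto
      finally have "open {\<tau>::config. \<tau> x = \<sigma> x}" .
      then show "\<forall>\<^sub>F \<tau> in nhds \<sigma>. \<tau> x = \<sigma> x"
        unfolding eventually_nhds by blast
    qed
    then have "\<forall>\<^sub>F \<tau> in nhds \<sigma>. f \<tau> = f \<sigma>"
      by eventually_elim (use S(2) in \<open>auto intro: depends_onD\<close>)
    then have "(f \<longlongrightarrow> f \<sigma>) (nhds \<sigma>)" by (rule tendsto_eventually)
    moreover have "at \<sigma> \<le> nhds \<sigma>" by (simp add: at_within_def)
    ultimately show ?thesis using tendsto_mono by blast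
  qed
  then show ?thesis by (simp add: continuous_on_def)
qed

lemma cylinder_bcontfun:
  fixes f :: "config \<Rightarrow> real"
  assumes "cylinder_function f" shows "f \<in> bcontfun"
  unfolding bcontfun_def
  using cylinder_continuous[OF assms] finite_imp_bounded[OF cylinder_finite_range[OF assms]] by blast

text \<open>Real-valued because it serves both as a coefficient in the generator and as a killing
  rate.\<close>

definition flip_ind :: "site \<Rightarrow> config \<Rightarrow> real" where
  "flip_ind y \<sigma> = of_bool (y \<in> flippable \<sigma>)"

lemma west_south_neq [simp]: "west y \<noteq> y" "south y \<noteq> y" "y \<noteq> west y" "y \<noteq> south y"
  by (cases y; simp add: west_def south_def)+

lemma flip_ind_cases: "flip_ind y \<sigma> = 0 \<or> flip_ind y \<sigma> = 1"
  by (simp add: flip_ind_def)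

lemma flip_ind_nonneg: "0 \<le> flip_ind y \<sigma>"
  by (simp add: flip_ind_def)

lemma flip_ind_depends: "west y \<in> S \<Longrightarrow> south y \<in> S \<Longrightarrow> depends_on S (flip_ind y)"
  unfolding depends_on_def flip_ind_def flippable_def by simp

lemma flip_ind_cylinder: "cylinder_function (flip_ind y)"
  by (rule cylinder_functionI[of "{west y, south y}"]) (auto intro: flip_ind_depends)

lemma flip_ind_update [simp]: "flip_ind y (\<sigma>(y := b)) = flip_ind y \<sigma>"
  by (simp add: flip_ind_def flippable_def)

text \<open>Both branches are multiples of the same difference. The multipliers
  \<open>-(1 - p)\<close> and \<open>p\<close> have mean zero under the Bernoulli law, which is
  where stationarity of the product measure comes from.\<close>

lemma nabla_eq:
  "nabla p y f \<sigma> = (if \<sigma> y then -(1 - p) else p) * (f (\<sigma>(y := True)) - f (\<sigma>(y := False)))"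
  by (simp add: nabla_def algebra_simps)

lemma nabla_eq_zero:
  assumes "depends_on S f" "y \<notin> S" shows "nabla p y f \<sigma> = 0"
proof -
  have "f (\<sigma>(y := True)) = f (\<sigma>(y := False))"
    using assms(2) by (intro depends_onD[OF assms(1)]) auto
  then show ?thesis by (simp add: nabla_eq)
qed

text \<open>Any finite support will do; later proofs enlarge it so that a prescribed site occurs in
  the sum.\<close>

lemma northeast_op_eq_sum:
  assumes "finite \<Lambda>" "depends_on \<Lambda> f"
  shows "northeast_op p f \<sigma> = (\<Sum>y\<in>\<Lambda>. flip_ind y \<sigma> * nabla p y f \<sigma>)"
proof -
  have "northeast_op p f \<sigma> = (\<Sum>\<^sub>\<infinity>y\<in>\<Lambda> \<inter> flippable \<sigma>. nabla p y f \<sigma>)"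
    unfolding northeast_op_def
    by (rule infsum_cong_neutral) (use nabla_eq_zero[OF assms(2)] in auto)
  also have "\<dots> = (\<Sum>y\<in>\<Lambda> \<inter> flippable \<sigma>. nabla p y f \<sigma>)"
    using assms(1) by simp
  also have "\<dots> = (\<Sum>y\<in>\<Lambda>. if y \<in> flippable \<sigma> then nabla p y f \<sigma> else 0)"
    using assms(1) by (simp add: sum.inter_restrict)
  also have "\<dots> = (\<Sum>y\<in>\<Lambda>. flip_ind y \<sigma> * nabla p y f \<sigma>)"
    by (rule sum.cong) (auto simp: flip_ind_def)
  finally show ?thesis .
qed

text \<open>The flip indicators enlarge the support by western and southern neighbours only. The
  generator can therefore be applied twice to a cylinder function.\<close>

lemma northeast_op_cylinder:
  assumes "cylinder_function f" shows "cylinder_function (northeast_op p f)"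
proof -
  obtain \<Lambda> where L: "finite \<Lambda>" "depends_on \<Lambda> f" using assms unfolding cylinder_function_iff by blast
  let ?S = "\<Lambda> \<union> west ` \<Lambda> \<union> south ` \<Lambda>"
  have D: "depends_on ?S f" by (rule depends_on_mono[OF L(2)]) auto
  have "depends_on ?S (\<lambda>\<sigma>. flip_ind y \<sigma> * nabla p y f \<sigma>)" if "y \<in> \<Lambda>" for y
  proof -
    have "depends_on ?S (flip_ind y)"
      using that by (intro flip_ind_depends) auto
    moreover have "depends_on ?S (\<lambda>\<sigma>. if \<sigma> y then -(1 - p) else p)"
      using that by (simp add: depends_on_def)
    moreover have "depends_on ?S (\<lambda>\<sigma>. f (\<sigma>(y := True)) - f (\<sigma>(y := False)))"
      by (intro depends_on_comp2[where F = "(-)"] depends_on_update D)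
    ultimately show ?thesis
      unfolding nabla_eq by (intro depends_on_comp2[where F = "(*)"])
  qed
  then have "depends_on ?S (\<lambda>\<sigma>. \<Sum>y\<in>\<Lambda>. flip_ind y \<sigma> * nabla p y f \<sigma>)"
    by (rule depends_on_sum)
  moreover have "northeast_op p f = (\<lambda>\<sigma>. \<Sum>y\<in>\<Lambda>. flip_ind y \<sigma> * nabla p y f \<sigma>)"
    by (rule ext) (rule northeast_op_eq_sum[OF L])
  ultimately have "depends_on ?S (northeast_op p f)" by simp
  then show ?thesis using L(1) by (intro cylinder_functionI[of ?S]) auto
qed

lemma northeast_op_linear:
  assumes "cylinder_function f" "cylinder_function g"
  shows "northeast_op p (\<lambda>\<sigma>. a * f \<sigma> + b * g \<sigma>) \<sigma> = a * northeast_op p f \<sigma> + b * northeast_op p g \<sigma>"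
proof -
  obtain S T where S: "finite S" "depends_on S f" and T: "finite T" "depends_on T g"
    using assms unfolding cylinder_function_iff by blast
  have D: "depends_on (S \<union> T) f" "depends_on (S \<union> T) g" 
    using depends_on_mono[OF S(2), of "S \<union> T"] depends_on_mono[OF T(2), of "S \<union> T"] by auto
  have "northeast_op p (\<lambda>\<sigma>. a * f \<sigma> + b * g \<sigma>) \<sigma>
      = (\<Sum>y\<in>S \<union> T. flip_ind y \<sigma> * nabla p y (\<lambda>\<sigma>. a * f \<sigma> + b * g \<sigma>) \<sigma>)"
    using S T D
    by (intro northeast_op_eq_sum depends_on_comp2[where F = "\<lambda>u v. a * u + b * v" and f = f and g = g]) simp_all
  also have "\<dots> = (\<Sum>y\<in>S \<union> T. a * (flip_ind y \<sigma> * nabla p y f \<sigma>) + b * (flip_ind y \<sigma> * nabla p y g \<sigma>))"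
    by (rule sum.cong) (auto simp: nabla_eq algebra_simps)
  also have "\<dots> = a * northeast_op p f \<sigma> + b * northeast_op p g \<sigma>"
    using S(1) T(1)
    by (simp add: sum.distrib sum_distrib_left northeast_op_eq_sum[OF _ D(1)] northeast_op_eq_sum[OF _ D(2)])
  finally show ?thesis .
qed

text \<open>Every flip out of a minimiser can only raise \<open>f\<close>, and the rates are
  nonnegative.\<close>

lemma northeast_op_min_nonneg:
  assumes "p \<in> {0..1}" "cylinder_function f" "\<And>\<tau>. f \<sigma> \<le> f \<tau>"
  shows "0 \<le> northeast_op p f \<sigma>"
proof -
  obtain \<Lambda> where L: "finite \<Lambda>" "depends_on \<Lambda> f" using assms unfolding cylinder_function_iff by blast
  have "0 \<le> nabla p y f \<sigma>" for y
  proof (cases "\<sigma> y")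
    case True
    then have "\<sigma>(y := True) = \<sigma>" by (simp add: fun_upd_idem_iff)
    then show ?thesis using True assms(1) assms(3)[of "\<sigma>(y := False)"] by (simp add: nabla_def)
  next
    case False
    then have "\<sigma>(y := False) = \<sigma>" by (simp add: fun_upd_idem_iff)
    then show ?thesis using False assms(1) assms(3)[of "\<sigma>(y := True)"] by (simp add: nabla_def)
  qed
  then show ?thesis
    unfolding northeast_op_eq_sum[OF L] by (intro sum_nonneg mult_nonneg_nonneg flip_ind_nonneg)
qed

section \<open>A maximum principle for the killed evolution\<close>

text \<open>\<open>(f, g)\<close> lies in the uniform closure of the generator with killing rate \<open>V\<close>. The functions need not be
  continuous, which spares a continuity proof for \<open>slope\<close> below.\<close>

definition in_closure :: "real \<Rightarrow> (config \<Rightarrow> real) \<Rightarrow> (config \<Rightarrow> real) \<Rightarrow> (config \<Rightarrow> real) \<Rightarrow> bool" where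
  "in_closure p V f g \<longleftrightarrow> (\<forall>\<epsilon>>0. \<exists>c. cylinder_function c \<and> (\<forall>\<sigma>. \<bar>c \<sigma> - f \<sigma>\<bar> \<le> \<epsilon>) \<and>
     (\<forall>\<sigma>. \<bar>northeast_op p c \<sigma> - V \<sigma> * c \<sigma> - g \<sigma>\<bar> \<le> \<epsilon>))"

lemma in_closureE:
  assumes "in_closure p V f g" "\<epsilon> > 0"
  obtains c where "cylinder_function c" "\<And>\<sigma>. \<bar>c \<sigma> - f \<sigma>\<bar> \<le> \<epsilon>"
    "\<And>\<sigma>. \<bar>northeast_op p c \<sigma> - V \<sigma> * c \<sigma> - g \<sigma>\<bar> \<le> \<epsilon>"
  using assms unfolding in_closure_def by blast

lemma in_closure_linear:
  assumes "in_closure p V f g" "in_closure p V f' g'"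
  shows "in_closure p V (\<lambda>\<sigma>. a * f \<sigma> + b * f' \<sigma>) (\<lambda>\<sigma>. a * g \<sigma> + b * g' \<sigma>)"
  unfolding in_closure_def
proof (intro allI impI)
  fix \<epsilon> :: real assume "\<epsilon> > 0"
  \<comment> \<open>The summand 1 keeps the denominator positive when both coefficients
    vanish.\<close>
  define d where "d = \<epsilon> / (\<bar>a\<bar> + \<bar>b\<bar> + 1)"
  have d: "d > 0" using \<open>\<epsilon> > 0\<close> by (simp add: d_def add_nonneg_pos)
  have bound: "\<bar>a * x + b * y\<bar> \<le> \<epsilon>" if "\<bar>x\<bar> \<le> d" "\<bar>y\<bar> \<le> d" for x y
  proof -
    have "\<bar>a * x + b * y\<bar> \<le> \<bar>a\<bar> * \<bar>x\<bar> + \<bar>b\<bar> * \<bar>y\<bar>" by (metis abs_mult abs_triangle_ineq)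
    also have "\<dots> \<le> \<bar>a\<bar> * d + \<bar>b\<bar> * d" using that by (intro add_mono mult_left_mono) auto
    also have "\<dots> \<le> (\<bar>a\<bar> + \<bar>b\<bar> + 1) * d" using d by (simp add: algebra_simps)
    also have "\<dots> = \<epsilon>" by (simp add: d_def add_nonneg_pos)
    finally show ?thesis .
  qed
  obtain c where c: "cylinder_function c" "\<And>\<sigma>. \<bar>c \<sigma> - f \<sigma>\<bar> \<le> d"
    "\<And>\<sigma>. \<bar>northeast_op p c \<sigma> - V \<sigma> * c \<sigma> - g \<sigma>\<bar> \<le> d" using in_closureE[OF assms(1) d] by blast
  obtain c' where c': "cylinder_function c'" "\<And>\<sigma>. \<bar>c' \<sigma> - f' \<sigma>\<bar> \<le> d"
    "\<And>\<sigma>. \<bar>northeast_op p c' \<sigma> - V \<sigma> * c' \<sigma> - g' \<sigma>\<bar> \<le> d" using in_closureE[OF assms(2) d] by blast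
  show "\<exists>c. cylinder_function c \<and> (\<forall>\<sigma>. \<bar>c \<sigma> - (a * f \<sigma> + b * f' \<sigma>)\<bar> \<le> \<epsilon>) \<and>
     (\<forall>\<sigma>. \<bar>northeast_op p c \<sigma> - V \<sigma> * c \<sigma> - (a * g \<sigma> + b * g' \<sigma>)\<bar> \<le> \<epsilon>)"
  proof (intro exI[of _ "\<lambda>\<sigma>. a * c \<sigma> + b * c' \<sigma>"] conjI allI)
    show "cylinder_function (\<lambda>\<sigma>. a * c \<sigma> + b * c' \<sigma>)"
      by (rule cylinder_function_comp2[where F = "\<lambda>u v. a * u + b * v", OF c(1) c'(1)])
    fix \<sigma>
    show "\<bar>a * c \<sigma> + b * c' \<sigma> - (a * f \<sigma> + b * f' \<sigma>)\<bar> \<le> \<epsilon>"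
      using bound[OF c(2)[of \<sigma>] c'(2)[of \<sigma>]] by (simp add: algebra_simps)
    show "\<bar>northeast_op p (\<lambda>\<sigma>. a * c \<sigma> + b * c' \<sigma>) \<sigma> - V \<sigma> * (a * c \<sigma> + b * c' \<sigma>) - (a * g \<sigma> + b * g' \<sigma>)\<bar> \<le> \<epsilon>"
      unfolding northeast_op_linear[OF c(1) c'(1)]
      using bound[OF c(3)[of \<sigma>] c'(3)[of \<sigma>]] by (simp add: algebra_simps)
  qed
qed

text \<open>At a minimiser of a cylinder approximant with negative value, generator and killing term
  are both nonnegative, so \<open>g\<close> is nearly nonnegative there and the hypothesis bounds
  \<open>f\<close>. A nonnegative minimum is covered by \<open>0 \<le> m\<close>.\<close>

lemma in_closure_resolvent_lower_bound:
  assumes p: "p \<in> {0..1}" and cl: "in_closure p V f g" and V: "\<And>\<sigma>. 0 \<le> V \<sigma>"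
    and l: "0 \<le> l" and m: "0 \<le> m" and low: "\<And>\<sigma>. - m \<le> f \<sigma> - l * g \<sigma>"
  shows "- m \<le> f \<sigma>"
proof (rule field_le_epsilon)
  fix e :: real assume "e > 0"
  \<comment> \<open>The minimum of \<open>c\<close> loses \<open>\<epsilon> * (1 + l)\<close>;
    returning from \<open>c\<close> to \<open>f\<close> loses one more
    \<open>\<epsilon>\<close>.\<close>
  define \<epsilon> where "\<epsilon> = e / (2 + l)"
  have \<epsilon>: "\<epsilon> > 0" "\<epsilon> * (2 + l) = e" using \<open>e > 0\<close> l by (auto simp: \<epsilon>_def)
  obtain c where c: "cylinder_function c" "\<And>\<sigma>. \<bar>c \<sigma> - f \<sigma>\<bar> \<le> \<epsilon>"
    "\<And>\<sigma>. \<bar>northeast_op p c \<sigma> - V \<sigma> * c \<sigma> - g \<sigma>\<bar> \<le> \<epsilon>" using in_closureE[OF cl \<epsilon>(1)] by blast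
  obtain \<tau> where \<tau>: "\<And>\<sigma>. c \<tau> \<le> c \<sigma>" using cylinder_attains_min[OF c(1)] by blast
  have "- m - \<epsilon> * (1 + l) \<le> c \<tau>"
  proof (cases "c \<tau> \<ge> 0")
    case True
    moreover have "0 \<le> \<epsilon> * (1 + l)" using \<epsilon> l by simp
    ultimately show ?thesis using m by linarith
  next
    case False
    have "0 \<le> northeast_op p c \<tau> - V \<tau> * c \<tau>"
      using northeast_op_min_nonneg[OF p c(1) \<tau>] V[of \<tau>] False
      by (smt (verit) mult_nonneg_nonpos)
    then have "- \<epsilon> \<le> g \<tau>" using c(3)[of \<tau>] by linarith
    then have "l * (- \<epsilon>) \<le> l * g \<tau>" by (rule mult_left_mono[OF _ l])
    then show ?thesis using low[of \<tau>] c(2)[of \<tau>] by (simp add: algebra_simps)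
  qed
  then show "- m \<le> f \<sigma> + e" using \<tau>[of \<sigma>] c(2)[of \<sigma>] \<epsilon> by (simp add: algebra_simps)
qed

text \<open>\<open>w t\<close> is the backward derivative of \<open>v\<close> at \<open>t\<close>, uniformly in \<open>t\<close>: an implicit Euler step is what the
  resolvent bound controls, and uniformity lets finitely many equal steps reach any time.\<close>

definition evolution :: "real \<Rightarrow> (config \<Rightarrow> real) \<Rightarrow> (real \<Rightarrow> config \<Rightarrow> real) \<Rightarrow> (real \<Rightarrow> config \<Rightarrow> real) \<Rightarrow> bool" where
  "evolution p V v w \<longleftrightarrow> (\<forall>t\<ge>0. in_closure p V (v t) (w t)) \<and>
     (\<forall>\<epsilon>>0. \<exists>d>0. \<forall>l t \<sigma>. 0 < l \<longrightarrow> l < d \<longrightarrow> l \<le> t \<longrightarrow> \<bar>v t \<sigma> - v (t - l) \<sigma> - l * w t \<sigma>\<bar> \<le> \<epsilon> * l)"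

lemma evolution_stepE:
  assumes "evolution p V v w" "\<epsilon> > 0"
  obtains d where "d > 0"
    "\<And>l t \<sigma>. 0 < l \<Longrightarrow> l < d \<Longrightarrow> l \<le> t \<Longrightarrow> \<bar>v t \<sigma> - v (t - l) \<sigma> - l * w t \<sigma>\<bar> \<le> \<epsilon> * l"
  using assms unfolding evolution_def by meson

lemma evolution_linear:
  assumes "evolution p V v w" "evolution p V v' w'"
  shows "evolution p V (\<lambda>t \<sigma>. a * v t \<sigma> + b * v' t \<sigma>) (\<lambda>t \<sigma>. a * w t \<sigma> + b * w' t \<sigma>)"
  unfolding evolution_def
proof (intro conjI allI impI)
  fix t :: real assume "t \<ge> 0"
  then show "in_closure p V (\<lambda>\<sigma>. a * v t \<sigma> + b * v' t \<sigma>) (\<lambda>\<sigma>. a * w t \<sigma> + b * w' t \<sigma>)"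
    using assms by (intro in_closure_linear) (auto simp: evolution_def)
next
  fix \<epsilon> :: real assume "\<epsilon> > 0"
  define e where "e = \<epsilon> / (\<bar>a\<bar> + \<bar>b\<bar> + 1)"
  have e: "e > 0" using \<open>\<epsilon> > 0\<close> by (simp add: e_def add_nonneg_pos)
  obtain d where d: "d > 0"
    "\<And>l t \<sigma>. 0 < l \<Longrightarrow> l < d \<Longrightarrow> l \<le> t \<Longrightarrow> \<bar>v t \<sigma> - v (t - l) \<sigma> - l * w t \<sigma>\<bar> \<le> e * l"
    using evolution_stepE[OF assms(1) e] by metis
  obtain d' where d': "d' > 0"
    "\<And>l t \<sigma>. 0 < l \<Longrightarrow> l < d' \<Longrightarrow> l \<le> t \<Longrightarrow> \<bar>v' t \<sigma> - v' (t - l) \<sigma> - l * w' t \<sigma>\<bar> \<le> e * l"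
    using evolution_stepE[OF assms(2) e] by metis
  have "\<bar>(a * v t \<sigma> + b * v' t \<sigma>) - (a * v (t - l) \<sigma> + b * v' (t - l) \<sigma>) - l * (a * w t \<sigma> + b * w' t \<sigma>)\<bar> \<le> \<epsilon> * l"
    if l: "0 < l" "l < min d d'" "l \<le> t" for l t \<sigma>
  proof -
    let ?x = "v t \<sigma> - v (t - l) \<sigma> - l * w t \<sigma>" and ?y = "v' t \<sigma> - v' (t - l) \<sigma> - l * w' t \<sigma>"
    have "\<bar>a * ?x + b * ?y\<bar> \<le> \<bar>a\<bar> * \<bar>?x\<bar> + \<bar>b\<bar> * \<bar>?y\<bar>" by (metis abs_mult abs_triangle_ineq)
    also have "\<dots> \<le> \<bar>a\<bar> * (e * l) + \<bar>b\<bar> * (e * l)"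
      using l d(2)[of l t \<sigma>] d'(2)[of l t \<sigma>] by (intro add_mono mult_left_mono) auto
    also have "\<dots> \<le> (\<bar>a\<bar> + \<bar>b\<bar> + 1) * e * l" using e l by (simp add: algebra_simps)
    also have "\<dots> = \<epsilon> * l" by (simp add: e_def add_nonneg_pos)
    finally show ?thesis by (simp add: algebra_simps)
  qed
  then show "\<exists>d>0. \<forall>l t \<sigma>. 0 < l \<longrightarrow> l < d \<longrightarrow> l \<le> t \<longrightarrow>
      \<bar>(a * v t \<sigma> + b * v' t \<sigma>) - (a * v (t - l) \<sigma> + b * v' (t - l) \<sigma>) - l * (a * w t \<sigma> + b * w' t \<sigma>)\<bar> \<le> \<epsilon> * l"
    using d(1) d'(1) by (intro exI[of _ "min d d'"]) auto
qed

lemma evolution_shift: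
  assumes "evolution p V v w" "0 \<le> s"
  shows "evolution p V (\<lambda>t. v (t + s)) (\<lambda>t. w (t + s))"
  unfolding evolution_def
proof (intro conjI allI impI)
  fix t :: real assume "t \<ge> 0"
  then show "in_closure p V (v (t + s)) (w (t + s))" using assms by (simp add: evolution_def)
next
  fix \<epsilon> :: real assume "\<epsilon> > 0"
  obtain d where d: "d > 0"
    "\<And>l t \<sigma>. 0 < l \<Longrightarrow> l < d \<Longrightarrow> l \<le> t \<Longrightarrow> \<bar>v t \<sigma> - v (t - l) \<sigma> - l * w t \<sigma>\<bar> \<le> \<epsilon> * l"
    using evolution_stepE[OF assms(1) \<open>\<epsilon> > 0\<close>] by metis
  have "\<bar>v (t + s) \<sigma> - v (t - l + s) \<sigma> - l * w (t + s) \<sigma>\<bar> \<le> \<epsilon> * l"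
    if "0 < l" "l < d" "l \<le> t" for l t \<sigma>
    using d(2)[of l "t + s" \<sigma>] that assms(2) by (simp add: algebra_simps)
  with d(1) show "\<exists>d>0. \<forall>l t \<sigma>. 0 < l \<longrightarrow> l < d \<longrightarrow> l \<le> t \<longrightarrow>
      \<bar>v (t + s) \<sigma> - v (t - l + s) \<sigma> - l * w (t + s) \<sigma>\<bar> \<le> \<epsilon> * l" by blast
qed

text \<open>Each implicit Euler step preserves the lower bound up to \<open>\<epsilon> * l\<close>
  by the resolvent estimate, and the losses add up to an arbitrarily small amount at time
  \<open>t\<close>.\<close>

lemma evolution_lower_bound:
  assumes p: "p \<in> {0..1}" and ev: "evolution p V v w" and V: "\<And>\<sigma>. 0 \<le> V \<sigma>"
    and m: "0 \<le> m" and init: "\<And>\<sigma>. - m \<le> v 0 \<sigma>" and t: "0 \<le> t"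
  shows "- m \<le> v t \<sigma>"
proof (rule field_le_epsilon)
  fix e :: real assume "e > 0"
  show "- m \<le> v t \<sigma> + e"
  proof (cases "t = 0")
    case True
    then show ?thesis using init[of \<sigma>] \<open>e > 0\<close> by simp
  next
    case False
    then have "t > 0" using t by simp
    \<comment> \<open>An error rate per unit of time: \<open>n\<close> steps of length
      \<open>t / n\<close> together lose \<open>e\<close>.\<close>
    define \<epsilon> where "\<epsilon> = e / t"
    have "\<epsilon> > 0" using \<open>e > 0\<close> \<open>t > 0\<close> by (simp add: \<epsilon>_def)
    obtain d where d: "d > 0"
      "\<And>l t \<sigma>. 0 < l \<Longrightarrow> l < d \<Longrightarrow> l \<le> t \<Longrightarrow> \<bar>v t \<sigma> - v (t - l) \<sigma> - l * w t \<sigma>\<bar> \<le> \<epsilon> * l"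
      using evolution_stepE[OF ev \<open>\<epsilon> > 0\<close>] by metis
    obtain n :: nat where n: "t / d < real n" using reals_Archimedean2 by blast
    moreover have "t / d > 0" using \<open>t > 0\<close> d(1) by simp
    ultimately have "real n > 0" by linarith
    define l where "l = t / real n"
    have l: "0 < l" "l < d" "real n * l = t"
      using n \<open>real n > 0\<close> \<open>t > 0\<close> d(1) by (auto simp: l_def field_simps)
    have "- (m + real j * (\<epsilon> * l)) \<le> v (real j * l) \<tau>" for j \<tau>
    proof (induction j arbitrary: \<tau>)
      case 0
      then show ?case using init by simp
    next
      case (Suc j)
      let ?t = "real (Suc j) * l"
      have t': "?t - l = real j * l" "l \<le> ?t" "0 \<le> ?t" using l(1) by (auto simp: algebra_simps)
      have "- (m + real (Suc j) * (\<epsilon> * l)) \<le> v ?t \<rho> - l * w ?t \<rho>" for \<rho>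
        using Suc[of \<rho>] d(2)[OF l(1,2) t'(2), of \<rho>] unfolding t'(1) by (simp add: algebra_simps)
      moreover have "in_closure p V (v ?t) (w ?t)" using ev t'(3) by (simp add: evolution_def)
      moreover have "0 \<le> m + real (Suc j) * (\<epsilon> * l)" using m l(1) \<open>\<epsilon> > 0\<close> by simp
      ultimately show ?case
        using in_closure_resolvent_lower_bound[where p = p and V = V and f = "v ?t" and g = "w ?t" and l = l
            and m = "m + real (Suc j) * (\<epsilon> * l)" and \<sigma> = \<tau>] p V l(1)
        by (metis less_imp_le)
    qed
    from this[of n \<sigma>] have "- (m + \<epsilon> * t) \<le> v t \<sigma>" using l(3) by (simp add: algebra_simps)
    then show ?thesis using \<open>t > 0\<close> by (simp add: \<epsilon>_def)
  qed
qed

section \<open>The product measure and the response to a single spin\<close>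

lemma space_bernoulli_UNIV [simp]: "space (\<nu> p) = UNIV"
  by (simp add: bernoulli_field_def space_PiM)

lemma prob_space_bernoulli: "prob_space (bernoulli_field \<Lambda> p)"
  unfolding bernoulli_field_def by (intro prob_space_PiM prob_space_measure_pmf)

lemma measurable_bernoulli_coord [measurable]: "(\<lambda>\<sigma>. \<sigma> x) \<in> measurable (\<nu> p) (count_space UNIV)"
proof -
  have "(\<lambda>\<sigma>. \<sigma> x) \<in> measurable (\<nu> p) (measure_pmf (bernoulli_pmf p))"
    unfolding bernoulli_field_def by (rule measurable_component_singleton) simp
  then show ?thesis by (simp add: measurable_def)
qed

lemma measurable_into_bernoulli:
  assumes "\<And>x. (\<lambda>a. f a x) \<in> measurable M (count_space UNIV)"
  shows "f \<in> measurable M (\<nu> p)"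
  unfolding bernoulli_field_def
proof (rule measurable_PiM_single')
  fix x show "(\<lambda>a. f a x) \<in> measurable M (measure_pmf (bernoulli_pmf p))"
    using assms[of x] by (simp add: measurable_def)
qed (simp add: PiE_def)

lemma measurable_bernoulli_update [measurable]: "(\<lambda>\<tau>. \<tau>(y := b)) \<in> measurable (\<nu> p) (\<nu> q)"
proof (rule measurable_into_bernoulli)
  fix x show "(\<lambda>\<tau>. (\<tau>(y := b)) x) \<in> measurable (\<nu> p) (count_space UNIV)"
    by (cases "x = y") auto
qed

lemma cylinder_measurable:
  fixes f :: "config \<Rightarrow> real"
  assumes "cylinder_function f" shows "f \<in> borel_measurable (\<nu> p)"
proof -
  obtain S where S: "finite S" "depends_on S f" using assms unfolding cylinder_function_iff by blast
  have "(\<lambda>\<sigma>. {x\<in>S. \<sigma> x}) \<in> measurable (\<nu> p) (count_space (Pow S))"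
  proof (subst measurable_count_space_eq2, use S in simp, intro conjI ballI)
    fix A assume "A \<in> Pow S"
    then have "(\<lambda>\<sigma>. {x\<in>S. \<sigma> x}) -` {A} \<inter> space (\<nu> p) = {\<sigma>\<in>space (\<nu> p). \<forall>x\<in>S. \<sigma> x = (x \<in> A)}"
      by auto
    also have "\<dots> \<in> sets (\<nu> p)" using S(1) by measurable
    finally show "(\<lambda>\<sigma>. {x\<in>S. \<sigma> x}) -` {A} \<inter> space (\<nu> p) \<in> sets (\<nu> p)" .
  qed auto
  moreover have "(\<lambda>A. f (\<lambda>x. x \<in> A)) \<in> measurable (count_space (Pow S)) borel" by simp
  ultimately have "(\<lambda>\<sigma>. f (\<lambda>x. x \<in> {x\<in>S. \<sigma> x})) \<in> borel_measurable (\<nu> p)"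
    by (rule measurable_compose)
  moreover have "f (\<lambda>x. x \<in> {x\<in>S. \<sigma> x}) = f \<sigma>" for \<sigma>
    by (rule depends_onD[OF S(2)]) simp
  ultimately show ?thesis by simp
qed

lemma integrable_bernoulli_bounded:
  fixes F :: "config \<Rightarrow> real"
  assumes "F \<in> borel_measurable (\<nu> p)" "\<And>\<sigma>. \<bar>F \<sigma>\<bar> \<le> C"
  shows "integrable (\<nu> p) F"
proof -
  interpret prob_space "\<nu> p" by (rule prob_space_bernoulli)
  show ?thesis using assms by (intro integrable_const_bound[of _ C]) auto
qed

lemma cylinder_bounded:
  fixes f :: "config \<Rightarrow> real"
  assumes "cylinder_function f" obtains C where "0 \<le> C" "\<And>\<sigma>. \<bar>f \<sigma>\<bar> \<le> C"
proof -
  have "bounded (range f)" by (rule finite_imp_bounded[OF cylinder_finite_range[OF assms]])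
  then obtain C where "\<And>\<sigma>. \<bar>f \<sigma>\<bar> \<le> C" by (auto simp: bounded_iff)
  then show ?thesis using that[of "max 0 C"] by (simp add: le_max_iff_disj)
qed

text \<open>The product over \<open>insert y UNIV\<close>, with \<open>y\<close> already a member:
  overwriting one coordinate by an independent Bernoulli spin does not change the law.\<close>

lemma distr_bernoulli_resample:
  "distr (measure_pmf (bernoulli_pmf p) \<Otimes>\<^sub>M \<nu> p) (\<nu> p) (\<lambda>(b, \<tau>). \<tau>(y := b)) = \<nu> p"
  using distr_pair_PiM_eq_PiM[of UNIV "\<lambda>_. measure_pmf (bernoulli_pmf p)" y]
  by (simp add: bernoulli_field_def prob_space_measure_pmf)

lemma measurable_resample [measurable]:
  "(\<lambda>(b, \<tau>). \<tau>(y := b)) \<in> measurable (measure_pmf (bernoulli_pmf p) \<Otimes>\<^sub>M \<nu> p) (\<nu> p)"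
proof (rule measurable_into_bernoulli)
  fix x
  show "(\<lambda>a. (case a of (b, \<tau>) \<Rightarrow> \<tau>(y := b)) x) \<in>
      measurable (measure_pmf (bernoulli_pmf p) \<Otimes>\<^sub>M \<nu> p) (count_space UNIV)"
    by (cases "x = y") (auto simp: case_prod_beta' intro!: measurable_compose[OF measurable_fst] measurable_compose[OF measurable_snd])
qed

text \<open>The conditional expectation over the spin at \<open>y\<close> made explicit; all
  integrations by parts below reduce to it.\<close>

lemma integral_resample:
  fixes F :: "config \<Rightarrow> real"
  assumes p: "p \<in> {0..1}" and F[measurable]: "F \<in> borel_measurable (\<nu> p)" and C: "\<And>\<sigma>. \<bar>F \<sigma>\<bar> \<le> C"
  shows "(\<integral>\<tau>. F \<tau> \<partial>\<nu> p) = (\<integral>\<tau>. p * F (\<tau>(y := True)) + (1 - p) * F (\<tau>(y := False)) \<partial>\<nu> p)"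
proof -
  let ?B = "measure_pmf (bernoulli_pmf p)"
  interpret N: prob_space "\<nu> p" by (rule prob_space_bernoulli)
  interpret BN: pair_prob_space ?B "\<nu> p" ..
  have int: "integrable (\<nu> p) (\<lambda>\<tau>. F (\<tau>(y := b)))" for b
    by (rule integrable_bernoulli_bounded[OF _ C]) measurable
  have "(\<integral>\<tau>. F \<tau> \<partial>\<nu> p) = (\<integral>x. F (case x of (b, \<tau>) \<Rightarrow> \<tau>(y := b)) \<partial>(?B \<Otimes>\<^sub>M \<nu> p))"
    by (subst distr_bernoulli_resample[of p y, symmetric], rule integral_distr) measurable
  also have "\<dots> = (\<integral>b. (\<integral>\<tau>. F (\<tau>(y := b)) \<partial>\<nu> p) \<partial>?B)"
    using C by (subst BN.integral_fst'[symmetric])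
       (auto intro!: BN.P.integrable_const_bound[of _ C] simp: case_prod_beta')
  also have "\<dots> = p * (\<integral>\<tau>. F (\<tau>(y := True)) \<partial>\<nu> p) + (1 - p) * (\<integral>\<tau>. F (\<tau>(y := False)) \<partial>\<nu> p)"
    using p by simp
  also have "\<dots> = (\<integral>\<tau>. p * F (\<tau>(y := True)) + (1 - p) * F (\<tau>(y := False)) \<partial>\<nu> p)"
    using int by simp
  finally show ?thesis .
qed

text \<open>Both spin values have positive probability, so forcing a spin is absolutely continuous
  with respect to resampling it.\<close>

lemma AE_bernoulli_update:
  assumes p: "0 < p" "p < 1" and AE: "AE \<sigma> in \<nu> p. Q \<sigma>"
  shows "AE \<sigma> in \<nu> p. Q (\<sigma>(y := b))"
proof -
  let ?B = "measure_pmf (bernoulli_pmf p)"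
  interpret N: prob_space "\<nu> p" by (rule prob_space_bernoulli)
  interpret BN: pair_prob_space ?B "\<nu> p" ..
  \<comment> \<open>\<open>Q\<close> need not be measurable, so the argument runs on a measurable
    null superset of its failure set.\<close>
  obtain N where N: "{\<sigma>. \<not> Q \<sigma>} \<subseteq> N" "N \<in> null_sets (\<nu> p)"
    using AE unfolding eventually_ae_filter by auto
  have "AE \<sigma> in \<nu> p. \<sigma> \<notin> N" using N(2) by (rule AE_not_in)
  then have "AE \<sigma> in distr (?B \<Otimes>\<^sub>M \<nu> p) (\<nu> p) (\<lambda>(b, \<tau>). \<tau>(y := b)). \<sigma> \<notin> N"
    unfolding distr_bernoulli_resample .
  then have "AE x in ?B \<Otimes>\<^sub>M \<nu> p. (case x of (b, \<tau>) \<Rightarrow> \<tau>(y := b)) \<notin> N"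
    by (rule AE_distrD[rotated]) measurable
  then have "AE x in ?B \<Otimes>\<^sub>M \<nu> p. (snd x)(y := fst x) \<notin> N"
    by (simp add: case_prod_beta')
  then have "AE b in ?B. AE \<tau> in \<nu> p. \<tau>(y := b) \<notin> N"
    using BN.AE_pair[of "\<lambda>x. (snd x)(y := fst x) \<notin> N"] by simp
  then have "AE \<tau> in \<nu> p. \<tau>(y := b) \<notin> N"
    using p by (auto simp: AE_measure_pmf_iff set_pmf_bernoulli split: if_splits)
  then show ?thesis using N(1) by (auto elim: eventually_mono)
qed

text \<open>Averaging over the spin at \<open>y\<close> weights the two rates to
  \<open>p * (-(1 - p)) + (1 - p) * p = 0\<close>, and \<open>W\<close> factors out because it
  ignores that spin.\<close>

lemma integral_nabla_zero:
  assumes p: "p \<in> {0..1}" and [measurable]: "W \<in> borel_measurable (\<nu> p)" "c \<in> borel_measurable (\<nu> p)"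
    and W: "\<And>\<tau> b. W (\<tau>(y := b)) = W \<tau>" "\<And>\<tau>. \<bar>W \<tau>\<bar> \<le> 1" and C: "\<And>\<tau>. \<bar>c \<tau>\<bar> \<le> C"
  shows "(\<integral>\<tau>. W \<tau> * nabla p y c \<tau> \<partial>\<nu> p) = 0"
proof -
  have m: "(\<lambda>\<tau>. W \<tau> * nabla p y c \<tau>) \<in> borel_measurable (\<nu> p)"
    unfolding nabla_eq by measurable
  have "\<bar>nabla p y c \<tau>\<bar> \<le> 2 * C" for \<tau>
  proof -
    have "\<bar>nabla p y c \<tau>\<bar> \<le> 1 * \<bar>c (\<tau>(y := True)) - c (\<tau>(y := False))\<bar>"
      unfolding nabla_eq abs_mult using p by (intro mult_right_mono) auto
    also have "\<dots> \<le> 2 * C"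
      using abs_triangle_ineq4[of "c (\<tau>(y := True))" "c (\<tau>(y := False))"]
        C[of "\<tau>(y := True)"] C[of "\<tau>(y := False)"] by simp
    finally show ?thesis .
  qed
  then have b: "\<bar>W \<tau> * nabla p y c \<tau>\<bar> \<le> 2 * C" for \<tau>
    using mult_mono[OF W(2)[of \<tau>], of "\<bar>nabla p y c \<tau>\<bar>" "2 * C"] by (simp add: abs_mult)
  show ?thesis
    by (subst integral_resample[OF p m b, of y]) (simp add: W(1) nabla_eq algebra_simps)
qed

text \<open>The spin at \<open>x\<close> cannot influence the sites of \<open>past x\<close>, which is closed under \<open>west\<close> and \<open>south\<close>.\<close>

definition past :: "site \<Rightarrow> site set" where
  "past x = {y. \<not> (fst x \<le> fst y \<and> snd x \<le> snd y)}"

lemma past_west: "y \<in> past x \<Longrightarrow> west y \<in> past x" and past_south: "y \<in> past x \<Longrightarrow> south y \<in> past x"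
  by (auto simp: past_def west_def south_def)

lemma west_in_past: "west x \<in> past x" and south_in_past: "south x \<in> past x" and not_in_past [simp]: "x \<notin> past x"
  by (auto simp: past_def west_def south_def)

text \<open>Integrating over \<open>\<tau>\<close> gives the conditional expectation given the spins
  in \<open>past x\<close>, in a version defined at every \<open>\<sigma>\<close>.\<close>

definition graft :: "site \<Rightarrow> config \<Rightarrow> config \<Rightarrow> config" where
  "graft x \<sigma> \<tau> = (\<lambda>z. if z \<in> past x then \<sigma> z else \<tau> z)"

definition spin_dev :: "real \<Rightarrow> site \<Rightarrow> config \<Rightarrow> real" where
  "spin_dev p x \<sigma> = of_bool (\<sigma> x) - p"

text \<open>Averaging over the sites outside \<open>past x\<close> removes their flip terms, because each of them has mean zero in
  the flipped coordinate; the flips at \<open>x\<close> itself survive as killing at rate \<open>flip_ind x\<close>. The map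
  \<open>f \<mapsto> spin_dev p x * slope p x f\<close> is thus a projection commuting with the generator.\<close>

definition slope :: "real \<Rightarrow> site \<Rightarrow> (config \<Rightarrow> real) \<Rightarrow> config \<Rightarrow> real" where
  "slope p x f \<sigma> = (\<integral>\<tau>. f ((graft x \<sigma> \<tau>)(x := True)) - f ((graft x \<sigma> \<tau>)(x := False)) \<partial>\<nu> p)"

lemma graft_measurable [measurable]: "(\<lambda>\<tau>. (graft x \<sigma> \<tau>)(z := b)) \<in> measurable (\<nu> p) (\<nu> q)"
proof (rule measurable_into_bernoulli)
  fix y show "(\<lambda>\<tau>. ((graft x \<sigma> \<tau>)(z := b)) y) \<in> measurable (\<nu> p) (count_space UNIV)"
    by (cases "y = z"; cases "y \<in> past x") (auto simp: graft_def)
qed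

lemma spin_dev_cylinder: "cylinder_function (spin_dev p x)"
  by (rule cylinder_functionI[of "{x}"]) (auto simp: depends_on_def spin_dev_def)

lemma slope_depends: "depends_on (past x) (slope p x f)"
proof -
  have "slope p x f \<sigma> = slope p x f \<sigma>'" if "\<And>z. z \<in> past x \<Longrightarrow> \<sigma> z = \<sigma>' z" for \<sigma> \<sigma>'
  proof -
    have "graft x \<sigma> = graft x \<sigma>'" using that by (auto simp: graft_def fun_eq_iff)
    then show ?thesis by (simp add: slope_def)
  qed
  then show ?thesis unfolding depends_on_def by blast
qed

lemma slope_depends_inter:
  assumes "depends_on S f" shows "depends_on (S \<inter> past x) (slope p x f)"
  unfolding depends_on_def
proof (intro allI impI)
  fix \<sigma> \<sigma>' :: config assume "\<forall>z\<in>S \<inter> past x. \<sigma> z = \<sigma>' z"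
  then have "f ((graft x \<sigma> \<tau>)(x := b)) = f ((graft x \<sigma>' \<tau>)(x := b))" for \<tau> b
    by (intro depends_onD[OF assms]) (auto simp: graft_def)
  then show "slope p x f \<sigma> = slope p x f \<sigma>'" by (simp add: slope_def)
qed

lemma slope_cylinder: "cylinder_function f \<Longrightarrow> cylinder_function (slope p x f)"
  unfolding cylinder_function_iff[of f]
  by (auto intro!: cylinder_functionI[OF _ slope_depends_inter])

lemma slope_integrable:
  fixes f :: "config \<Rightarrow> real"
  assumes "f \<in> borel_measurable (\<nu> p)" "\<And>\<sigma>. \<bar>f \<sigma>\<bar> \<le> C"
  shows "integrable (\<nu> p) (\<lambda>\<tau>. f ((graft x \<sigma> \<tau>)(z := b)))"
proof (rule integrable_bernoulli_bounded[where C = C])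
  show "(\<lambda>\<tau>. f ((graft x \<sigma> \<tau>)(z := b))) \<in> borel_measurable (\<nu> p)"
    by (rule measurable_compose[OF graft_measurable assms(1)])
qed (rule assms(2))

lemma slope_linear:
  assumes "f \<in> borel_measurable (\<nu> p)" "\<And>\<sigma>. \<bar>f \<sigma>\<bar> \<le> C"
    and "g \<in> borel_measurable (\<nu> p)" "\<And>\<sigma>. \<bar>g \<sigma>\<bar> \<le> D"
  shows "slope p x (\<lambda>\<sigma>. a * f \<sigma> + b * g \<sigma>) \<sigma> = a * slope p x f \<sigma> + b * slope p x g \<sigma>"
  using slope_integrable[OF assms(1,2)] slope_integrable[OF assms(3,4)]
  unfolding slope_def by (simp add: algebra_simps)

lemma slope_abs_le:
  assumes "f \<in> borel_measurable (\<nu> p)" "\<And>\<sigma>. \<bar>f \<sigma>\<bar> \<le> C"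
  shows "\<bar>slope p x f \<sigma>\<bar> \<le> 2 * C"
proof -
  interpret N: prob_space "\<nu> p" by (rule prob_space_bernoulli)
  let ?F = "\<lambda>\<tau>. f ((graft x \<sigma> \<tau>)(x := True)) - f ((graft x \<sigma> \<tau>)(x := False))"
  have i: "integrable (\<nu> p) ?F" using slope_integrable[OF assms] by simp
  have b: "\<bar>?F \<tau>\<bar> \<le> 2 * C" for \<tau>
    using assms(2)[of "(graft x \<sigma> \<tau>)(x := True)"] assms(2)[of "(graft x \<sigma> \<tau>)(x := False)"] by linarith
  have "\<bar>slope p x f \<sigma>\<bar> \<le> (\<integral>\<tau>. \<bar>?F \<tau>\<bar> \<partial>\<nu> p)"
    unfolding slope_def by (rule integral_abs_bound)
  also have "\<dots> \<le> (\<integral>\<tau>. 2 * C \<partial>\<nu> p)"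
    using b i by (intro integral_mono) auto
  finally show ?thesis using N.prob_space by simp
qed

text \<open>The centred spin jumps by exactly 1 at \<open>x\<close>, so \<open>slope\<close>
  recovers the other factor without a normalising constant.\<close>

lemma slope_spin_dev_mult:
  assumes "depends_on (past x) g"
  shows "slope p x (\<lambda>\<sigma>. spin_dev p x \<sigma> * g \<sigma>) \<sigma> = g \<sigma>"
proof -
  interpret N: prob_space "\<nu> p" by (rule prob_space_bernoulli)
  have "g ((graft x \<sigma> \<tau>)(x := b)) = g \<sigma>" for \<tau> b
    by (rule depends_onD[OF assms]) (auto simp: graft_def)
  then show ?thesis
    using N.prob_space by (simp add: slope_def spin_dev_def algebra_simps)
qed

text \<open>At sites other than \<open>x\<close> the centred spin is a constant factor. At
  \<open>x\<close> the up and down rates add up to 1, so \<open>nabla\<close> maps the centred spin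
  to its negative; this is the killing term.\<close>

lemma northeast_op_spin_dev_mult:
  assumes k: "cylinder_function k" and dep: "depends_on (past x) k"
  shows "northeast_op p (\<lambda>\<sigma>. spin_dev p x \<sigma> * k \<sigma>) \<sigma>
    = spin_dev p x \<sigma> * (northeast_op p k \<sigma> - flip_ind x \<sigma> * k \<sigma>)"
proof -
  obtain S where S: "finite S" "depends_on S k" using k unfolding cylinder_function_iff by blast
  have Dk: "depends_on (insert x S) k" using depends_on_mono[OF S(2), of "insert x S"] by auto
  have "depends_on (insert x S) (spin_dev p x)" by (auto simp: depends_on_def spin_dev_def)
  then have Df: "depends_on (insert x S) (\<lambda>\<sigma>. spin_dev p x \<sigma> * k \<sigma>)"
    using Dk by (rule depends_on_comp2[where F = "(*)"])
  have upd: "k (\<sigma>(x := b)) = k \<sigma>" for \<sigma> b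
    by (rule depends_onD[OF dep]) auto
  have "flip_ind y \<sigma> * nabla p y (\<lambda>\<sigma>. spin_dev p x \<sigma> * k \<sigma>) \<sigma>
      = spin_dev p x \<sigma> * (flip_ind y \<sigma> * nabla p y k \<sigma>) - (if y = x then spin_dev p x \<sigma> * (flip_ind x \<sigma> * k \<sigma>) else 0)" for y
    by (cases "y = x") (auto simp: nabla_eq spin_dev_def upd algebra_simps)
  then show ?thesis
    using S(1) by (simp add: northeast_op_eq_sum[OF _ Df] northeast_op_eq_sum[OF _ Dk] sum_subtractf
        sum_distrib_left right_diff_distrib)
qed

lemma flip_nabla_cylinder:
  assumes c: "cylinder_function c"
  shows "cylinder_function (\<lambda>\<sigma>. flip_ind y \<sigma> * nabla p y c \<sigma>)"
proof -
  obtain S where S: "finite S" "depends_on S c" using c unfolding cylinder_function_iff by blast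
  have D: "depends_on (insert y S) c" by (rule depends_on_mono[OF S(2)]) auto
  have "depends_on (insert y S) (\<lambda>\<sigma>. if \<sigma> y then -(1 - p) else p)" by (simp add: depends_on_def)
  moreover have "depends_on (insert y S) (\<lambda>\<sigma>. c (\<sigma>(y := True)) - c (\<sigma>(y := False)))"
    by (intro depends_on_comp2[where F = "(-)"] depends_on_update D)
  ultimately have "depends_on (insert y S) (nabla p y c)"
    unfolding nabla_eq[abs_def] by (intro depends_on_comp2[where F = "(*)"])
  then have "cylinder_function (nabla p y c)" using S(1) by (intro cylinder_functionI) auto
  with flip_ind_cylinder show ?thesis by (rule cylinder_function_comp2[where F = "(*)"])
qed

text \<open>The site-by-site form of the commutation. The position of \<open>y\<close> relative to
  \<open>x\<close> decides whether the flip term commutes with the average, becomes killing, or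
  averages to zero.\<close>

lemma slope_nabla:
  assumes p: "p \<in> {0..1}" and c: "cylinder_function c"
  shows "slope p x (\<lambda>\<sigma>. flip_ind y \<sigma> * nabla p y c \<sigma>) \<sigma> =
     flip_ind y \<sigma> * nabla p y (slope p x c) \<sigma> - (if y = x then flip_ind x \<sigma> * slope p x c \<sigma> else 0)"
proof -
  obtain C where C: "\<And>\<sigma>. \<bar>c \<sigma>\<bar> \<le> C" using cylinder_bounded[OF c] by blast
  note cm[measurable] = cylinder_measurable[OF c, of p]
  note int = slope_integrable[OF cm C, where x = x]
  consider "y \<in> past x" | "y = x" | "y \<notin> past x" "y \<noteq> x" by blast
  then show ?thesis
  proof cases
    \<comment> \<open>The spin and the neighbours of \<open>y\<close> all lie in the past, so
      grafting leaves them at their values in \<open>\<sigma>\<close>.\<close>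
    case 1
    then have "y \<noteq> x" by auto
    have fl: "flip_ind y ((graft x \<sigma> \<tau>)(x := b)) = flip_ind y \<sigma>" for \<tau> b
      using past_west[OF 1] past_south[OF 1] not_in_past[of x]
      by (auto simp: flip_ind_def flippable_def graft_def)
    have up: "((graft x \<sigma> \<tau>)(x := b))(y := d) = (graft x (\<sigma>(y := d)) \<tau>)(x := b)" for \<tau> b d
      using 1 \<open>y \<noteq> x\<close> by (auto simp: graft_def fun_eq_iff)
    have vy: "((graft x \<sigma> \<tau>)(x := b)) y = \<sigma> y" for \<tau> b
      using 1 \<open>y \<noteq> x\<close> by (auto simp: graft_def)
    have "slope p x (\<lambda>\<sigma>. flip_ind y \<sigma> * nabla p y c \<sigma>) \<sigma> =
      (\<integral>\<tau>. flip_ind y \<sigma> * (if \<sigma> y then -(1 - p) else p) *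
         ((c ((graft x (\<sigma>(y := True)) \<tau>)(x := True)) - c ((graft x (\<sigma>(y := True)) \<tau>)(x := False)))
         - (c ((graft x (\<sigma>(y := False)) \<tau>)(x := True)) - c ((graft x (\<sigma>(y := False)) \<tau>)(x := False)))) \<partial>\<nu> p)"
      unfolding slope_def nabla_eq fl up vy by (intro Bochner_Integration.integral_cong refl) (simp add: algebra_simps)
    also have "\<dots> = flip_ind y \<sigma> * nabla p y (slope p x c) \<sigma>"
      using int unfolding nabla_eq slope_def by simp
    finally show ?thesis using \<open>y \<noteq> x\<close> by simp
  next
    \<comment> \<open>The values of \<open>nabla\<close> at spin 1 and spin 0 differ by
      \<open>-(1 - p) - p = -1\<close> times the jump of \<open>c\<close>.\<close>
    case 2
    have fl: "flip_ind x ((graft x \<sigma> \<tau>)(x := b)) = flip_ind x \<sigma>" for \<tau> b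
      using west_in_past[of x] south_in_past[of x] by (simp add: flip_ind_def flippable_def graft_def)
    have "slope p x (\<lambda>\<sigma>. flip_ind x \<sigma> * nabla p x c \<sigma>) \<sigma> = - (flip_ind x \<sigma> * slope p x c \<sigma>)"
      using int unfolding slope_def nabla_eq fl by (simp add: algebra_simps)
    moreover have "nabla p x (slope p x c) \<sigma> = 0"
      by (rule nabla_eq_zero[OF slope_depends]) simp
    ultimately show ?thesis using 2 by simp
  next
    \<comment> \<open>The spin at \<open>y\<close> is integrated out. The indicator may read the
      spin at \<open>x\<close>, but for each fixed value \<open>b\<close> it ignores the spin at
      \<open>y\<close>.\<close>
    case 3
    have z: "(\<integral>\<tau>. flip_ind y ((graft x \<sigma> \<tau>)(x := b)) * nabla p y c ((graft x \<sigma> \<tau>)(x := b)) \<partial>\<nu> p) = 0" for b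
    proof -
      have up: "(graft x \<sigma> (\<tau>(y := d)))(x := b) = ((graft x \<sigma> \<tau>)(x := b))(y := d)" for \<tau> d
        using 3 by (auto simp: graft_def fun_eq_iff)
      have vy: "((graft x \<sigma> \<tau>)(x := b)) y = \<tau> y" for \<tau>
        using 3 by (auto simp: graft_def)
      let ?W = "\<lambda>\<tau>. flip_ind y ((graft x \<sigma> \<tau>)(x := b))" and ?c = "\<lambda>\<tau>. c ((graft x \<sigma> \<tau>)(x := b))"
      have "nabla p y c ((graft x \<sigma> \<tau>)(x := b)) = nabla p y ?c \<tau>" for \<tau>
        unfolding nabla_eq up vy ..
      moreover have "(\<integral>\<tau>. ?W \<tau> * nabla p y ?c \<tau> \<partial>\<nu> p) = 0"
      proof (rule integral_nabla_zero[OF p])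
        show "?W \<in> borel_measurable (\<nu> p)"
          by (rule measurable_compose[OF graft_measurable cylinder_measurable[OF flip_ind_cylinder]])
        show "?W (\<tau>(y := d)) = ?W \<tau>" for \<tau> d unfolding up by simp
      qed (use C in \<open>auto simp: flip_ind_def\<close>)
      ultimately show ?thesis by simp
    qed
    have "cylinder_function (\<lambda>\<sigma>. flip_ind y \<sigma> * nabla p y c \<sigma>)"
      by (rule flip_nabla_cylinder[OF c])
    then obtain E where E: "\<And>\<sigma>. \<bar>flip_ind y \<sigma> * nabla p y c \<sigma>\<bar> \<le> E"
       and Em: "(\<lambda>\<sigma>. flip_ind y \<sigma> * nabla p y c \<sigma>) \<in> borel_measurable (\<nu> p)"
      using cylinder_bounded cylinder_measurable by meson
    have "slope p x (\<lambda>\<sigma>. flip_ind y \<sigma> * nabla p y c \<sigma>) \<sigma> = 0"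
      unfolding slope_def using slope_integrable[OF Em E, where x = x] z by simp
    moreover have "nabla p y (slope p x c) \<sigma> = 0"
      by (rule nabla_eq_zero[OF slope_depends 3(1)])
    ultimately show ?thesis using 3 by simp
  qed
qed

lemma slope_sum:
  fixes f :: "'i \<Rightarrow> config \<Rightarrow> real"
  assumes "finite A" "\<And>i. i \<in> A \<Longrightarrow> cylinder_function (f i)"
  shows "slope p x (\<lambda>\<sigma>. \<Sum>i\<in>A. f i \<sigma>) \<sigma> = (\<Sum>i\<in>A. slope p x (f i) \<sigma>)"
proof -
  have "integrable (\<nu> p) (\<lambda>\<tau>. f i ((graft x \<sigma> \<tau>)(x := b)))" if "i \<in> A" for i b
    using cylinder_bounded[OF assms(2)[OF that]] slope_integrable[OF cylinder_measurable[OF assms(2)[OF that]]]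
    by metis
  then show ?thesis
    unfolding slope_def sum_subtractf[symmetric]
    by (subst Bochner_Integration.integral_sum) auto
qed

text \<open>Intertwines the generator with the one killed at rate \<open>flip_ind x\<close>: in the
  sum over sites only \<open>y = x\<close> contributes a correction.\<close>

lemma slope_northeast_op:
  assumes p: "p \<in> {0..1}" and c: "cylinder_function c"
  shows "slope p x (northeast_op p c) \<sigma> = northeast_op p (slope p x c) \<sigma> - flip_ind x \<sigma> * slope p x c \<sigma>"
proof -
  obtain S where S: "finite S" "depends_on S c" using c unfolding cylinder_function_iff by blast
  \<comment> \<open>Adding \<open>x\<close> to the support makes the killing term appear even if
    \<open>c\<close> ignores \<open>x\<close>.\<close>
  let ?S = "insert x S"
  have D: "depends_on ?S c" by (rule depends_on_mono[OF S(2)]) auto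
  have D': "depends_on ?S (slope p x c)"
    by (rule depends_on_mono[OF slope_depends_inter[OF D]]) auto
  have eq: "northeast_op p c = (\<lambda>\<sigma>. \<Sum>y\<in>?S. flip_ind y \<sigma> * nabla p y c \<sigma>)"
    by (rule ext) (rule northeast_op_eq_sum[OF _ D], use S(1) in simp)
  have "slope p x (northeast_op p c) \<sigma> = (\<Sum>y\<in>?S. slope p x (\<lambda>\<sigma>. flip_ind y \<sigma> * nabla p y c \<sigma>) \<sigma>)"
    unfolding eq using S(1) by (intro slope_sum flip_nabla_cylinder[OF c]) auto
  also have "\<dots> = (\<Sum>y\<in>?S. flip_ind y \<sigma> * nabla p y (slope p x c) \<sigma>
      - (if y = x then flip_ind x \<sigma> * slope p x c \<sigma> else 0))"
    by (intro sum.cong refl slope_nabla[OF p c])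
  also have "\<dots> = (\<Sum>y\<in>?S. flip_ind y \<sigma> * nabla p y (slope p x c) \<sigma>) - flip_ind x \<sigma> * slope p x c \<sigma>"
    unfolding sum_subtractf using S(1) by (subst sum.delta) auto
  also have "(\<Sum>y\<in>?S. flip_ind y \<sigma> * nabla p y (slope p x c) \<sigma>) = northeast_op p (slope p x c) \<sigma>"
    using S(1) by (intro northeast_op_eq_sum[OF _ D', symmetric]) simp
  finally show ?thesis .
qed

section \<open>Projecting the closure of the generator and its evolutions\<close>

lemma measurable_of_approx:
  fixes f :: "config \<Rightarrow> real"
  assumes "\<And>\<epsilon>. \<epsilon> > 0 \<Longrightarrow> \<exists>c. cylinder_function c \<and> (\<forall>\<sigma>. \<bar>c \<sigma> - f \<sigma>\<bar> \<le> \<epsilon>)"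
  shows "f \<in> borel_measurable (\<nu> p)" "\<exists>C\<ge>0. \<forall>\<sigma>. \<bar>f \<sigma>\<bar> \<le> C"
proof -
  have "\<forall>n. \<exists>c. cylinder_function c \<and> (\<forall>\<sigma>. \<bar>c \<sigma> - f \<sigma>\<bar> \<le> inverse (real (Suc n)))"
    by (intro allI assms) simp
  then obtain c where c: "\<And>n. cylinder_function (c n)" "\<And>n \<sigma>. \<bar>c n \<sigma> - f \<sigma>\<bar> \<le> inverse (real (Suc n))"
    by metis
  have "(\<lambda>n. c n \<sigma>) \<longlonglongrightarrow> f \<sigma>" for \<sigma>
  proof -
    have "(\<lambda>n. c n \<sigma> - f \<sigma>) \<longlonglongrightarrow> 0"
      by (rule Lim_null_comparison[OF _ LIMSEQ_inverse_real_of_nat])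
         (intro always_eventually allI, use c(2) in \<open>simp only: real_norm_def\<close>)
    then show ?thesis by (simp add: LIM_zero_iff)
  qed
  then show "f \<in> borel_measurable (\<nu> p)"
    by (rule borel_measurable_LIMSEQ_real) (rule cylinder_measurable[OF c(1)])
  obtain C where C: "0 \<le> C" "\<And>\<sigma>. \<bar>c 0 \<sigma>\<bar> \<le> C" using cylinder_bounded[OF c(1)[of 0]] by blast
  have "\<bar>f \<sigma>\<bar> \<le> C + 1" for \<sigma> using c(2)[of 0 \<sigma>] C(2)[of \<sigma>] by simp
  with C(1) show "\<exists>C\<ge>0. \<forall>\<sigma>. \<bar>f \<sigma>\<bar> \<le> C" by (intro exI[of _ "C + 1"]) auto
qed

text \<open>Both components are uniform limits of cylinder functions: of the approximants
  \<open>c\<close> for \<open>f\<close>, and of their images under the generator for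
  \<open>g\<close>. This makes the integrals in \<open>slope\<close> meaningful.\<close>

lemma in_closure_regular:
  assumes "in_closure p (\<lambda>_. 0) f g"
  shows "f \<in> borel_measurable (\<nu> q)" "g \<in> borel_measurable (\<nu> q)"
    "\<exists>C\<ge>0. (\<forall>\<sigma>. \<bar>f \<sigma>\<bar> \<le> C) \<and> (\<forall>\<sigma>. \<bar>g \<sigma>\<bar> \<le> C)"
proof -
  have f: "\<exists>c. cylinder_function c \<and> (\<forall>\<sigma>. \<bar>c \<sigma> - f \<sigma>\<bar> \<le> \<epsilon>)" if "\<epsilon> > 0" for \<epsilon>
    using assms that unfolding in_closure_def by blast
  have g: "\<exists>c. cylinder_function c \<and> (\<forall>\<sigma>. \<bar>c \<sigma> - g \<sigma>\<bar> \<le> \<epsilon>)" if \<epsilon>: "\<epsilon> > 0" for \<epsilon>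
  proof -
    obtain c where c: "cylinder_function c" "\<And>\<sigma>. \<bar>c \<sigma> - f \<sigma>\<bar> \<le> \<epsilon>"
      "\<And>\<sigma>. \<bar>northeast_op p c \<sigma> - 0 * c \<sigma> - g \<sigma>\<bar> \<le> \<epsilon>" using in_closureE[OF assms \<epsilon>] by metis
    show ?thesis
      using northeast_op_cylinder[OF c(1)] c(3) by (intro exI[of _ "northeast_op p c"]) auto
  qed
  show "f \<in> borel_measurable (\<nu> q)" by (rule measurable_of_approx(1)[OF f])
  show "g \<in> borel_measurable (\<nu> q)" by (rule measurable_of_approx(1)[OF g])
  obtain C D where "0 \<le> C" "\<And>\<sigma>. \<bar>f \<sigma>\<bar> \<le> C" "0 \<le> D" "\<And>\<sigma>. \<bar>g \<sigma>\<bar> \<le> D"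
    using measurable_of_approx(2)[OF f] measurable_of_approx(2)[OF g] by blast
  then show "\<exists>C\<ge>0. (\<forall>\<sigma>. \<bar>f \<sigma>\<bar> \<le> C) \<and> (\<forall>\<sigma>. \<bar>g \<sigma>\<bar> \<le> C)"
    by (intro exI[of _ "max C D"]) (auto simp: le_max_iff_disj)
qed

lemma slope_diff_le:
  assumes "f \<in> borel_measurable (\<nu> p)" "\<And>\<sigma>. \<bar>f \<sigma>\<bar> \<le> C" "g \<in> borel_measurable (\<nu> p)" "\<And>\<sigma>. \<bar>g \<sigma>\<bar> \<le> D"
    and "\<And>\<sigma>. \<bar>f \<sigma> - g \<sigma>\<bar> \<le> \<epsilon>"
  shows "\<bar>slope p x f \<sigma> - slope p x g \<sigma>\<bar> \<le> 2 * \<epsilon>"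
proof -
  have "slope p x f \<sigma> - slope p x g \<sigma> = slope p x (\<lambda>\<sigma>. f \<sigma> - g \<sigma>) \<sigma>"
    using slope_linear[OF assms(1-4), of x 1 "-1" \<sigma>] by simp
  also have "\<bar>\<dots>\<bar> \<le> 2 * \<epsilon>"
    using assms(1,3,5) by (intro slope_abs_le) auto
  finally show ?thesis .
qed

lemma slope_approx:
  assumes p: "p \<in> {0..1}" and cl: "in_closure p (\<lambda>_. 0) f g" and \<epsilon>: "\<epsilon> > 0"
  obtains c where "cylinder_function c" "\<And>\<sigma>. \<bar>slope p x c \<sigma> - slope p x f \<sigma>\<bar> \<le> \<epsilon>"
    "\<And>\<sigma>. \<bar>slope p x (northeast_op p c) \<sigma> - slope p x g \<sigma>\<bar> \<le> \<epsilon>"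
proof -
  \<comment> \<open>Halved because \<open>slope\<close> may double a uniform distance.\<close>
  have e: "\<epsilon> / 2 > 0" using \<epsilon> by simp
  obtain c where c: "cylinder_function c" "\<And>\<sigma>. \<bar>c \<sigma> - f \<sigma>\<bar> \<le> \<epsilon> / 2"
      "\<And>\<sigma>. \<bar>northeast_op p c \<sigma> - 0 * c \<sigma> - g \<sigma>\<bar> \<le> \<epsilon> / 2" using in_closureE[OF cl e] by metis
  obtain C where C: "\<And>\<sigma>. \<bar>f \<sigma>\<bar> \<le> C" "\<And>\<sigma>. \<bar>g \<sigma>\<bar> \<le> C" using in_closure_regular(3)[OF cl] by blast
  note Lc = northeast_op_cylinder[OF c(1), of p]
  obtain D where D: "\<And>\<sigma>. \<bar>c \<sigma>\<bar> \<le> D" using cylinder_bounded[OF c(1)] by blast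
  obtain E where E: "\<And>\<sigma>. \<bar>northeast_op p c \<sigma>\<bar> \<le> E" using cylinder_bounded[OF Lc] by blast
  show ?thesis
  proof (rule that[OF c(1)])
    show "\<bar>slope p x c \<sigma> - slope p x f \<sigma>\<bar> \<le> \<epsilon>" for \<sigma>
      using slope_diff_le[OF cylinder_measurable[OF c(1)] D in_closure_regular(1)[OF cl] C(1) c(2)] by simp
    show "\<bar>slope p x (northeast_op p c) \<sigma> - slope p x g \<sigma>\<bar> \<le> \<epsilon>" for \<sigma>
      using slope_diff_le[OF cylinder_measurable[OF Lc] E in_closure_regular(2)[OF cl] C(2), of "\<epsilon> / 2"] c(3) by simp
  qed
qed

lemma in_closure_slope:
  assumes p: "p \<in> {0..1}" and cl: "in_closure p (\<lambda>_. 0) f g"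
  shows "in_closure p (flip_ind x) (slope p x f) (slope p x g)"
  unfolding in_closure_def
proof (intro allI impI)
  fix \<epsilon> :: real assume "\<epsilon> > 0"
  then obtain c where c: "cylinder_function c" "\<And>\<sigma>. \<bar>slope p x c \<sigma> - slope p x f \<sigma>\<bar> \<le> \<epsilon>"
    "\<And>\<sigma>. \<bar>slope p x (northeast_op p c) \<sigma> - slope p x g \<sigma>\<bar> \<le> \<epsilon>" using slope_approx[OF p cl] by metis
  then show "\<exists>c. cylinder_function c \<and> (\<forall>\<sigma>. \<bar>c \<sigma> - slope p x f \<sigma>\<bar> \<le> \<epsilon>) \<and>
      (\<forall>\<sigma>. \<bar>northeast_op p c \<sigma> - flip_ind x \<sigma> * c \<sigma> - slope p x g \<sigma>\<bar> \<le> \<epsilon>)"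
    using slope_cylinder[OF c(1), of p x] unfolding slope_northeast_op[OF p c(1)] by blast
qed

lemma spin_dev_abs_le: "p \<in> {0..1} \<Longrightarrow> \<bar>spin_dev p x \<sigma>\<bar> \<le> 1"
  by (auto simp: spin_dev_def)

text \<open>The killing created by \<open>slope\<close> is exactly what the generator produces on
  multiplication by the centred spin, so the composite projection stays within the unkilled
  dynamics.\<close>

lemma in_closure_spin_dev_slope:
  assumes p: "p \<in> {0..1}" and cl: "in_closure p (\<lambda>_. 0) f g"
  shows "in_closure p (\<lambda>_. 0) (\<lambda>\<sigma>. spin_dev p x \<sigma> * slope p x f \<sigma>) (\<lambda>\<sigma>. spin_dev p x \<sigma> * slope p x g \<sigma>)"
  unfolding in_closure_def
proof (intro allI impI)
  fix \<epsilon> :: real assume "\<epsilon> > 0"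
  then obtain c where c: "cylinder_function c" "\<And>\<sigma>. \<bar>slope p x c \<sigma> - slope p x f \<sigma>\<bar> \<le> \<epsilon>"
    "\<And>\<sigma>. \<bar>slope p x (northeast_op p c) \<sigma> - slope p x g \<sigma>\<bar> \<le> \<epsilon>" using slope_approx[OF p cl] by metis
  have le: "\<bar>spin_dev p x \<sigma> * a - spin_dev p x \<sigma> * b\<bar> \<le> \<epsilon>" if "\<bar>a - b\<bar> \<le> \<epsilon>" for \<sigma> a b
  proof -
    have "\<bar>spin_dev p x \<sigma> * a - spin_dev p x \<sigma> * b\<bar> = \<bar>spin_dev p x \<sigma>\<bar> * \<bar>a - b\<bar>"
      by (simp add: abs_mult[symmetric] algebra_simps)
    also have "\<dots> \<le> 1 * \<epsilon>" using that by (intro mult_mono spin_dev_abs_le[OF p]) auto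
    finally show ?thesis by simp
  qed
  have "cylinder_function (\<lambda>\<sigma>. spin_dev p x \<sigma> * slope p x c \<sigma>)"
    by (rule cylinder_function_comp2[where F = "(*)", OF spin_dev_cylinder slope_cylinder[OF c(1)]])
  moreover have "northeast_op p (\<lambda>\<sigma>. spin_dev p x \<sigma> * slope p x c \<sigma>) \<sigma>
      = spin_dev p x \<sigma> * slope p x (northeast_op p c) \<sigma>" for \<sigma>
    unfolding slope_northeast_op[OF p c(1)]
    by (rule northeast_op_spin_dev_mult[OF slope_cylinder[OF c(1)] slope_depends])
  ultimately show "\<exists>c. cylinder_function c \<and> (\<forall>\<sigma>. \<bar>c \<sigma> - spin_dev p x \<sigma> * slope p x f \<sigma>\<bar> \<le> \<epsilon>) \<and>
      (\<forall>\<sigma>. \<bar>northeast_op p c \<sigma> - 0 * c \<sigma> - spin_dev p x \<sigma> * slope p x g \<sigma>\<bar> \<le> \<epsilon>)"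
    using le[OF c(2)] le[OF c(3)]
    by (intro exI[of _ "\<lambda>\<sigma>. spin_dev p x \<sigma> * slope p x c \<sigma>"]) simp
qed

lemma evolution_slope_step:
  assumes ev: "evolution p (\<lambda>_. 0) v w" and \<epsilon>: "\<epsilon> > 0"
  obtains d where "d > 0" "\<And>l t \<sigma>. 0 < l \<Longrightarrow> l < d \<Longrightarrow> l \<le> t \<Longrightarrow>
    \<bar>slope p x (v t) \<sigma> - slope p x (v (t - l)) \<sigma> - l * slope p x (w t) \<sigma>\<bar> \<le> \<epsilon> * l"
proof -
  have e: "\<epsilon> / 2 > 0" using \<epsilon> by simp
  obtain d where d: "d > 0"
    "\<And>l t \<sigma>. 0 < l \<Longrightarrow> l < d \<Longrightarrow> l \<le> t \<Longrightarrow> \<bar>v t \<sigma> - v (t - l) \<sigma> - l * w t \<sigma>\<bar> \<le> \<epsilon> / 2 * l"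
    using evolution_stepE[OF ev e] by metis
  show ?thesis
  proof (rule that[OF d(1)])
    fix l t \<sigma> assume l: "0 < l" "l < d" "l \<le> t"
    have cl: "in_closure p (\<lambda>_. 0) (v t) (w t)" "in_closure p (\<lambda>_. 0) (v (t - l)) (w (t - l))"
      using ev l by (auto simp: evolution_def)
    obtain C where C: "\<And>\<sigma>. \<bar>v t \<sigma>\<bar> \<le> C" "\<And>\<sigma>. \<bar>w t \<sigma>\<bar> \<le> C" using in_closure_regular(3)[OF cl(1)] by blast
    obtain D where D: "\<And>\<sigma>. \<bar>v (t - l) \<sigma>\<bar> \<le> D" using in_closure_regular(3)[OF cl(2)] by blast
    note m = in_closure_regular(1)[OF cl(1), of p] in_closure_regular(2)[OF cl(1), of p] in_closure_regular(1)[OF cl(2), of p]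
    have lw: "\<bar>v t \<sigma> - l * w t \<sigma>\<bar> \<le> C + l * C" for \<sigma>
    proof -
      have "\<bar>l * w t \<sigma>\<bar> \<le> l * C" using C(2)[of \<sigma>] l(1) by (simp add: abs_mult)
      then show ?thesis using C(1)[of \<sigma>] by linarith
    qed
    have "slope p x (\<lambda>\<sigma>. v t \<sigma> - l * w t \<sigma>) \<sigma> = slope p x (v t) \<sigma> - l * slope p x (w t) \<sigma>"
      using slope_linear[OF m(1) C(1) m(2) C(2), of x 1 "- l" \<sigma>] by simp
    moreover have "\<bar>slope p x (\<lambda>\<sigma>. v t \<sigma> - l * w t \<sigma>) \<sigma> - slope p x (v (t - l)) \<sigma>\<bar> \<le> 2 * (\<epsilon> / 2 * l)"
    proof (rule slope_diff_le[OF _ lw m(3) D])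
      show "(\<lambda>\<sigma>. v t \<sigma> - l * w t \<sigma>) \<in> borel_measurable (\<nu> p)" using m by measurable
      show "\<bar>v t \<sigma> - l * w t \<sigma> - v (t - l) \<sigma>\<bar> \<le> \<epsilon> / 2 * l" for \<sigma>
        using d(2)[OF l, of \<sigma>] by (simp add: algebra_simps)
    qed
    ultimately show "\<bar>slope p x (v t) \<sigma> - slope p x (v (t - l)) \<sigma> - l * slope p x (w t) \<sigma>\<bar> \<le> \<epsilon> * l"
      by (simp add: algebra_simps)
  qed
qed

text \<open>The source of killed evolutions, to which the maximum principle is then applied with
  \<open>V = flip_ind x\<close>.\<close>

lemma evolution_slope:
  assumes p: "p \<in> {0..1}" and ev: "evolution p (\<lambda>_. 0) v w"
  shows "evolution p (flip_ind x) (\<lambda>t. slope p x (v t)) (\<lambda>t. slope p x (w t))"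
  unfolding evolution_def
proof (intro conjI allI impI)
  fix t :: real assume "t \<ge> 0"
  then show "in_closure p (flip_ind x) (slope p x (v t)) (slope p x (w t))"
    using ev by (intro in_closure_slope[OF p]) (auto simp: evolution_def)
next
  fix \<epsilon> :: real assume "\<epsilon> > 0"
  then show "\<exists>d>0. \<forall>l t \<sigma>. 0 < l \<longrightarrow> l < d \<longrightarrow> l \<le> t \<longrightarrow>
      \<bar>slope p x (v t) \<sigma> - slope p x (v (t - l)) \<sigma> - l * slope p x (w t) \<sigma>\<bar> \<le> \<epsilon> * l"
    using evolution_slope_step[OF ev, of \<epsilon> x] by metis
qed

lemma evolution_spin_dev_slope:
  assumes p: "p \<in> {0..1}" and ev: "evolution p (\<lambda>_. 0) v w"
  shows "evolution p (\<lambda>_. 0) (\<lambda>t \<sigma>. spin_dev p x \<sigma> * slope p x (v t) \<sigma>) (\<lambda>t \<sigma>. spin_dev p x \<sigma> * slope p x (w t) \<sigma>)"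
  unfolding evolution_def
proof (intro conjI allI impI)
  fix t :: real assume "t \<ge> 0"
  then show "in_closure p (\<lambda>_. 0) (\<lambda>\<sigma>. spin_dev p x \<sigma> * slope p x (v t) \<sigma>) (\<lambda>\<sigma>. spin_dev p x \<sigma> * slope p x (w t) \<sigma>)"
    using ev by (intro in_closure_spin_dev_slope[OF p]) (auto simp: evolution_def)
next
  fix \<epsilon> :: real assume "\<epsilon> > 0"
  then obtain d where d: "d > 0" "\<And>l t \<sigma>. 0 < l \<Longrightarrow> l < d \<Longrightarrow> l \<le> t \<Longrightarrow>
    \<bar>slope p x (v t) \<sigma> - slope p x (v (t - l)) \<sigma> - l * slope p x (w t) \<sigma>\<bar> \<le> \<epsilon> * l"
    using evolution_slope_step[OF ev, of \<epsilon> x] by metis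
  have "\<bar>spin_dev p x \<sigma> * slope p x (v t) \<sigma> - spin_dev p x \<sigma> * slope p x (v (t - l)) \<sigma>
      - l * (spin_dev p x \<sigma> * slope p x (w t) \<sigma>)\<bar> \<le> \<epsilon> * l" if l: "0 < l" "l < d" "l \<le> t" for l t \<sigma>
  proof -
    let ?X = "slope p x (v t) \<sigma> - slope p x (v (t - l)) \<sigma> - l * slope p x (w t) \<sigma>"
    have "\<bar>spin_dev p x \<sigma> * ?X\<bar> \<le> 1 * (\<epsilon> * l)"
      unfolding abs_mult using d(2)[OF l, of \<sigma>] by (intro mult_mono spin_dev_abs_le[OF p]) auto
    then show ?thesis by (simp add: algebra_simps)
  qed
  with d(1) show "\<exists>d>0. \<forall>l t \<sigma>. 0 < l \<longrightarrow> l < d \<longrightarrow> l \<le> t \<longrightarrow>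
      \<bar>spin_dev p x \<sigma> * slope p x (v t) \<sigma> - spin_dev p x \<sigma> * slope p x (v (t - l)) \<sigma>
      - l * (spin_dev p x \<sigma> * slope p x (w t) \<sigma>)\<bar> \<le> \<epsilon> * l" by blast
qed

section \<open>Factorisation, domination and monotonicity in time\<close>

lemma evolution_unique:
  assumes p: "p \<in> {0..1}" and ev: "evolution p (\<lambda>_. 0) v w" "evolution p (\<lambda>_. 0) v' w'"
    and init: "\<And>\<sigma>. v 0 \<sigma> = v' 0 \<sigma>" and t: "0 \<le> t"
  shows "v t \<sigma> = v' t \<sigma>"
proof (rule antisym)
  have "- 0 \<le> 1 * v' t \<sigma> + (-1) * v t \<sigma>"
    by (rule evolution_lower_bound[OF p evolution_linear[OF ev(2) ev(1)] _ _ _ t]) (auto simp: init)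
  then show "v t \<sigma> \<le> v' t \<sigma>" by simp
  have "- 0 \<le> 1 * v t \<sigma> + (-1) * v' t \<sigma>"
    by (rule evolution_lower_bound[OF p evolution_linear[OF ev(1) ev(2)] _ _ _ t]) (auto simp: init)
  then show "v' t \<sigma> \<le> v t \<sigma>" by simp
qed

text \<open>The projected evolution has the same initial value, since \<open>slope\<close> recovers
  \<open>g\<close> at time 0; uniqueness identifies the two.\<close>

lemma evolution_factor:
  assumes p: "p \<in> {0..1}" and ev: "evolution p (\<lambda>_. 0) v w"
    and init: "v 0 = (\<lambda>\<sigma>. spin_dev p x \<sigma> * g \<sigma>)" and dep: "depends_on (past x) g" and t: "0 \<le> t"
  shows "v t \<sigma> = spin_dev p x \<sigma> * slope p x (v t) \<sigma>"
  by (rule evolution_unique[OF p ev evolution_spin_dev_slope[OF p ev] _ t])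
     (simp add: init slope_spin_dev_mult[OF dep])

lemma evolution_slope_lower_bound:
  assumes p: "p \<in> {0..1}" and ev: "evolution p (\<lambda>_. 0) v w"
    and init: "v 0 = (\<lambda>\<sigma>. spin_dev p x \<sigma> * g \<sigma>)" and dep: "depends_on (past x) g" and t: "0 \<le> t"
    and m: "0 \<le> m" "\<And>\<sigma>. - m \<le> g \<sigma>"
  shows "- m \<le> slope p x (v t) \<sigma>"
  by (rule evolution_lower_bound[OF p evolution_slope[OF p ev] flip_ind_nonneg m(1) _ t])
     (simp add: init slope_spin_dev_mult[OF dep] m(2))

text \<open>The evolutions \<open>u + v\<close> and \<open>u - v\<close> start from the centred spin
  times \<open>1 + g\<close> and \<open>1 - g\<close>. Both factors are nonnegative, so the slopes
  stay nonnegative.\<close>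

lemma evolution_dominated:
  assumes p: "p \<in> {0..1}" and v: "evolution p (\<lambda>_. 0) v w" and u: "evolution p (\<lambda>_. 0) u w'"
    and initv: "v 0 = (\<lambda>\<sigma>. spin_dev p x \<sigma> * g \<sigma>)" and dep: "depends_on (past x) g" and g: "\<And>\<sigma>. \<bar>g \<sigma>\<bar> \<le> 1"
    and initu: "u 0 = spin_dev p x" and t: "0 \<le> t"
  shows "\<bar>v t \<sigma>\<bar> \<le> \<bar>u t \<sigma>\<bar>" "\<bar>slope p x (v t) \<sigma>\<bar> \<le> slope p x (u t) \<sigma>"
proof -
  have clv: "in_closure p (\<lambda>_. 0) (v t) (w t)" and clu: "in_closure p (\<lambda>_. 0) (u t) (w' t)"
    using v u t by (auto simp: evolution_def)
  obtain C where C: "\<And>\<sigma>. \<bar>v t \<sigma>\<bar> \<le> C" using in_closure_regular(3)[OF clv] by blast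
  obtain D where D: "\<And>\<sigma>. \<bar>u t \<sigma>\<bar> \<le> D" using in_closure_regular(3)[OF clu] by blast
  have initu': "u 0 = (\<lambda>\<sigma>. spin_dev p x \<sigma> * 1)" using initu by simp
  have "0 \<le> slope p x (u t) \<sigma> + s * slope p x (v t) \<sigma>" if s: "s = 1 \<or> s = - 1" for s :: real
  proof -
    have d: "depends_on (past x) (\<lambda>\<sigma>. 1 + s * g \<sigma>)"
      by (rule depends_on_comp2[where F = "\<lambda>a b. a + s * b", OF depends_on_const dep])
    have "- 0 \<le> slope p x (\<lambda>\<sigma>. 1 * u t \<sigma> + s * v t \<sigma>) \<sigma>"
    proof (rule evolution_slope_lower_bound[OF p evolution_linear[OF u v] _ d t])
      show "(\<lambda>\<sigma>. 1 * u 0 \<sigma> + s * v 0 \<sigma>) = (\<lambda>\<sigma>. spin_dev p x \<sigma> * (1 + s * g \<sigma>))"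
        by (simp add: initu initv algebra_simps)
      show "- 0 \<le> 1 + s * g \<sigma>" for \<sigma> using s g[of \<sigma>] by auto
    qed simp
    then show ?thesis
      using slope_linear[OF in_closure_regular(1)[OF clu, of p] D in_closure_regular(1)[OF clv, of p] C, of x 1 s \<sigma>] by simp
  qed
  from this[of 1] this[of "-1"] show le: "\<bar>slope p x (v t) \<sigma>\<bar> \<le> slope p x (u t) \<sigma>" by simp
  have "\<bar>v t \<sigma>\<bar> = \<bar>spin_dev p x \<sigma>\<bar> * \<bar>slope p x (v t) \<sigma>\<bar>"
    by (subst evolution_factor[OF p v initv dep t]) (simp add: abs_mult)
  also have "\<dots> \<le> \<bar>spin_dev p x \<sigma>\<bar> * \<bar>slope p x (u t) \<sigma>\<bar>"
    using le by (intro mult_left_mono) auto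
  also have "\<dots> = \<bar>u t \<sigma>\<bar>"
    unfolding abs_mult[symmetric] evolution_factor[OF p u initu' depends_on_const t, symmetric] ..
  finally show "\<bar>v t \<sigma>\<bar> \<le> \<bar>u t \<sigma>\<bar>" .
qed

text \<open>Restarted at time \<open>s\<close>, the evolution again begins with the centred spin
  times a function of the past bounded by 1, hence is dominated by the original evolution.\<close>

lemma evolution_slope_decreasing:
  assumes p: "p \<in> {0..1}" and u: "evolution p (\<lambda>_. 0) u w" and init: "u 0 = spin_dev p x"
    and t: "0 \<le> t" and s: "0 \<le> s"
  shows "\<bar>slope p x (u t) \<sigma>\<bar> \<le> 1" "0 \<le> slope p x (u t) \<sigma>" "slope p x (u (t + s)) \<sigma> \<le> slope p x (u t) \<sigma>"
proof -
  have init1: "u 0 = (\<lambda>\<sigma>. spin_dev p x \<sigma> * 1)" using init by simp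
  have bound: "\<bar>slope p x (u r) \<sigma>\<bar> \<le> 1" if r: "0 \<le> r" for r \<sigma>
  proof -
    have clu: "in_closure p (\<lambda>_. 0) (u r) (w r)" using u r by (auto simp: evolution_def)
    obtain D where D: "\<And>\<sigma>. \<bar>u r \<sigma>\<bar> \<le> D" using in_closure_regular(3)[OF clu] by blast
    have "- 0 \<le> slope p x (u r) \<sigma>"
      by (rule evolution_slope_lower_bound[OF p u init1 depends_on_const r]) auto
    \<comment> \<open>The combination is just \<open>- u r\<close>, written in the shape of
      \<open>evolution_linear\<close>; a lower bound for it is an upper bound for the slope of
      \<open>u r\<close>.\<close>
    moreover have "- 1 \<le> slope p x (\<lambda>\<sigma>. 0 * u r \<sigma> + (-1) * u r \<sigma>) \<sigma>"
      by (rule evolution_slope_lower_bound[OF p evolution_linear[OF u u] _ depends_on_const[of _ "- 1"] r])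
         (auto simp: init)
    then have "slope p x (u r) \<sigma> \<le> 1"
      using slope_linear[OF in_closure_regular(1)[OF clu, of p] D in_closure_regular(1)[OF clu, of p] D, of x 0 "-1" \<sigma>] by simp
    ultimately show ?thesis by simp
  qed
  show "\<bar>slope p x (u t) \<sigma>\<bar> \<le> 1" by (rule bound[OF t])
  show "0 \<le> slope p x (u t) \<sigma>"
    using evolution_slope_lower_bound[OF p u init1 depends_on_const t, of 0 \<sigma>] by simp
  have "u (0 + s) = (\<lambda>\<sigma>. spin_dev p x \<sigma> * slope p x (u s) \<sigma>)"
    unfolding add_0 by (rule ext) (rule evolution_factor[OF p u init1 depends_on_const s])
  then have "\<bar>slope p x (u (t + s)) \<sigma>\<bar> \<le> slope p x (u t) \<sigma>"
    by (rule evolution_dominated(2)[OF p evolution_shift[OF u s] u _ slope_depends bound[OF s] init t])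
  then show "slope p x (u (t + s)) \<sigma> \<le> slope p x (u t) \<sigma>" by linarith
qed

section \<open>Dissipation of energy\<close>

definition jump :: "site \<Rightarrow> (config \<Rightarrow> real) \<Rightarrow> config \<Rightarrow> real" where
  "jump y f \<sigma> = f (\<sigma>(y := True)) - f (\<sigma>(y := False))"

lemma jump_measurable:
  assumes [measurable]: "f \<in> borel_measurable (\<nu> p)" shows "jump y f \<in> borel_measurable (\<nu> p)"
  unfolding jump_def[abs_def] by measurable

lemma flip_ind_measurable [measurable]: "flip_ind y \<in> borel_measurable (\<nu> p)"
  by (rule cylinder_measurable[OF flip_ind_cylinder])

lemma jump_abs_le: "(\<And>\<sigma>. \<bar>f \<sigma>\<bar> \<le> C) \<Longrightarrow> \<bar>jump y f \<sigma>\<bar> \<le> 2 * C"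
  using abs_triangle_ineq4[of "f (\<sigma>(y := True))" "f (\<sigma>(y := False))"] unfolding jump_def
  by (smt (verit, ccfv_SIG))

lemma flip_jump_sq_le:
  assumes "\<And>\<sigma>. \<bar>f \<sigma>\<bar> \<le> C" shows "\<bar>flip_ind y \<sigma> * (jump y f \<sigma>)\<^sup>2\<bar> \<le> (2 * C)\<^sup>2"
proof -
  have "\<bar>jump y f \<sigma>\<bar> \<le> \<bar>2 * C\<bar>" using jump_abs_le[of f C y \<sigma>, OF assms] by linarith
  then have "(jump y f \<sigma>)\<^sup>2 \<le> (2 * C)\<^sup>2" by (simp only: abs_le_square_iff)
  then show ?thesis using flip_ind_cases[of y \<sigma>] by (auto simp: abs_mult)
qed

lemma flip_jump_sq_measurable:
  assumes "f \<in> borel_measurable (\<nu> p)"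
  shows "(\<lambda>\<sigma>. flip_ind y \<sigma> * (jump y f \<sigma>)\<^sup>2) \<in> borel_measurable (\<nu> p)"
  by (intro borel_measurable_times borel_measurable_power flip_ind_measurable jump_measurable assms)

text \<open>Integration by parts at one site: averaging \<open>c * nabla p y c\<close> over the spin
  at \<open>y\<close> gives \<open>- p * (1 - p)\<close> times the squared jump.\<close>

lemma integral_flip_nabla:
  assumes p: "p \<in> {0..1}" and c: "cylinder_function c"
  shows "(\<integral>\<sigma>. c \<sigma> * (flip_ind y \<sigma> * nabla p y c \<sigma>) \<partial>\<nu> p)
    = - (p * (1 - p)) * (\<integral>\<sigma>. flip_ind y \<sigma> * (jump y c \<sigma>)\<^sup>2 \<partial>\<nu> p)"
proof -
  have cyl: "cylinder_function (\<lambda>\<sigma>. c \<sigma> * (flip_ind y \<sigma> * nabla p y c \<sigma>))"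
    by (rule cylinder_function_comp2[where F = "(*)", OF c flip_nabla_cylinder[OF c]])
  obtain C where C: "\<And>\<sigma>. \<bar>c \<sigma> * (flip_ind y \<sigma> * nabla p y c \<sigma>)\<bar> \<le> C" using cylinder_bounded[OF cyl] by blast
  have "(\<integral>\<sigma>. c \<sigma> * (flip_ind y \<sigma> * nabla p y c \<sigma>) \<partial>\<nu> p)
      = (\<integral>\<sigma>. - (p * (1 - p)) * (flip_ind y \<sigma> * (jump y c \<sigma>)\<^sup>2) \<partial>\<nu> p)"
    by (subst integral_resample[OF p cylinder_measurable[OF cyl] C, of y], intro Bochner_Integration.integral_cong refl)
       (simp add: nabla_eq jump_def power2_eq_square algebra_simps)
  then show ?thesis by simp
qed

text \<open>The right-hand side is a sum of nonnegative site energies, of which one is kept. A fixed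
  site allows passage to the closure, where the supports of the approximants may grow.\<close>

lemma cylinder_energy:
  assumes p: "p \<in> {0..1}" and c: "cylinder_function c"
  shows "p * (1 - p) * (\<integral>\<sigma>. flip_ind y \<sigma> * (jump y c \<sigma>)\<^sup>2 \<partial>\<nu> p) \<le> - (\<integral>\<sigma>. c \<sigma> * northeast_op p c \<sigma> \<partial>\<nu> p)"
proof -
  obtain S where S: "finite S" "depends_on S c" using c unfolding cylinder_function_iff by blast
  let ?S = "insert y S"
  let ?E = "\<lambda>z. p * (1 - p) * (\<integral>\<sigma>. flip_ind z \<sigma> * (jump z c \<sigma>)\<^sup>2 \<partial>\<nu> p)"
  have D: "depends_on ?S c" by (rule depends_on_mono[OF S(2)]) auto
  have int: "integrable (\<nu> p) (\<lambda>\<sigma>. c \<sigma> * (flip_ind z \<sigma> * nabla p z c \<sigma>))" for z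
  proof -
    have cyl: "cylinder_function (\<lambda>\<sigma>. c \<sigma> * (flip_ind z \<sigma> * nabla p z c \<sigma>))"
      by (rule cylinder_function_comp2[where F = "(*)", OF c flip_nabla_cylinder[OF c]])
    from cylinder_bounded[OF cyl] show ?thesis
      using integrable_bernoulli_bounded[OF cylinder_measurable[OF cyl]] by metis
  qed
  have "(\<integral>\<sigma>. c \<sigma> * northeast_op p c \<sigma> \<partial>\<nu> p) = (\<integral>\<sigma>. (\<Sum>z\<in>?S. c \<sigma> * (flip_ind z \<sigma> * nabla p z c \<sigma>)) \<partial>\<nu> p)"
    using S(1) by (intro Bochner_Integration.integral_cong refl)
       (subst northeast_op_eq_sum[OF _ D], simp_all only: sum_distrib_left finite_insert)
  also have "\<dots> = (\<Sum>z\<in>?S. - ?E z)"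
    using int by (subst Bochner_Integration.integral_sum) (simp_all add: integral_flip_nabla[OF p c])
  finally have eq: "- (\<integral>\<sigma>. c \<sigma> * northeast_op p c \<sigma> \<partial>\<nu> p) = (\<Sum>z\<in>?S. ?E z)"
    by (simp only: sum_negf minus_minus)
  have "0 \<le> ?E z" for z
    using p by (intro mult_nonneg_nonneg integral_nonneg_AE AE_I2) (auto simp: flip_ind_nonneg)
  then have "?E y \<le> (\<Sum>z\<in>?S. ?E z)" using S(1) by (intro member_le_sum) auto
  then show ?thesis unfolding eq .
qed

lemma closure_energy:
  assumes p: "p \<in> {0..1}" and cl: "in_closure p (\<lambda>_. 0) f g"
  shows "p * (1 - p) * (\<integral>\<sigma>. flip_ind y \<sigma> * (jump y f \<sigma>)\<^sup>2 \<partial>\<nu> p) \<le> - (\<integral>\<sigma>. f \<sigma> * g \<sigma> \<partial>\<nu> p)"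
proof -
  interpret N: prob_space "\<nu> p" by (rule prob_space_bernoulli)
  obtain C where C: "0 \<le> C" "\<And>\<sigma>. \<bar>f \<sigma>\<bar> \<le> C" "\<And>\<sigma>. \<bar>g \<sigma>\<bar> \<le> C" using in_closure_regular(3)[OF cl] by blast
  note [measurable] = in_closure_regular(1)[OF cl, of p] in_closure_regular(2)[OF cl, of p]
  \<comment> \<open>The first summand bounds the change of the squared jump (difference at most
    \<open>2 * \<epsilon>\<close>, sum at most \<open>4 * C + 2\<close>); the second bounds the
    change of the product, \<open>\<epsilon> * C + (C + 1) * \<epsilon>\<close>.\<close>
  define K where "K = 2 * (4 * C + 2) + (2 * C + 1)"
  have K: "K > 0" using C(1) by (simp add: K_def)
  show ?thesis
  proof (rule field_le_epsilon)
    fix e :: real assume "e > 0"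
    \<comment> \<open>The cap 1 keeps the approximant and its image under the generator bounded by
      \<open>C + 1\<close>.\<close>
    define \<epsilon> where "\<epsilon> = min 1 (e / K)"
    have \<epsilon>: "\<epsilon> > 0" "\<epsilon> \<le> 1" "K * \<epsilon> \<le> e" using \<open>e > 0\<close> K by (auto simp: \<epsilon>_def min_def field_simps)
    obtain c where c: "cylinder_function c" "\<And>\<sigma>. \<bar>c \<sigma> - f \<sigma>\<bar> \<le> \<epsilon>"
      "\<And>\<sigma>. \<bar>northeast_op p c \<sigma> - 0 * c \<sigma> - g \<sigma>\<bar> \<le> \<epsilon>" using in_closureE[OF cl \<epsilon>(1)] by metis
    note [measurable] = cylinder_measurable[OF c(1), of p] cylinder_measurable[OF northeast_op_cylinder[OF c(1), of p], of p]
    have cb: "\<bar>c \<sigma>\<bar> \<le> C + 1" for \<sigma> using c(2)[of \<sigma>] C(2)[of \<sigma>] \<epsilon>(2) by linarith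
    have gb: "\<bar>northeast_op p c \<sigma>\<bar> \<le> C + 1" for \<sigma> using c(3)[of \<sigma>] C(3)[of \<sigma>] \<epsilon>(2) by simp
    have j: "(jump y f \<sigma>)\<^sup>2 - (jump y c \<sigma>)\<^sup>2 \<le> 2 * \<epsilon> * (4 * C + 2)" for \<sigma>
    proof -
      have "\<bar>jump y f \<sigma> - jump y c \<sigma>\<bar> \<le> 2 * \<epsilon>"
        using c(2)[of "\<sigma>(y := True)"] c(2)[of "\<sigma>(y := False)"] unfolding jump_def by linarith
      moreover have "\<bar>jump y f \<sigma> + jump y c \<sigma>\<bar> \<le> 4 * C + 2"
        using jump_abs_le[of f C y \<sigma>, OF C(2)] jump_abs_le[of c "C + 1" y \<sigma>, OF cb]
          abs_triangle_ineq[of "jump y f \<sigma>" "jump y c \<sigma>"] by simp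
      ultimately have "\<bar>jump y f \<sigma> - jump y c \<sigma>\<bar> * \<bar>jump y f \<sigma> + jump y c \<sigma>\<bar> \<le> 2 * \<epsilon> * (4 * C + 2)"
        using \<epsilon>(1) by (intro mult_mono) auto
      then have "\<bar>(jump y f \<sigma>)\<^sup>2 - (jump y c \<sigma>)\<^sup>2\<bar> \<le> 2 * \<epsilon> * (4 * C + 2)"
        by (simp add: abs_mult[symmetric] power2_eq_square algebra_simps)
      then show ?thesis by linarith
    qed
    have ib: "integrable (\<nu> p) (\<lambda>\<sigma>. flip_ind y \<sigma> * (jump y h \<sigma>)\<^sup>2)"
      if "h \<in> borel_measurable (\<nu> p)" and b: "\<And>\<sigma>. \<bar>h \<sigma>\<bar> \<le> B" for h B
      by (rule integrable_bernoulli_bounded[OF flip_jump_sq_measurable[OF that(1)] flip_jump_sq_le[of h B, OF b]])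
    have "(\<integral>\<sigma>. flip_ind y \<sigma> * (jump y f \<sigma>)\<^sup>2 \<partial>\<nu> p)
        \<le> (\<integral>\<sigma>. flip_ind y \<sigma> * (jump y c \<sigma>)\<^sup>2 + 2 * \<epsilon> * (4 * C + 2) \<partial>\<nu> p)"
    proof (rule integral_mono)
      show "flip_ind y \<sigma> * (jump y f \<sigma>)\<^sup>2 \<le> flip_ind y \<sigma> * (jump y c \<sigma>)\<^sup>2 + 2 * \<epsilon> * (4 * C + 2)" for \<sigma>
      proof -
        have "0 \<le> 2 * \<epsilon> * (4 * C + 2)" using \<epsilon>(1) C(1) by simp
        then show ?thesis using flip_ind_cases[of y \<sigma>] j[of \<sigma>] by auto
      qed
    qed (use ib[OF _ C(2)] ib[OF _ cb] in auto)
    also have "\<dots> = (\<integral>\<sigma>. flip_ind y \<sigma> * (jump y c \<sigma>)\<^sup>2 \<partial>\<nu> p) + 2 * \<epsilon> * (4 * C + 2)"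
      using ib[OF _ cb] N.prob_space by (subst Bochner_Integration.integral_add) auto
    finally have 1: "p * (1 - p) * (\<integral>\<sigma>. flip_ind y \<sigma> * (jump y f \<sigma>)\<^sup>2 \<partial>\<nu> p)
        \<le> p * (1 - p) * (\<integral>\<sigma>. flip_ind y \<sigma> * (jump y c \<sigma>)\<^sup>2 \<partial>\<nu> p) + p * (1 - p) * (2 * \<epsilon> * (4 * C + 2))"
      using p mult_left_mono[of _ _ "p * (1 - p)"] by (simp add: distrib_left[symmetric] del: distrib_left_numeral)
    have "p * (1 - p) \<le> 1 * 1" using p by (intro mult_mono) auto
    then have 2: "p * (1 - p) * (2 * \<epsilon> * (4 * C + 2)) \<le> 1 * (2 * \<epsilon> * (4 * C + 2))"
      using \<epsilon>(1) C(1) by (intro mult_right_mono) auto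
    have "(\<integral>\<sigma>. f \<sigma> * g \<sigma> \<partial>\<nu> p) \<le> (\<integral>\<sigma>. c \<sigma> * northeast_op p c \<sigma> + \<epsilon> * (2 * C + 1) \<partial>\<nu> p)"
    proof (rule integral_mono)
      show "integrable (\<nu> p) (\<lambda>\<sigma>. f \<sigma> * g \<sigma>)"
        by (rule integrable_bernoulli_bounded[where C = "C * C"]) (use C in \<open>auto simp: abs_mult intro!: mult_mono\<close>)
      show "integrable (\<nu> p) (\<lambda>\<sigma>. c \<sigma> * northeast_op p c \<sigma> + \<epsilon> * (2 * C + 1))"
      proof (intro Bochner_Integration.integrable_add N.integrable_const integrable_bernoulli_bounded[where C = "(C + 1) * (C + 1)"])
        show "\<bar>c \<sigma> * northeast_op p c \<sigma>\<bar> \<le> (C + 1) * (C + 1)" for \<sigma>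
          unfolding abs_mult using cb[of \<sigma>] gb[of \<sigma>] C(1) by (intro mult_mono) auto
      qed measurable
      show "f \<sigma> * g \<sigma> \<le> c \<sigma> * northeast_op p c \<sigma> + \<epsilon> * (2 * C + 1)" for \<sigma>
      proof -
        have "f \<sigma> * g \<sigma> - c \<sigma> * northeast_op p c \<sigma> = - ((c \<sigma> - f \<sigma>) * g \<sigma>) - c \<sigma> * (northeast_op p c \<sigma> - g \<sigma>)"
          by (simp add: algebra_simps)
        also have "\<dots> \<le> \<bar>c \<sigma> - f \<sigma>\<bar> * \<bar>g \<sigma>\<bar> + \<bar>c \<sigma>\<bar> * \<bar>northeast_op p c \<sigma> - g \<sigma>\<bar>"
          unfolding abs_mult[symmetric] by linarith
        also have "\<dots> \<le> \<epsilon> * C + (C + 1) * \<epsilon>"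
          using c(2)[of \<sigma>] c(3)[of \<sigma>] C(3)[of \<sigma>] cb[of \<sigma>] C(1) \<epsilon>(1) by (intro add_mono mult_mono) auto
        finally show ?thesis by (simp add: algebra_simps)
      qed
    qed
    also have "\<dots> = (\<integral>\<sigma>. c \<sigma> * northeast_op p c \<sigma> \<partial>\<nu> p) + \<epsilon> * (2 * C + 1)"
    proof -
      have "integrable (\<nu> p) (\<lambda>\<sigma>. c \<sigma> * northeast_op p c \<sigma>)"
      proof (rule integrable_bernoulli_bounded[where C = "(C + 1) * (C + 1)"])
        show "\<bar>c \<sigma> * northeast_op p c \<sigma>\<bar> \<le> (C + 1) * (C + 1)" for \<sigma>
          unfolding abs_mult using cb[of \<sigma>] gb[of \<sigma>] C(1) by (intro mult_mono) auto
      qed measurable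
      then show ?thesis using N.prob_space by (subst Bochner_Integration.integral_add) auto
    qed
    finally have 3: "(\<integral>\<sigma>. f \<sigma> * g \<sigma> \<partial>\<nu> p) \<le> (\<integral>\<sigma>. c \<sigma> * northeast_op p c \<sigma> \<partial>\<nu> p) + \<epsilon> * (2 * C + 1)" .
    have "1 * (2 * \<epsilon> * (4 * C + 2)) + \<epsilon> * (2 * C + 1) = K * \<epsilon>" by (simp add: K_def algebra_simps)
    then show "p * (1 - p) * (\<integral>\<sigma>. flip_ind y \<sigma> * (jump y f \<sigma>)\<^sup>2 \<partial>\<nu> p) \<le> - (\<integral>\<sigma>. f \<sigma> * g \<sigma> \<partial>\<nu> p) + e"
      using 1 2 3 \<epsilon>(3) cylinder_energy[OF p c(1), of y] by linarith
  qed
qed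

text \<open>If the dissipation stayed above \<open>\<eta>\<close> after time \<open>N\<close>, the
  squared L2 norm would drop by at least \<open>l * \<eta>\<close> in each step of length
  \<open>l\<close> and become negative.\<close>

lemma evolution_energy_small:
  assumes ev: "evolution p (\<lambda>_. 0) v w" and C: "\<And>t \<sigma>. 0 \<le> t \<Longrightarrow> \<bar>v t \<sigma>\<bar> \<le> C"
    and \<eta>: "0 < \<eta>" and N: "0 \<le> N"
  shows "\<exists>t\<ge>N. - (\<integral>\<sigma>. v t \<sigma> * w t \<sigma> \<partial>\<nu> p) < \<eta>"
proof (rule ccontr)
  interpret N: prob_space "\<nu> p" by (rule prob_space_bernoulli)
  assume "\<not> (\<exists>t\<ge>N. - (\<integral>\<sigma>. v t \<sigma> * w t \<sigma> \<partial>\<nu> p) < \<eta>)"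
  then have big: "\<eta> \<le> - (\<integral>\<sigma>. v t \<sigma> * w t \<sigma> \<partial>\<nu> p)" if "N \<le> t" for t using that by (meson not_le)
  have C0: "0 \<le> C" using C[of 0 undefined] by linarith
  \<comment> \<open>Chosen so that the discretisation error \<open>2 * C * \<epsilon> * l\<close>
    uses up at most half of the gain \<open>2 * l * \<eta>\<close>.\<close>
  define \<epsilon> where "\<epsilon> = \<eta> / (2 * C + 1)"
  have \<epsilon>: "\<epsilon> > 0" "2 * C * \<epsilon> \<le> \<eta>" using C0 \<eta> by (auto simp: \<epsilon>_def field_simps)
  obtain d where d: "d > 0"
    "\<And>l t \<sigma>. 0 < l \<Longrightarrow> l < d \<Longrightarrow> l \<le> t \<Longrightarrow> \<bar>v t \<sigma> - v (t - l) \<sigma> - l * w t \<sigma>\<bar> \<le> \<epsilon> * l"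
    using evolution_stepE[OF ev \<epsilon>(1)] by metis
  define l where "l = d / 2"
  have l: "0 < l" "l < d" using d(1) by (auto simp: l_def)
  define a where "a t = (\<integral>\<sigma>. (v t \<sigma>)\<^sup>2 \<partial>\<nu> p)" for t
  have vm: "v t \<in> borel_measurable (\<nu> p)" if "0 \<le> t" for t
    using in_closure_regular(1) ev that unfolding evolution_def by blast
  have int2: "integrable (\<nu> p) (\<lambda>\<sigma>. (v t \<sigma>)\<^sup>2)" if "0 \<le> t" for t
  proof (rule integrable_bernoulli_bounded[where C = "C\<^sup>2"])
    show "(\<lambda>\<sigma>. (v t \<sigma>)\<^sup>2) \<in> borel_measurable (\<nu> p)" using vm[OF that] by measurable
    show "\<bar>(v t \<sigma>)\<^sup>2\<bar> \<le> C\<^sup>2" for \<sigma> using C[OF that, of \<sigma>] C0 by (simp add: abs_le_square_iff[symmetric])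
  qed
  have step: "a t + l * \<eta> \<le> a (t - l)" if t: "N \<le> t - l" for t
  proof -
    have t0: "0 \<le> t" "0 \<le> t - l" "N \<le> t" "l \<le> t" using t N l(1) by auto
    have cl: "in_closure p (\<lambda>_. 0) (v t) (w t)" using ev t0 by (simp add: evolution_def)
    obtain G where G: "0 \<le> G" "\<And>\<sigma>. \<bar>v t \<sigma>\<bar> \<le> G" "\<And>\<sigma>. \<bar>w t \<sigma>\<bar> \<le> G" using in_closure_regular(3)[OF cl] by blast
    note [measurable] = in_closure_regular(1)[OF cl, of p] in_closure_regular(2)[OF cl, of p]
    have ivw: "integrable (\<nu> p) (\<lambda>\<sigma>. v t \<sigma> * w t \<sigma>)"
      by (rule integrable_bernoulli_bounded[where C = "G * G"]) (use G in \<open>auto simp: abs_mult intro!: mult_mono\<close>)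
    have "(\<integral>\<sigma>. (v t \<sigma>)\<^sup>2 - 2 * l * (v t \<sigma> * w t \<sigma>) - 2 * C * (\<epsilon> * l) \<partial>\<nu> p) \<le> a (t - l)"
      unfolding a_def
    proof (rule integral_mono)
      show "(v t \<sigma>)\<^sup>2 - 2 * l * (v t \<sigma> * w t \<sigma>) - 2 * C * (\<epsilon> * l) \<le> (v (t - l) \<sigma>)\<^sup>2" for \<sigma>
      proof -
        let ?r = "v t \<sigma> - v (t - l) \<sigma> - l * w t \<sigma>"
        have "\<bar>v t \<sigma>\<bar> * \<bar>?r\<bar> \<le> C * (\<epsilon> * l)"
          using C[OF t0(1), of \<sigma>] d(2)[OF l t0(4), of \<sigma>] C0 by (intro mult_mono) auto
        then have "v t \<sigma> * ?r \<le> C * (\<epsilon> * l)" unfolding abs_mult[symmetric] by linarith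
        \<comment> \<open>The backward difference is helpful here: the quadratic remainder of a step
          has the favourable sign and is dropped.\<close>
        moreover have "0 \<le> (v t \<sigma> - v (t - l) \<sigma>)\<^sup>2" by simp
        ultimately show ?thesis by (simp add: power2_eq_square algebra_simps)
      qed
    qed (use int2[OF t0(1)] int2[OF t0(2)] ivw in auto)
    moreover have "(\<integral>\<sigma>. (v t \<sigma>)\<^sup>2 - 2 * l * (v t \<sigma> * w t \<sigma>) - 2 * C * (\<epsilon> * l) \<partial>\<nu> p)
        = a t + 2 * l * (- (\<integral>\<sigma>. v t \<sigma> * w t \<sigma> \<partial>\<nu> p)) - 2 * C * (\<epsilon> * l)"
      unfolding a_def using int2[OF t0(1)] ivw N.prob_space by simp
    moreover have "2 * l * \<eta> \<le> 2 * l * (- (\<integral>\<sigma>. v t \<sigma> * w t \<sigma> \<partial>\<nu> p))"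
      using big[OF t0(3)] l(1) by (intro mult_left_mono) auto
    moreover have "2 * C * (\<epsilon> * l) \<le> l * \<eta>"
      using mult_right_mono[OF \<epsilon>(2), of l] l(1) by (simp add: algebra_simps)
    ultimately show ?thesis by linarith
  qed
  have dec: "a (N + real j * l) + real j * (l * \<eta>) \<le> a N" for j
  proof (induction j)
    case (Suc j)
    have "a (N + real (Suc j) * l) + l * \<eta> \<le> a (N + real (Suc j) * l - l)"
      using l(1) by (intro step) (simp add: algebra_simps)
    moreover have "N + real (Suc j) * l - l = N + real j * l" by (simp add: algebra_simps)
    ultimately show ?case using Suc by (simp add: algebra_simps)
  qed simp
  obtain j :: nat where "a N / (l * \<eta>) < real j" using reals_Archimedean2 by blast
  then have "a N < real j * (l * \<eta>)" using l(1) \<eta> by (simp add: field_simps)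
  moreover have "0 \<le> a (N + real j * l)" unfolding a_def by simp
  ultimately show False using dec[of j] by linarith
qed

text \<open>The limit \<open>F\<close> need not lie in the domain, so the energy bound is applied to
  \<open>v\<close> at times where the dissipation is small and carried to \<open>F\<close> by
  dominated convergence.\<close>

lemma evolution_limit_jump_zero:
  assumes p: "0 < p" "p < 1" and ev: "evolution p (\<lambda>_. 0) v w" and C: "\<And>t \<sigma>. 0 \<le> t \<Longrightarrow> \<bar>v t \<sigma>\<bar> \<le> C"
    and lim: "\<And>\<sigma>. ((\<lambda>t. v t \<sigma>) \<longlongrightarrow> F \<sigma>) at_top"
  shows "AE \<sigma> in \<nu> p. y \<in> flippable \<sigma> \<longrightarrow> F (\<sigma>(y := True)) = F (\<sigma>(y := False))"
proof -
  interpret N: prob_space "\<nu> p" by (rule prob_space_bernoulli)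
  have p': "p \<in> {0..1}" and pp: "0 < p * (1 - p)" using p by auto
  have C0: "0 \<le> C" using C[of 0 undefined] by linarith
  have "\<exists>t. real n \<le> t \<and> - (\<integral>\<sigma>. v t \<sigma> * w t \<sigma> \<partial>\<nu> p) < inverse (real (Suc n))" for n
    by (rule evolution_energy_small[OF ev C]) simp_all
  then obtain s where s: "\<And>n. real n \<le> s n" "\<And>n. - (\<integral>\<sigma>. v (s n) \<sigma> * w (s n) \<sigma> \<partial>\<nu> p) < inverse (real (Suc n))"
    by metis
  have s0: "0 \<le> s n" for n using s(1)[of n] by linarith
  have s_top: "filterlim s at_top sequentially"
    by (rule filterlim_at_top_mono[OF filterlim_real_sequentially]) (simp add: s(1))
  have lim_s: "(\<lambda>n. v (s n) \<sigma>) \<longlonglongrightarrow> F \<sigma>" for \<sigma>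
    by (rule filterlim_compose[OF lim s_top])
  have vm[measurable]: "v (s n) \<in> borel_measurable (\<nu> p)" for n
    using in_closure_regular(1) ev s0 unfolding evolution_def by blast
  have [measurable]: "F \<in> borel_measurable (\<nu> p)"
    by (rule borel_measurable_LIMSEQ_real[OF lim_s]) (rule vm)
  let ?E = "\<lambda>f \<sigma>. flip_ind y \<sigma> * (jump y f \<sigma>)\<^sup>2"
  have bd: "\<bar>?E (v (s n)) \<sigma>\<bar> \<le> (2 * C)\<^sup>2" for n \<sigma>
    by (rule flip_jump_sq_le[OF C[OF s0]])
  have limE: "(\<lambda>n. ?E (v (s n)) \<sigma>) \<longlonglongrightarrow> ?E F \<sigma>" for \<sigma>
    unfolding jump_def by (intro tendsto_intros lim_s)
  have m: "?E F \<in> borel_measurable (\<nu> p)" "\<And>n. ?E (v (s n)) \<in> borel_measurable (\<nu> p)"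
    by (intro flip_jump_sq_measurable; measurable)+
  have d: "integrable (\<nu> p) (\<lambda>_. (2 * C)\<^sup>2)" by simp
  have ae: "AE \<sigma> in \<nu> p. (\<lambda>n. ?E (v (s n)) \<sigma>) \<longlonglongrightarrow> ?E F \<sigma>"
    by (rule AE_I2) (rule limE)
  have nb: "\<And>n. AE \<sigma> in \<nu> p. norm (?E (v (s n)) \<sigma>) \<le> (2 * C)\<^sup>2"
    unfolding real_norm_def by (rule AE_I2) (rule bd)
  note dc = m d ae nb
  have "integrable (\<nu> p) (?E F)" by (rule integrable_dominated_convergence[OF dc])
  have conv: "(\<lambda>n. \<integral>\<sigma>. ?E (v (s n)) \<sigma> \<partial>\<nu> p) \<longlonglongrightarrow> (\<integral>\<sigma>. ?E F \<sigma> \<partial>\<nu> p)"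
    by (rule integral_dominated_convergence[OF dc])
  have "(\<lambda>n. inverse (real (Suc n)) / (p * (1 - p))) \<longlonglongrightarrow> 0 / (p * (1 - p))"
    by (intro tendsto_divide LIMSEQ_inverse_real_of_nat tendsto_const) (use p in simp)
  moreover have "(\<integral>\<sigma>. ?E (v (s n)) \<sigma> \<partial>\<nu> p) \<le> inverse (real (Suc n)) / (p * (1 - p))" for n
  proof -
    have "in_closure p (\<lambda>_. 0) (v (s n)) (w (s n))" using ev s0 by (simp add: evolution_def)
    from closure_energy[OF p' this, of y] s(2)[of n] pp show ?thesis
      by (simp only: pos_le_divide_eq) (simp add: mult.commute)
  qed
  ultimately have "(\<integral>\<sigma>. ?E F \<sigma> \<partial>\<nu> p) \<le> 0"
    using LIMSEQ_le[OF conv] by auto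
  moreover have "0 \<le> (\<integral>\<sigma>. ?E F \<sigma> \<partial>\<nu> p)"
    by (intro integral_nonneg_AE AE_I2) (simp add: flip_ind_nonneg)
  ultimately have "(\<integral>\<sigma>. ?E F \<sigma> \<partial>\<nu> p) = 0" by linarith
  then have "AE \<sigma> in \<nu> p. ?E F \<sigma> = 0"
    using \<open>integrable (\<nu> p) (?E F)\<close> by (subst (asm) integral_nonneg_eq_0_iff_AE) (auto simp: flip_ind_nonneg)
  then show ?thesis
    by eventually_elim (auto simp: flip_ind_def jump_def)
qed

section \<open>Percolation of zeros\<close>

text \<open>Finite-depth version of percolation: an open oriented path of \<open>n\<close> steps
  starts at \<open>x\<close>. It turns an uncountable union over paths into countable
  operations.\<close>

fun open_to :: "config \<Rightarrow> nat \<Rightarrow> site \<Rightarrow> bool" where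
  "open_to \<omega> 0 x \<longleftrightarrow> \<omega> x"
| "open_to \<omega> (Suc n) x \<longleftrightarrow> \<omega> x \<and> (open_to \<omega> n (south x) \<or> open_to \<omega> n (west x))"

lemma open_to_Suc_imp: "open_to \<omega> (Suc n) x \<Longrightarrow> open_to \<omega> n x"
proof (induction n arbitrary: x)
  case (Suc n)
  then show ?case unfolding open_to.simps(2)[of _ "Suc n"] open_to.simps(2)[of _ n x] by blast
qed simp

lemma open_to_antimono: "m \<le> n \<Longrightarrow> open_to \<omega> n x \<Longrightarrow> open_to \<omega> m x"
proof (induction n rule: dec_induct)
  case (step n)
  from open_to_Suc_imp[OF step.prems] show ?case by (rule step.IH)
qed

text \<open>Koenig's lemma. If both successors of a site failed at some finite depth, they would
  both fail at the larger one, so a site open to all depths has a successor of the same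
  kind.\<close>

lemma infinite_open_path_iff:
  "(\<exists>\<gamma>. infinite_open_path \<omega> \<gamma>) \<longleftrightarrow> (\<exists>x. \<forall>n. open_to \<omega> n x)"
proof
  assume "\<exists>\<gamma>. infinite_open_path \<omega> \<gamma>"
  then obtain \<gamma> where \<gamma>: "\<And>n. \<omega> (\<gamma> n)" "\<And>n. \<gamma> (Suc n) = south (\<gamma> n) \<or> \<gamma> (Suc n) = west (\<gamma> n)"
    unfolding infinite_open_path_def by auto
  have "open_to \<omega> n (\<gamma> k)" for n k
  proof (induction n arbitrary: k)
    case (Suc n)
    show ?case using \<gamma>(1)[of k] \<gamma>(2)[of k] Suc[of "Suc k"] by auto
  qed (simp add: \<gamma>(1))
  then show "\<exists>x. \<forall>n. open_to \<omega> n x" by blast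
next
  assume "\<exists>x. \<forall>n. open_to \<omega> n x"
  then obtain x where x: "\<forall>n. open_to \<omega> n x" by blast
  have step: "\<exists>y. (\<forall>n. open_to \<omega> n y) \<and> y \<in> {south z, west z}" if z: "\<forall>n. open_to \<omega> n z" for z
  proof (rule ccontr)
    assume "\<not> ?thesis"
    then obtain m n where "\<not> open_to \<omega> m (south z)" "\<not> open_to \<omega> n (west z)" by blast
    then have "\<not> open_to \<omega> (max m n) (south z)" "\<not> open_to \<omega> (max m n) (west z)"
      using open_to_antimono[of _ "max m n"] by (meson max.cobounded1 max.cobounded2)+
    moreover have "open_to \<omega> (Suc (max m n)) z" using z by blast
    ultimately show False by simp
  qed
  have "\<exists>\<gamma>. \<forall>n. (\<forall>k. open_to \<omega> k (\<gamma> n)) \<and> \<gamma> (Suc n) \<in> {south (\<gamma> n), west (\<gamma> n)}"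
    by (rule dependent_nat_choice[of "\<lambda>_ y. \<forall>n. open_to \<omega> n y" "\<lambda>_ z y. y \<in> {south z, west z}"])
       (rule exI[of _ x], rule x, rule step)
  then obtain \<gamma> where \<gamma>: "\<forall>n. (\<forall>k. open_to \<omega> k (\<gamma> n)) \<and> \<gamma> (Suc n) \<in> {south (\<gamma> n), west (\<gamma> n)}" ..
  have "\<omega> (\<gamma> n)" for n using \<gamma> open_to.simps(1)[of \<omega> "\<gamma> n"] by blast
  with \<gamma> show "\<exists>\<gamma>. infinite_open_path \<omega> \<gamma>" unfolding infinite_open_path_def by blast
qed

lemma open_to_measurable: "{\<sigma>. open_to (\<lambda>z. h (\<sigma> z)) n x} \<in> sets (\<nu> p)"
proof -
  have "Measurable.pred (\<nu> p) (\<lambda>\<sigma>. open_to (\<lambda>z. h (\<sigma> z)) n x)"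
  proof (induction n arbitrary: x)
    case 0
    have "Measurable.pred (\<nu> p) (\<lambda>\<sigma>. h (\<sigma> x))"
      by (rule measurable_compose[OF measurable_bernoulli_coord]) simp
    then show ?case by simp
  next
    case (Suc n)
    have "Measurable.pred (\<nu> p) (\<lambda>\<sigma>. h (\<sigma> x))"
      by (rule measurable_compose[OF measurable_bernoulli_coord]) simp
    with Suc[of "south x"] Suc[of "west x"] show ?case by simp
  qed
  then show ?thesis by (simp add: pred_def)
qed

text \<open>The function \<open>h\<close> allows the zeros of a configuration to be read as open
  sites.\<close>

lemma infinite_open_path_measurable:
  "{\<sigma>. \<exists>\<gamma>. infinite_open_path (\<lambda>z. h (\<sigma> z)) \<gamma>} \<in> sets (\<nu> p)"
proof -
  have "{\<sigma>. \<exists>\<gamma>. infinite_open_path (\<lambda>z. h (\<sigma> z)) \<gamma>} = (\<Union>x. \<Inter>n. {\<sigma>. open_to (\<lambda>z. h (\<sigma> z)) n x})"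
    unfolding infinite_open_path_iff by auto
  also have "\<dots> \<in> sets (\<nu> p)"
    using sets.top[of "\<nu> p"]
    by (intro sets.countable_UN'' sets.countable_INT'' open_to_measurable) auto
  finally show ?thesis .
qed

section \<open>Comparing the zeros with subcritical percolation\<close>

lemma distr_PiM_map_pmf:
  fixes K :: "'a pmf" and f :: "'a \<Rightarrow> 'b"
  shows "distr (Pi\<^sub>M UNIV (\<lambda>_::'i. measure_pmf K)) (Pi\<^sub>M UNIV (\<lambda>_. measure_pmf (map_pmf f K))) (\<lambda>\<omega> x. f (\<omega> x))
    = Pi\<^sub>M UNIV (\<lambda>_. measure_pmf (map_pmf f K))" (is "distr ?A ?B ?g = _")
proof -
  interpret B: product_prob_space "\<lambda>_::'i. measure_pmf (map_pmf f K)" UNIV ..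
  interpret A: product_prob_space "\<lambda>_::'i. measure_pmf K" UNIV ..
  have m: "?g \<in> measurable ?A ?B"
  proof (rule measurable_PiM_single')
    fix x
    have "(\<lambda>\<omega>. \<omega> x) \<in> measurable ?A (measure_pmf K)" by (rule measurable_component_singleton) simp
    then have "(\<lambda>\<omega>. f (\<omega> x)) \<in> measurable ?A (count_space UNIV)"
      by (rule measurable_compose) simp
    then show "(\<lambda>\<omega>. f (\<omega> x)) \<in> measurable ?A (measure_pmf (map_pmf f K))"
      by (simp add: measurable_def)
  qed simp
  show ?thesis
  proof (rule B.PiM_eq)
    fix J :: "'i set" and F :: "'i \<Rightarrow> 'b set"
    assume J: "finite J"
    have "emeasure (distr ?A ?B ?g) (prod_emb UNIV (\<lambda>_. measure_pmf (map_pmf f K)) J (Pi\<^sub>E J F))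
        = emeasure ?A (?g -` prod_emb UNIV (\<lambda>_. measure_pmf (map_pmf f K)) J (Pi\<^sub>E J F) \<inter> space ?A)"
      using J by (intro emeasure_distr m) simp
    also have "?g -` prod_emb UNIV (\<lambda>_. measure_pmf (map_pmf f K)) J (Pi\<^sub>E J F) \<inter> space ?A
        = prod_emb UNIV (\<lambda>_. measure_pmf K) J (\<Pi>\<^sub>E j\<in>J. f -` F j)"
      by (auto simp: prod_emb_def space_PiM PiE_iff Pi_iff)
    also have "emeasure ?A \<dots> = (\<Prod>j\<in>J. emeasure (measure_pmf K) (f -` F j))"
      using J by (subst emeasure_PiM_emb) (auto intro: prob_space_measure_pmf)
    finally show "emeasure (distr ?A ?B ?g) (prod_emb UNIV (\<lambda>_. measure_pmf (map_pmf f K)) J (Pi\<^sub>E J F))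
        = (\<Prod>j\<in>J. emeasure (measure_pmf (map_pmf f K)) (F j))" by simp
  qed simp
qed

text \<open>A parameter below a supremum is exceeded by a member of the set. Nonemptiness comes from
  parameter 0, where almost surely no site is open.\<close>

lemma beta_c_less_obtain:
  assumes "q < beta_c" "0 \<le> q"
  obtains \<beta> where "q < \<beta>" "\<beta> \<in> {0..1}" "AE \<omega> in \<nu> \<beta>. \<not> (\<exists>\<gamma>. infinite_open_path \<omega> \<gamma>)"
proof -
  let ?S = "{\<beta> \<in> {0..1}. AE \<omega> in \<nu> \<beta>. \<not> (\<exists>\<gamma>. infinite_open_path \<omega> \<gamma>)}"
  have "AE \<omega> in \<nu> 0. \<not> \<omega> x" for x
  proof -
    interpret product_prob_space "\<lambda>_::site. measure_pmf (bernoulli_pmf 0)" UNIV ..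
    have "\<not> b" if "b \<in> set_pmf (bernoulli_pmf 0)" for b
      using that by (cases b) (auto simp: set_pmf_iff)
    then have "AE b in measure_pmf (bernoulli_pmf 0). \<not> b" unfolding AE_measure_pmf_iff by blast
    then show ?thesis unfolding bernoulli_field_def by (intro AE_component) auto
  qed
  then have "AE \<omega> in \<nu> 0. \<forall>x. \<not> \<omega> x" by (simp add: AE_all_countable)
  then have "AE \<omega> in \<nu> 0. \<not> (\<exists>\<gamma>. infinite_open_path \<omega> \<gamma>)"
    by eventually_elim (unfold infinite_open_path_def, blast)
  then have "0 \<in> ?S" by simp
  then have "?S \<noteq> {}" by blast
  moreover have "q < Sup ?S" using assms(1) by (simp add: beta_c_def)
  ultimately obtain \<beta> where "\<beta> \<in> ?S" "q < \<beta>" using less_cSupE by blast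
  then show ?thesis using that by auto
qed

text \<open>A zero of the first spin forces a one of the second, so sitewise copies place the zeros
  inside an open set of density \<beta>.\<close>

lemma bernoulli_coupling:
  fixes p \<beta> :: real
  assumes p: "p \<in> {0..1}" and b: "1 - p < \<beta>" "\<beta> \<le> 1"
  obtains K :: "(bool \<times> bool) pmf" where "map_pmf fst K = bernoulli_pmf p" "map_pmf snd K = bernoulli_pmf \<beta>"
    "\<And>z. z \<in> set_pmf K \<Longrightarrow> \<not> fst z \<Longrightarrow> snd z"
proof -
  have p0: "0 < p" using b by linarith
  \<comment> \<open>Solves \<open>(1 - p) + p * r = \<beta>\<close>, the probability that the second
    spin is 1.\<close>
  define r where "r = (\<beta> - (1 - p)) / p"
  have r: "0 \<le> r" "r \<le> 1" using p0 b by (auto simp: r_def field_simps)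
  define k where "k a = (if a then bernoulli_pmf r else return_pmf True)" for a
  define K where "K = bind_pmf (bernoulli_pmf p) (\<lambda>a. map_pmf (Pair a) (k a))"
  have "map_pmf fst K = bernoulli_pmf p"
    by (simp add: K_def map_bind_pmf pmf.map_comp o_def bind_return_pmf' map_pmf_const)
  moreover have "map_pmf snd K = bind_pmf (bernoulli_pmf p) k"
    by (simp add: K_def map_bind_pmf pmf.map_comp o_def)
  moreover have "bind_pmf (bernoulli_pmf p) k = bernoulli_pmf \<beta>"
  proof (rule pmf_eqI)
    fix c :: bool
    have T: "pmf (bind_pmf (bernoulli_pmf p) k) True = pmf (bernoulli_pmf \<beta>) True"
      using p p0 r b by (simp add: pmf_bind k_def r_def)
    then show "pmf (bind_pmf (bernoulli_pmf p) k) c = pmf (bernoulli_pmf \<beta>) c"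
      by (cases c) (simp_all only: pmf_False_conv_True)
  qed
  moreover have "snd z" if "z \<in> set_pmf K" "\<not> fst z" for z
    using that by (auto simp: K_def k_def split: if_splits)
  ultimately show ?thesis using that by simp
qed

text \<open>The zeros have density \<open>1 - p < beta_c\<close>; under the coupling any infinite
  path of zeros is an infinite open path at a parameter that does not percolate.\<close>

lemma AE_no_infinite_zero_path:
  assumes p: "p \<in> {0..1}" "1 - beta_c < p"
  shows "AE \<sigma> in \<nu> p. \<not> (\<exists>\<gamma>. infinite_open_path (\<lambda>z. \<not> \<sigma> z) \<gamma>)"
proof -
  obtain \<beta> where \<beta>: "1 - p < \<beta>" "\<beta> \<in> {0..1}" "AE \<omega> in \<nu> \<beta>. \<not> (\<exists>\<gamma>. infinite_open_path \<omega> \<gamma>)"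
    using beta_c_less_obtain[of "1 - p"] p by auto
  obtain K :: "(bool \<times> bool) pmf" where K: "map_pmf fst K = bernoulli_pmf p" "map_pmf snd K = bernoulli_pmf \<beta>"
    "\<And>z. z \<in> set_pmf K \<Longrightarrow> \<not> fst z \<Longrightarrow> snd z" using bernoulli_coupling[of p \<beta>] p \<beta> by auto
  let ?K = "Pi\<^sub>M UNIV (\<lambda>_::site. measure_pmf K)"
  interpret product_prob_space "\<lambda>_::site. measure_pmf K" UNIV ..
  have m: "(\<lambda>\<omega> x. f (\<omega> x)) \<in> measurable ?K (\<nu> q)" for f :: "bool \<times> bool \<Rightarrow> bool" and q
  proof (rule measurable_into_bernoulli)
    fix x
    have "(\<lambda>\<omega>. \<omega> x) \<in> measurable ?K (measure_pmf K)" by (rule measurable_component_singleton) simp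
    then show "(\<lambda>\<omega>. f (\<omega> x)) \<in> measurable ?K (count_space UNIV)"
      by (rule measurable_compose) simp
  qed
  have d: "distr ?K (\<nu> p) (\<lambda>\<omega> x. fst (\<omega> x)) = \<nu> p" "distr ?K (\<nu> \<beta>) (\<lambda>\<omega> x. snd (\<omega> x)) = \<nu> \<beta>"
    using distr_PiM_map_pmf[of K fst, where 'i = site] distr_PiM_map_pmf[of K snd, where 'i = site]
    by (simp_all add: bernoulli_field_def K)
  have "AE \<omega> in ?K. \<not> (\<exists>\<gamma>. infinite_open_path (\<lambda>x. snd (\<omega> x)) \<gamma>)"
    using AE_distrD[OF m[of snd \<beta>], of "\<lambda>\<omega>. \<not> (\<exists>\<gamma>. infinite_open_path \<omega> \<gamma>)"] \<beta>(3) unfolding d by blast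
  moreover have "AE \<omega> in ?K. \<forall>x. \<not> fst (\<omega> x) \<longrightarrow> snd (\<omega> x)"
    unfolding AE_all_countable
  proof
    fix x
    show "AE \<omega> in ?K. \<not> fst (\<omega> x) \<longrightarrow> snd (\<omega> x)"
      using K(3) by (intro AE_component) (auto simp: AE_measure_pmf_iff)
  qed
  ultimately have "AE \<omega> in ?K. \<not> (\<exists>\<gamma>. infinite_open_path (\<lambda>x. \<not> fst (\<omega> x)) \<gamma>)"
    by eventually_elim (unfold infinite_open_path_def, blast)
  \<comment> \<open>Measurability is what lets the statement be pushed forward from the coupling to
    its first marginal.\<close>
  moreover have "{\<sigma> \<in> space (\<nu> p). \<not> (\<exists>\<gamma>. infinite_open_path (\<lambda>z. \<not> \<sigma> z) \<gamma>)} \<in> sets (\<nu> p)"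
    using infinite_open_path_measurable[of Not p] by (intro sets.sets_Collect_neg) simp
  ultimately have "AE \<sigma> in distr ?K (\<nu> p) (\<lambda>\<omega> x. fst (\<omega> x)). \<not> (\<exists>\<gamma>. infinite_open_path (\<lambda>z. \<not> \<sigma> z) \<gamma>)"
    by (subst AE_distr_iff[OF m])
  then show ?thesis unfolding d .
qed

section \<open>Filling clusters of zeros by legal flips\<close>

definition fill :: "site set \<Rightarrow> config \<Rightarrow> config" where
  "fill B \<sigma> = (\<lambda>z. z \<in> B \<or> \<sigma> z)"

text \<open>Contains every site reachable from \<open>y\<close> by western and southern steps;
  confining fillings to it keeps them away from the site to be flipped.\<close>

definition lower :: "site \<Rightarrow> site set" where
  "lower y = {z. fst z \<le> fst y \<and> snd z \<le> snd y}"

lemma lower_west: "lower (west y) \<subseteq> lower y" and lower_south: "lower (south y) \<subseteq> lower y" and self_lower: "y \<in> lower y"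
  by (auto simp: lower_def west_def south_def)

lemma not_lower: "y \<notin> lower (west y)" "y \<notin> lower (south y)"
  by (auto simp: lower_def west_def south_def)

lemma fill_closed:
  assumes "\<And>\<tau> y b. \<tau> \<in> \<Omega> \<Longrightarrow> \<tau>(y := b) \<in> \<Omega>" "finite B" "\<sigma> \<in> \<Omega>"
  shows "fill B \<sigma> \<in> \<Omega>"
  using assms(2)
proof (induction B)
  case empty
  then show ?case using assms(3) by (simp add: fill_def)
next
  case (insert y B)
  have "fill (insert y B) \<sigma> = (fill B \<sigma>)(y := True)" by (auto simp: fill_def fun_eq_iff)
  then show ?case by (simp only:) (rule assms(1)[OF insert.IH])
qed

text \<open>Recursion along the zeros: make both neighbours of \<open>y\<close> equal to 1, then
  \<open>y\<close> can be filled legally. The same \<open>B\<close> must work for all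
  \<open>\<sigma>'\<close> above \<open>\<sigma>\<close>, since one neighbour is treated after the
  other has been filled, and since it is later used on both sides of a flip.\<close>

lemma fill_by_legal_flips:
  assumes closed: "\<And>\<tau> y b. \<tau> \<in> \<Omega> \<Longrightarrow> \<tau>(y := b) \<in> \<Omega>"
    and legal: "\<And>\<tau> y b. \<tau> \<in> \<Omega> \<Longrightarrow> y \<in> flippable \<tau> \<Longrightarrow> G (\<tau>(y := b)) = G \<tau>"
    and wf: "wf {(z, y). z \<in> {south y, west y} \<and> \<not> \<sigma> z}"
  shows "\<exists>B. finite B \<and> B \<subseteq> lower y \<and>
    (\<forall>\<sigma>'\<in>\<Omega>. (\<forall>z\<in>lower y. \<sigma> z \<longrightarrow> \<sigma>' z) \<longrightarrow> G (fill B \<sigma>') = G \<sigma>' \<and> fill B \<sigma>' y)" (is "?P y")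
  using wf
proof (induction y rule: wf_induct_rule)
  case (less y)
  \<comment> \<open>Well-founded induction reaches only neighbours that are zeros; a neighbour
    already equal to 1 takes the empty filling.\<close>
  have base: "?P z" if "\<sigma> z" for z
    using that self_lower by (intro exI[of _ "{}"]) (simp add: fill_def)
  show ?case
  proof (cases "\<sigma> y")
    case True
    then show ?thesis by (rule base)
  next
    case False
    have "?P (west y)"
    proof (cases "\<sigma> (west y)")
      case False
      then show ?thesis by (intro less) simp
    qed (rule base)
    then obtain B where "finite B \<and> B \<subseteq> lower (west y) \<and>
        (\<forall>\<sigma>'\<in>\<Omega>. (\<forall>z\<in>lower (west y). \<sigma> z \<longrightarrow> \<sigma>' z) \<longrightarrow> G (fill B \<sigma>') = G \<sigma>' \<and> fill B \<sigma>' (west y))" ..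
    then have B: "finite B" "B \<subseteq> lower (west y)"
        "\<And>\<sigma>'. \<sigma>' \<in> \<Omega> \<Longrightarrow> \<forall>z\<in>lower (west y). \<sigma> z \<longrightarrow> \<sigma>' z \<Longrightarrow> G (fill B \<sigma>') = G \<sigma>' \<and> fill B \<sigma>' (west y)"
      by simp_all
    have "?P (south y)"
    proof (cases "\<sigma> (south y)")
      case False
      then show ?thesis by (intro less) simp
    qed (rule base)
    then obtain C where "finite C \<and> C \<subseteq> lower (south y) \<and>
        (\<forall>\<sigma>'\<in>\<Omega>. (\<forall>z\<in>lower (south y). \<sigma> z \<longrightarrow> \<sigma>' z) \<longrightarrow> G (fill C \<sigma>') = G \<sigma>' \<and> fill C \<sigma>' (south y))" ..
    then have C: "finite C" "C \<subseteq> lower (south y)"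
        "\<And>\<sigma>'. \<sigma>' \<in> \<Omega> \<Longrightarrow> \<forall>z\<in>lower (south y). \<sigma> z \<longrightarrow> \<sigma>' z \<Longrightarrow> G (fill C \<sigma>') = G \<sigma>' \<and> fill C \<sigma>' (south y)"
      by simp_all
    show ?thesis
    proof (intro exI[of _ "insert y (B \<union> C)"] conjI ballI impI)
      show "finite (insert y (B \<union> C))" using B C by simp
      show "insert y (B \<union> C) \<subseteq> lower y" using B(2) C(2) lower_west lower_south self_lower by blast
      fix \<sigma>' assume s: "\<sigma>' \<in> \<Omega>" "\<forall>z\<in>lower y. \<sigma> z \<longrightarrow> \<sigma>' z"
      \<comment> \<open>West is filled before south. Filling only adds ones, so the second stage
        still starts above \<open>\<sigma>\<close> and preserves the western neighbour.\<close>
      let ?\<tau> = "fill C (fill B \<sigma>')"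
      have 1: "G (fill B \<sigma>') = G \<sigma>'" "fill B \<sigma>' (west y)"
        using B(3)[OF s(1)] s(2) lower_west by blast+
      have o: "fill B \<sigma>' \<in> \<Omega>" by (rule fill_closed[OF closed B(1) s(1)])
      have 2: "G ?\<tau> = G (fill B \<sigma>')" "?\<tau> (south y)"
        using C(3)[OF o] s(2) lower_south[of y] by (auto simp: fill_def)
      have o2: "?\<tau> \<in> \<Omega>" by (rule fill_closed[OF closed C(1) o])
      have "y \<in> flippable ?\<tau>" using 1(2) 2(2) by (simp add: flippable_def fill_def)
      then have "G (?\<tau>(y := True)) = G \<sigma>'" using legal[OF o2] 1 2 by simp
      moreover have "fill (insert y (B \<union> C)) \<sigma>' = ?\<tau>(y := True)" by (auto simp: fill_def fun_eq_iff)
      ultimately show "G (fill (insert y (B \<union> C)) \<sigma>') = G \<sigma>'" by simp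
      show "fill (insert y (B \<union> C)) \<sigma>' y" by (simp add: fill_def)
    qed
  qed
qed

text \<open>Fill both neighbours of \<open>x\<close>, flip \<open>x\<close> legally, and undo the
  filling: each stage preserves \<open>G\<close>, and the filling is the same with either spin at
  \<open>x\<close>.\<close>

lemma flip_invariant_of_legal_flips:
  assumes closed: "\<And>\<tau> y b. \<tau> \<in> \<Omega> \<Longrightarrow> \<tau>(y := b) \<in> \<Omega>"
    and legal: "\<And>\<tau> y b. \<tau> \<in> \<Omega> \<Longrightarrow> y \<in> flippable \<tau> \<Longrightarrow> G (\<tau>(y := b)) = G \<tau>"
    and no_path: "\<not> (\<exists>\<gamma>. infinite_open_path (\<lambda>z. \<not> \<sigma> z) \<gamma>)" and \<sigma>: "\<sigma> \<in> \<Omega>"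
  shows "G (\<sigma>(x := b)) = G \<sigma>"
proof -
  have wf: "wf {(z, y). z \<in> {south y, west y} \<and> \<not> \<sigma> z}"
    unfolding wf_iff_no_infinite_down_chain
  proof
    assume "\<exists>f. \<forall>i. (f (Suc i), f i) \<in> {(z, y). z \<in> {south y, west y} \<and> \<not> \<sigma> z}"
    then obtain f where f: "\<And>i. (f (Suc i), f i) \<in> {(z, y). z \<in> {south y, west y} \<and> \<not> \<sigma> z}" by meson
    have "f (Suc i) \<in> {south (f i), west (f i)}" "\<not> \<sigma> (f (Suc i))" for i using f[of i] by simp_all
    \<comment> \<open>A descending chain constrains only the smaller end of each step, so its first
      site may carry a one; the path therefore starts at index 1.\<close>
    then have "infinite_open_path (\<lambda>z. \<not> \<sigma> z) (\<lambda>n. f (Suc n))" by (simp add: infinite_open_path_def)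
    with no_path show False by blast
  qed
  from fill_by_legal_flips[where G = G and \<Omega> = \<Omega> and \<sigma> = \<sigma>, OF closed legal wf, of "west x"]
  obtain B where "finite B \<and> B \<subseteq> lower (west x) \<and>
      (\<forall>\<sigma>'\<in>\<Omega>. (\<forall>z\<in>lower (west x). \<sigma> z \<longrightarrow> \<sigma>' z) \<longrightarrow> G (fill B \<sigma>') = G \<sigma>' \<and> fill B \<sigma>' (west x))" ..
  then have B: "finite B" "B \<subseteq> lower (west x)"
      "\<And>\<sigma>'. \<sigma>' \<in> \<Omega> \<Longrightarrow> \<forall>z\<in>lower (west x). \<sigma> z \<longrightarrow> \<sigma>' z \<Longrightarrow> G (fill B \<sigma>') = G \<sigma>' \<and> fill B \<sigma>' (west x)"
    by simp_all
  from fill_by_legal_flips[where G = G and \<Omega> = \<Omega> and \<sigma> = \<sigma>, OF closed legal wf, of "south x"]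
  obtain C where "finite C \<and> C \<subseteq> lower (south x) \<and>
      (\<forall>\<sigma>'\<in>\<Omega>. (\<forall>z\<in>lower (south x). \<sigma> z \<longrightarrow> \<sigma>' z) \<longrightarrow> G (fill C \<sigma>') = G \<sigma>' \<and> fill C \<sigma>' (south x))" ..
  then have C: "finite C" "C \<subseteq> lower (south x)"
      "\<And>\<sigma>'. \<sigma>' \<in> \<Omega> \<Longrightarrow> \<forall>z\<in>lower (south x). \<sigma> z \<longrightarrow> \<sigma>' z \<Longrightarrow> G (fill C \<sigma>') = G \<sigma>' \<and> fill C \<sigma>' (south x)"
    by simp_all
  \<comment> \<open>Hence the filling commutes with an update at \<open>x\<close>.\<close>
  have nx: "x \<notin> B" "x \<notin> C" using B(2) C(2) not_lower by blast+
  have GB: "G (fill C (fill B \<sigma>')) = G \<sigma>' \<and> x \<in> flippable (fill C (fill B \<sigma>')) \<and> fill C (fill B \<sigma>') \<in> \<Omega>"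
    if s: "\<sigma>' \<in> \<Omega>" "\<And>z. z \<noteq> x \<Longrightarrow> \<sigma>' z = \<sigma> z" for \<sigma>'
  proof -
    have o: "fill B \<sigma>' \<in> \<Omega>" by (rule fill_closed[OF closed B(1) s(1)])
    have 1: "G (fill B \<sigma>') = G \<sigma>' \<and> fill B \<sigma>' (west x)"
      using s(2) not_lower by (intro B(3)[OF s(1)]) metis
    have 2: "G (fill C (fill B \<sigma>')) = G (fill B \<sigma>') \<and> fill C (fill B \<sigma>') (south x)"
    proof (rule C(3)[OF o], intro ballI impI)
      fix z assume "z \<in> lower (south x)" "\<sigma> z"
      then show "fill B \<sigma>' z" using s(2) not_lower unfolding fill_def by metis
    qed
    have "fill C (fill B \<sigma>') \<in> \<Omega>" by (rule fill_closed[OF closed C(1) o])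
    with 1 2 show ?thesis by (simp add: flippable_def fill_def)
  qed
  have "(fill C (fill B \<sigma>))(x := b) = fill C (fill B (\<sigma>(x := b)))"
    using nx by (auto simp: fill_def fun_eq_iff)
  then show ?thesis
    using GB[OF \<sigma>] GB[OF closed[OF \<sigma>], of x b] legal[of "fill C (fill B \<sigma>)" x b] by simp
qed

text \<open>Turns an almost sure hypothesis into the pointwise hypotheses of the filling argument by
  restricting to a set of full measure that is closed under all single-spin changes.\<close>

lemma AE_flip_invariant:
  assumes p: "0 < p" "p < 1" "1 - beta_c < p"
    and legal: "\<And>y. AE \<sigma> in \<nu> p. y \<in> flippable \<sigma> \<longrightarrow> F (\<sigma>(y := True)) = F (\<sigma>(y := False))"
  shows "AE \<sigma> in \<nu> p. F (\<sigma>(x := True)) = F (\<sigma>(x := False))"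
proof -
  let ?u = "\<lambda>(y, b) \<tau>. \<tau>(y := b)"
  define Q where "Q \<sigma> \<longleftrightarrow> (\<forall>y. y \<in> flippable \<sigma> \<longrightarrow> F (\<sigma>(y := True)) = F (\<sigma>(y := False)))" for \<sigma>
  \<comment> \<open>Closed under updates by construction, and of full measure because there are only
    countably many finite lists.\<close>
  define \<Omega> where "\<Omega> = {\<sigma>. \<forall>xs :: (site \<times> bool) list. Q (foldr ?u xs \<sigma>)}"
  have "AE \<sigma> in \<nu> p. Q \<sigma>" unfolding Q_def AE_all_countable using legal by blast
  then have "AE \<sigma> in \<nu> p. Q (foldr ?u xs \<sigma>)" for xs
  \<comment> \<open>\<open>foldr\<close> applies the last entry of the list to
    \<open>\<sigma>\<close> before the others, so lists grow at the right end.\<close>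
  proof (induction xs rule: rev_induct)
    case (snoc yb xs)
    from AE_bernoulli_update[OF p(1,2) snoc(1)[OF snoc(2)], of "fst yb" "snd yb"]
    show ?case by (simp add: case_prod_beta')
  qed simp
  then have "AE \<sigma> in \<nu> p. \<forall>xs. Q (foldr ?u xs \<sigma>)" unfolding AE_all_countable by blast
  moreover have "AE \<sigma> in \<nu> p. \<not> (\<exists>\<gamma>. infinite_open_path (\<lambda>z. \<not> \<sigma> z) \<gamma>)"
    using p by (intro AE_no_infinite_zero_path) auto
  ultimately show ?thesis
  proof eventually_elim
    case (elim \<sigma>)
    have closed: "\<tau>(y := b) \<in> \<Omega>" if "\<tau> \<in> \<Omega>" for \<tau> y b
    proof -
      have "Q (foldr ?u xs (\<tau>(y := b)))" for xs
      proof -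
        have "Q (foldr ?u (xs @ [(y, b)]) \<tau>)" using that unfolding \<Omega>_def by blast
        then show ?thesis by simp
      qed
      then show ?thesis by (simp add: \<Omega>_def)
    qed
    have legal': "F (\<tau>(y := b)) = F \<tau>" if \<tau>: "\<tau> \<in> \<Omega>" "y \<in> flippable \<tau>" for \<tau> y b
    proof -
      have "Q (foldr ?u [] \<tau>)" using \<tau>(1) unfolding \<Omega>_def by blast
      then have "F (\<tau>(y := True)) = F (\<tau>(y := False))" using \<tau>(2) unfolding Q_def foldr_Nil id_apply by blast
      then have "F (\<tau>(y := b)) = F (\<tau>(y := \<tau> y))" by (cases b; cases "\<tau> y") simp_all
      then show ?thesis by simp
    qed
    have \<sigma>: "\<sigma> \<in> \<Omega>" using elim(1) unfolding \<Omega>_def by blast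
    have "F (\<sigma>(x := b)) = F \<sigma>" for b
      by (rule flip_invariant_of_legal_flips[where G = F and \<Omega> = \<Omega>, OF closed legal' elim(2) \<sigma>])
    then show ?case by simp
  qed
qed

section \<open>The transition semigroup\<close>

lemma space_path_space: "space path_space = cadlag_paths"
  unfolding path_space_def space_restrict_space space_PiM PiE_def cadlag_paths_def by auto

lemma measurable_path_eval: "0 \<le> t \<Longrightarrow> (\<lambda>\<omega>. \<omega> t) \<in> measurable path_space borel"
  unfolding path_space_def by (rule measurable_restrict_space1, rule measurable_component_singleton) simp

text \<open>Events of the path space contain cadlag paths only, so this is needed to rewrite an
  event at time \<open>s + t\<close> as the preimage under the shift of an event at time
  \<open>t\<close>.\<close>

lemma time_shift_cadlag:
  assumes \<omega>: "\<omega> \<in> cadlag_paths" and s: "0 \<le> s"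
  shows "time_shift s \<omega> \<in> cadlag_paths"
  unfolding cadlag_paths_def
proof (intro CollectI conjI allI impI)
  show "time_shift s \<omega> \<in> extensional {0..}" by (simp add: time_shift_def)
next
  fix t :: real assume t: "0 \<le> t"
  have "filterlim ((+) s) (at_right (s + t)) (at_right t)"
    unfolding filterlim_at
    by (auto intro!: tendsto_eq_intros eventually_mono[OF eventually_at_right_less])
  moreover have "(\<omega> \<longlongrightarrow> \<omega> (s + t)) (at_right (s + t))"
    using \<omega> s t by (simp add: cadlag_paths_def)
  ultimately have "((\<lambda>u. \<omega> (s + u)) \<longlongrightarrow> \<omega> (s + t)) (at_right t)"
    by (rule filterlim_compose[rotated])
  moreover have "\<forall>\<^sub>F u in at_right t. \<omega> (s + u) = time_shift s \<omega> u"
    using eventually_at_right_less[of t] t by (auto elim!: eventually_mono simp: time_shift_def)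
  ultimately have "(time_shift s \<omega> \<longlongrightarrow> \<omega> (s + t)) (at_right t)"
    by (rule Lim_transform_eventually)
  then show "(time_shift s \<omega> \<longlongrightarrow> time_shift s \<omega> t) (at_right t)"
    using t by (simp add: time_shift_def)
next
  fix t :: real assume t: "0 < t"
  have ev: "\<forall>\<^sub>F u in at_left t. u \<in> {0<..<t}" by (rule eventually_at_left_real[OF t])
  have "filterlim ((+) s) (at_left (s + t)) (at_left t)"
    unfolding filterlim_at by (auto intro!: tendsto_eq_intros eventually_mono[OF ev])
  moreover have "0 < s + t" using s t by simp
  then obtain l where "(\<omega> \<longlongrightarrow> l) (at_left (s + t))"
    using \<omega> unfolding cadlag_paths_def by blast
  ultimately have "((\<lambda>u. \<omega> (s + u)) \<longlongrightarrow> l) (at_left t)"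
    using filterlim_compose by blast
  moreover have "\<forall>\<^sub>F u in at_left t. \<omega> (s + u) = time_shift s \<omega> u"
    using ev by (auto elim!: eventually_mono simp: time_shift_def)
  ultimately show "\<exists>l. (time_shift s \<omega> \<longlongrightarrow> l) (at_left t)"
    using Lim_transform_eventually by blast
qed

text \<open>The semigroup on bare functions, outside the type of bounded continuous functions in
  which \<open>transition_op\<close> lives.\<close>

definition mean :: "('a::topological_space \<Rightarrow> (real \<Rightarrow> 'a) measure) \<Rightarrow> real \<Rightarrow> ('a \<Rightarrow> real) \<Rightarrow> 'a \<Rightarrow> real" where
  "mean P t f \<sigma> = (\<integral>\<omega>. f (\<omega> t) \<partial>P \<sigma>)"

section \<open>The Chapman-Kolmogorov equation\<close>

lemma markov_kernel:
  assumes "markov_process P"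
  shows "prob_space (P \<sigma>)" "sets (P \<sigma>) = sets path_space" "space (P \<sigma>) = cadlag_paths"
proof -
  have "P \<in> measurable borel (prob_algebra path_space)" using assms by (simp add: markov_process_def)
  then have "P \<sigma> \<in> space (prob_algebra path_space)" by (rule measurable_space) simp
  then show "prob_space (P \<sigma>)" "sets (P \<sigma>) = sets path_space" by (auto simp: space_prob_algebra)
  then show "space (P \<sigma>) = cadlag_paths" using sets_eq_imp_space_eq space_path_space by metis
qed

lemma markov_measurable_eval:
  assumes "markov_process P" "0 \<le> t"
  shows "(\<lambda>\<omega>. \<omega> t) \<in> measurable (P \<sigma>) borel"
  using measurable_path_eval[OF assms(2)] measurable_cong_sets[OF markov_kernel(2)[OF assms(1)] refl] by blast

text \<open>The Markov property with the whole path space as past event.\<close>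

lemma markov_emeasure:
  fixes P :: "'a::topological_space \<Rightarrow> (real \<Rightarrow> 'a) measure"
  assumes M: "markov_process P" and s: "0 \<le> s" and t: "0 \<le> t" and B: "B \<in> sets borel"
  shows "emeasure (P \<sigma>) {\<omega> \<in> cadlag_paths. \<omega> (s + t) \<in> B}
    = (\<integral>\<^sup>+\<omega>. emeasure (P (\<omega> s)) {\<omega>' \<in> cadlag_paths. \<omega>' t \<in> B} \<partial>P \<sigma>)"
proof -
  let ?A = "{\<omega>' \<in> cadlag_paths. \<omega>' t \<in> B}"
  have "?A = (\<lambda>\<omega>. \<omega> t) -` B \<inter> space path_space" by (auto simp: space_path_space)
  also have "\<dots> \<in> sets path_space" by (rule measurable_sets[OF measurable_path_eval[OF t] B])
  finally have A: "?A \<in> sets path_space" .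
  have "space (history s :: (real \<Rightarrow> 'a) measure) = cadlag_paths" by (simp add: history_def)
  then have F: "(cadlag_paths :: (real \<Rightarrow> 'a) set) \<in> sets (history s)" by (metis sets.top)
  have "{\<omega> \<in> cadlag_paths. \<omega> (s + t) \<in> B} = cadlag_paths \<inter> time_shift s -` ?A"
    using time_shift_cadlag[OF _ s] t by (auto simp: time_shift_def)
  moreover have "emeasure (P \<sigma>) (cadlag_paths \<inter> time_shift s -` ?A)
      = (\<integral>\<^sup>+\<omega>\<in>cadlag_paths. emeasure (P (\<omega> s)) ?A \<partial>P \<sigma>)"
    using M s A F unfolding markov_process_def by blast
  ultimately have "emeasure (P \<sigma>) {\<omega> \<in> cadlag_paths. \<omega> (s + t) \<in> B}
      = (\<integral>\<^sup>+\<omega>\<in>cadlag_paths. emeasure (P (\<omega> s)) ?A \<partial>P \<sigma>)" by (simp only:)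
  also have "\<dots> = (\<integral>\<^sup>+\<omega>. emeasure (P (\<omega> s)) ?A \<partial>P \<sigma>)"
    by (rule nn_integral_cong) (simp add: markov_kernel(3)[OF M])
  finally show ?thesis .
qed

text \<open>The same identity as a composition of kernels, so that integrals of arbitrary
  nonnegative functions follow.\<close>

lemma markov_bind:
  fixes P :: "'a::topological_space \<Rightarrow> (real \<Rightarrow> 'a) measure"
  assumes M: "markov_process P" and s: "0 \<le> s" and t: "0 \<le> t"
  shows "(\<lambda>\<omega>. distr (P (\<omega> s)) borel (\<lambda>\<omega>'. \<omega>' t)) \<in> measurable (P \<sigma>) (subprob_algebra borel)" (is "?K \<in> _")
    and "distr (P \<sigma>) borel (\<lambda>\<omega>. \<omega> (s + t)) = P \<sigma> \<bind> (\<lambda>\<omega>. distr (P (\<omega> s)) borel (\<lambda>\<omega>'. \<omega>' t))"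
proof -
  interpret prob_space "P \<sigma>" by (rule markov_kernel(1)[OF M])
  have "P \<in> measurable borel (subprob_algebra path_space)"
    using M by (intro measurable_prob_algebraD) (simp add: markov_process_def)
  then have "(\<lambda>x. distr (P x) borel (\<lambda>\<omega>'. \<omega>' t)) \<in> measurable borel (subprob_algebra borel)"
    by (rule measurable_compose[OF _ measurable_distr[OF measurable_path_eval[OF t]]])
  then show K: "?K \<in> measurable (P \<sigma>) (subprob_algebra borel)"
    by (rule measurable_compose[OF markov_measurable_eval[OF M s]])
  show "distr (P \<sigma>) borel (\<lambda>\<omega>. \<omega> (s + t)) = P \<sigma> \<bind> ?K"
  proof (rule measure_eqI)
    show "sets (distr (P \<sigma>) borel (\<lambda>\<omega>. \<omega> (s + t))) = sets (P \<sigma> \<bind> ?K)"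
      using not_empty by (subst sets_bind[where N = borel]) auto
  next
    fix B assume "B \<in> sets (distr (P \<sigma>) borel (\<lambda>\<omega>. \<omega> (s + t)))"
    then have B: "B \<in> sets borel" by simp
    have e: "emeasure (distr (P x) borel (\<lambda>\<omega>. \<omega> r)) B = emeasure (P x) {\<omega> \<in> cadlag_paths. \<omega> r \<in> B}"
      if "0 \<le> r" for x r
      by (subst emeasure_distr[OF markov_measurable_eval[OF M that] B])
         (auto simp: markov_kernel(3)[OF M] intro!: arg_cong2[where f = emeasure])
    have "emeasure (P \<sigma> \<bind> ?K) B = (\<integral>\<^sup>+\<omega>. emeasure (?K \<omega>) B \<partial>P \<sigma>)"
      by (rule emeasure_bind[OF not_empty K B])
    also have "\<dots> = emeasure (P \<sigma>) {\<omega> \<in> cadlag_paths. \<omega> (s + t) \<in> B}"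
      unfolding markov_emeasure[OF M s t B] e[OF t] ..
    also have "\<dots> = emeasure (distr (P \<sigma>) borel (\<lambda>\<omega>. \<omega> (s + t))) B"
      using s t by (intro e[symmetric]) simp
    finally show "emeasure (distr (P \<sigma>) borel (\<lambda>\<omega>. \<omega> (s + t))) B = emeasure (P \<sigma> \<bind> ?K) B" by simp
  qed
qed

lemma bcontfun_borel: "f \<in> bcontfun \<Longrightarrow> f \<in> borel_measurable borel"
  unfolding bcontfun_def by (auto intro: borel_measurable_continuous_onI)

lemma bcontfun_bound:
  fixes f :: "'a::topological_space \<Rightarrow> real"
  assumes "f \<in> bcontfun" obtains C where "\<And>x. \<bar>f x\<bar> \<le> C"
  using assms unfolding bcontfun_def bounded_iff by auto

lemma mean_integrable:
  fixes f :: "'a::topological_space \<Rightarrow> real"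
  assumes M: "markov_process P" and t: "0 \<le> t" and f: "f \<in> borel_measurable borel" "\<And>x. \<bar>f x\<bar> \<le> C"
  shows "integrable (P \<sigma>) (\<lambda>\<omega>. f (\<omega> t))"
proof -
  interpret prob_space "P \<sigma>" by (rule markov_kernel(1)[OF M])
  show ?thesis
    using measurable_compose[OF markov_measurable_eval[OF M t] f(1)] f(2)
    by (intro integrable_const_bound[of _ C]) auto
qed

lemma mean_integrable_bcontfun:
  assumes "markov_process P" "0 \<le> t" "f \<in> bcontfun"
  shows "integrable (P \<sigma>) (\<lambda>\<omega>. f (\<omega> t) :: real)"
  using bcontfun_bound[OF assms(3)] mean_integrable[OF assms(1,2) bcontfun_borel[OF assms(3)]] by metis

lemma mean_abs_le:
  assumes M: "markov_process P" and t: "0 \<le> t" and f: "f \<in> bcontfun" "\<And>x. \<bar>f x\<bar> \<le> C"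
  shows "\<bar>mean P t f \<sigma>\<bar> \<le> C"
proof -
  interpret prob_space "P \<sigma>" by (rule markov_kernel(1)[OF M])
  have "\<bar>mean P t f \<sigma>\<bar> \<le> (\<integral>\<omega>. \<bar>f (\<omega> t)\<bar> \<partial>P \<sigma>)" unfolding mean_def by (rule integral_abs_bound)
  also have "\<dots> \<le> (\<integral>\<omega>. C \<partial>P \<sigma>)"
    using mean_integrable_bcontfun[OF M t f(1)] f(2) by (intro integral_mono) auto
  finally show ?thesis using prob_space by simp
qed

lemma mean_linear:
  assumes "markov_process P" "0 \<le> t" "f \<in> bcontfun" "g \<in> bcontfun"
  shows "mean P t (\<lambda>x. a * f x + b * g x) \<sigma> = a * mean P t f \<sigma> + b * mean P t g \<sigma>"
  unfolding mean_def
  using mean_integrable_bcontfun[OF assms(1,2,3), of \<sigma>] mean_integrable_bcontfun[OF assms(1,2,4), of \<sigma>] by simp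

lemma mean_const: "markov_process P \<Longrightarrow> mean P t (\<lambda>_. c) \<sigma> = c"
  using prob_space.prob_space[OF markov_kernel(1)[of P \<sigma>]] by (simp add: mean_def)

lemma mean_bcontfun:
  assumes "feller_process P" "0 \<le> t" "f \<in> bcontfun"
  shows "mean P t f \<in> bcontfun"
proof -
  obtain F where "f = apply_bcontfun F" using bcontfunE[OF assms(3)] .
  then show ?thesis using assms(1,2) unfolding feller_process_def mean_def[abs_def] by blast
qed

lemma mean_add:
  assumes Fe: "feller_process P" and s: "0 \<le> s" and t: "0 \<le> t" and f: "f \<in> bcontfun"
  shows "mean P (s + t) f \<sigma> = mean P s (mean P t f) \<sigma>"
proof -
  have M: "markov_process P" using Fe by (simp add: feller_process_def)
  have main: "mean P (s + t) g \<sigma> = mean P s (mean P t g) \<sigma>" if g: "g \<in> bcontfun" "\<And>x. 0 \<le> g x" for g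
  proof -
    have nn: "(\<integral>\<^sup>+\<omega>. ennreal (h (\<omega> r)) \<partial>P x) = ennreal (mean P r h x)"
      if "0 \<le> r" "h \<in> bcontfun" "\<And>x. 0 \<le> h x" for h r x
      unfolding mean_def
      by (rule nn_integral_eq_integral[OF mean_integrable_bcontfun[OF M that(1,2)]]) (simp add: that(3))
    have pos: "0 \<le> mean P r h x" if "\<And>x. 0 \<le> h x" for h r x
      unfolding mean_def using that by simp
    have gb: "(\<lambda>x. ennreal (g x)) \<in> borel_measurable borel" using bcontfun_borel[OF g(1)] by measurable
    have st: "0 \<le> s + t" using s t by simp
    have "ennreal (mean P (s + t) g \<sigma>) = (\<integral>\<^sup>+x. ennreal (g x) \<partial>distr (P \<sigma>) borel (\<lambda>\<omega>. \<omega> (s + t)))"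
      unfolding nn[OF st g, symmetric]
      by (rule nn_integral_distr[OF markov_measurable_eval[OF M st], symmetric]) (simp add: gb)
    also have "\<dots> = (\<integral>\<^sup>+\<omega>. (\<integral>\<^sup>+x. ennreal (g x) \<partial>distr (P (\<omega> s)) borel (\<lambda>\<omega>'. \<omega>' t)) \<partial>P \<sigma>)"
      unfolding markov_bind(2)[OF M s t] by (rule nn_integral_bind[OF gb markov_bind(1)[OF M s t]])
    also have "\<dots> = (\<integral>\<^sup>+\<omega>. ennreal (mean P t g (\<omega> s)) \<partial>P \<sigma>)"
      unfolding nn[OF t g, symmetric]
      by (intro nn_integral_cong nn_integral_distr[OF markov_measurable_eval[OF M t]]) (simp add: gb)
    also have "\<dots> = ennreal (mean P s (mean P t g) \<sigma>)"
      by (rule nn[OF s mean_bcontfun[OF Fe t g(1)]]) (rule pos[OF g(2)])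
    finally show ?thesis using pos[of g] pos[of "mean P t g"] g(2) by simp
  qed
  obtain C where C: "\<And>x. \<bar>f x\<bar> \<le> C" using bcontfun_bound[OF f] by blast
  have c: "(\<lambda>_. C) \<in> bcontfun" by (rule const_bcontfun)
  \<comment> \<open>Adding the bound \<open>C\<close> reduces to the nonnegative case; constants are
    fixed by the semigroup and cancel. The factors 1 match \<open>mean_linear\<close>.\<close>
  let ?g = "\<lambda>x. 1 * f x + 1 * C"
  have g: "?g \<in> bcontfun" using plus_cont[OF f c] by simp
  have "0 \<le> ?g x" for x using C[of x] by simp
  from main[OF g this] have "mean P (s + t) ?g \<sigma> = mean P s (mean P t ?g) \<sigma>" .
  moreover have "mean P t ?g = (\<lambda>x. 1 * mean P t f x + 1 * C)"
    by (rule ext) (simp only: mean_linear[OF M t f c] mean_const[OF M])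
  ultimately show ?thesis
    using mean_linear[OF M _ f c, of "s + t" 1 1 \<sigma>] mean_linear[OF M s mean_bcontfun[OF Fe t f] c, of 1 1 \<sigma>] s t
    by (simp add: mean_const[OF M])
qed

lemma mean_zero:
  assumes M: "markov_process P" and f: "f \<in> bcontfun"
  shows "mean P 0 f \<sigma> = f \<sigma>"
proof -
  have "AE \<omega> in P \<sigma>. f (\<omega> 0) = f \<sigma>"
    using M unfolding markov_process_def by (auto elim: eventually_mono)
  then have "mean P 0 f \<sigma> = (\<integral>\<omega>. f \<sigma> \<partial>P \<sigma>)"
    unfolding mean_def
    using measurable_compose[OF markov_measurable_eval[OF M order_refl] bcontfun_borel[OF f]]
    by (intro integral_cong_AE) auto
  then show ?thesis using mean_const[OF M, of 0 "f \<sigma>" \<sigma>] by (simp add: mean_def)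
qed

section \<open>The operator semigroup and its generator\<close>

lemma transition_op_apply:
  assumes "feller_process P" "0 \<le> t"
  shows "apply_bcontfun (transition_op P t f) = mean P t (apply_bcontfun f)"
proof -
  have "mean P t (apply_bcontfun f) \<in> bcontfun" by (rule mean_bcontfun[OF assms]) (rule apply_bcontfun)
  then show ?thesis unfolding transition_op_def mean_def[abs_def] by (rule Bcontfun_inverse)
qed

lemma transition_op_add:
  assumes "feller_process P" "0 \<le> s" "0 \<le> t"
  shows "transition_op P (s + t) f = transition_op P s (transition_op P t f)"
  using assms by (intro bcontfun_eqI) (simp add: transition_op_apply mean_add apply_bcontfun)

lemma transition_op_linear:
  assumes Fe: "feller_process P" and t: "0 \<le> t"
  shows "transition_op P t (a *\<^sub>R f + b *\<^sub>R g) = a *\<^sub>R transition_op P t f + b *\<^sub>R transition_op P t g"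
proof (rule bcontfun_eqI)
  fix \<sigma>
  have M: "markov_process P" using Fe by (simp add: feller_process_def)
  have "apply_bcontfun (a *\<^sub>R f + b *\<^sub>R g) = (\<lambda>x. a * f x + b * g x)"
    by (simp add: fun_eq_iff plus_bcontfun.rep_eq scaleR_bcontfun.rep_eq)
  then show "apply_bcontfun (transition_op P t (a *\<^sub>R f + b *\<^sub>R g)) \<sigma>
      = apply_bcontfun (a *\<^sub>R transition_op P t f + b *\<^sub>R transition_op P t g) \<sigma>"
    using mean_linear[OF M t apply_bcontfun apply_bcontfun, of a f b g \<sigma>]
    by (simp add: transition_op_apply[OF Fe t] plus_bcontfun.rep_eq scaleR_bcontfun.rep_eq)
qed

lemma transition_op_norm_le:
  assumes Fe: "feller_process P" and t: "0 \<le> t"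
  shows "norm (transition_op P t f) \<le> norm f"
proof (rule norm_bound)
  fix \<sigma>
  have M: "markov_process P" using Fe by (simp add: feller_process_def)
  show "norm (apply_bcontfun (transition_op P t f) \<sigma>) \<le> norm f"
    unfolding transition_op_apply[OF Fe t] real_norm_def
    by (rule mean_abs_le[OF M t apply_bcontfun]) (metis norm_bounded real_norm_def)
qed

text \<open>The operators commute, so the difference quotient of the image is the image of the
  difference quotient, and contractivity preserves convergence.\<close>

lemma transition_op_generator:
  assumes Fe: "feller_process P" and t: "0 \<le> t" and fg: "(f, g) \<in> generator_graph P"
  shows "(transition_op P t f, transition_op P t g) \<in> generator_graph P"
proof -
  let ?T = "transition_op P"
  let ?D = "\<lambda>h. (?T h f - f) /\<^sub>R h"
  have "(?D \<longlongrightarrow> g) (at_right 0)" using fg by (simp add: generator_graph_def)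
  then have "((\<lambda>h. norm (?D h - g)) \<longlongrightarrow> 0) (at_right 0)"
    by (simp add: tendsto_norm_zero_iff LIM_zero_iff)
  moreover have "\<forall>\<^sub>F h in at_right 0. norm ((?T h (?T t f) - ?T t f) /\<^sub>R h - ?T t g) \<le> norm (?D h - g)"
    using eventually_at_right_less[of "0::real"]
  proof eventually_elim
    case (elim h)
    have lin: "?T t (a *\<^sub>R u + b *\<^sub>R v) = a *\<^sub>R ?T t u + b *\<^sub>R ?T t v" for a b u v
      by (rule transition_op_linear[OF Fe t])
    have "?T h (?T t f) = ?T t (?T h f)"
      using transition_op_add[OF Fe _ t, of h f] transition_op_add[OF Fe t, of h f] elim
      by (simp add: add.commute)
    moreover have "?T t (?D h - g) = (?T t (?T h f) - ?T t f) /\<^sub>R h - ?T t g"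
    proof -
      have "?D h - g = inverse h *\<^sub>R (1 *\<^sub>R ?T h f + (-1) *\<^sub>R f) + (-1) *\<^sub>R g" by simp
      then show ?thesis by (simp only: lin) simp
    qed
    ultimately show ?case using transition_op_norm_le[OF Fe t, of "?D h - g"] by simp
  qed
  ultimately have "((\<lambda>h. (?T h (?T t f) - ?T t f) /\<^sub>R h - ?T t g) \<longlongrightarrow> 0) (at_right 0)"
    by (rule Lim_null_comparison[rotated])
  then show ?thesis by (simp add: generator_graph_def LIM_zero_iff)
qed

lemma generator_difference_quotient:
  assumes "(f, g) \<in> generator_graph P" "0 < \<epsilon>"
  obtains d where "0 < d" "\<And>h. 0 < h \<Longrightarrow> h < d \<Longrightarrow> norm (transition_op P h f - f - h *\<^sub>R g) \<le> \<epsilon> * h"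
proof -
  have "((\<lambda>t. (transition_op P t f - f) /\<^sub>R t) \<longlongrightarrow> g) (at_right 0)"
    using assms(1) by (simp add: generator_graph_def)
  then have "\<forall>\<^sub>F t in at_right 0. dist ((transition_op P t f - f) /\<^sub>R t) g < \<epsilon>"
    using assms(2) by (rule tendstoD)
  then obtain d where d: "0 < d" "\<And>h. 0 < h \<Longrightarrow> h < d \<Longrightarrow> dist ((transition_op P h f - f) /\<^sub>R h) g < \<epsilon>"
    unfolding eventually_at_right_field by auto
  have "norm (transition_op P h f - f - h *\<^sub>R g) \<le> \<epsilon> * h" if h: "0 < h" "h < d" for h
  proof -
    have "transition_op P h f - f - h *\<^sub>R g = h *\<^sub>R ((transition_op P h f - f) /\<^sub>R h - g)"
      using h by (simp add: scaleR_diff_right)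
    then have "norm (transition_op P h f - f - h *\<^sub>R g) = h * dist ((transition_op P h f - f) /\<^sub>R h) g"
      using h by (simp only: norm_scaleR dist_norm abs_of_pos)
    also have "\<dots> \<le> h * \<epsilon>" using d(2)[OF h] h by (intro mult_left_mono) auto
    finally show ?thesis by (simp add: mult.commute)
  qed
  with d(1) show ?thesis by (rule that)
qed

text \<open>The backward difference quotients of the orbit converge uniformly in time because \<open>g\<close> is itself
  in the domain, so that \<open>transition_op P h g\<close> tends to \<open>g\<close>.\<close>

lemma transition_op_backward_difference:
  assumes Fe: "feller_process P" and fg: "(f, g) \<in> generator_graph P" and gk: "(g, k) \<in> generator_graph P"
    and \<epsilon>: "0 < \<epsilon>"
  obtains d where "0 < d" "\<And>l t. 0 < l \<Longrightarrow> l < d \<Longrightarrow> l \<le> t \<Longrightarrow>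
    norm (transition_op P t f - transition_op P (t - l) f - l *\<^sub>R transition_op P t g) \<le> \<epsilon> * l"
proof -
  let ?T = "transition_op P"
  have \<epsilon>2: "0 < \<epsilon> / 2" using \<epsilon> by simp
  obtain d1 where d1: "0 < d1" "\<And>h. 0 < h \<Longrightarrow> h < d1 \<Longrightarrow> norm (?T h f - f - h *\<^sub>R g) \<le> \<epsilon> / 2 * h"
    using generator_difference_quotient[OF fg \<epsilon>2] by blast
  obtain d2 where d2: "0 < d2" "\<And>h. 0 < h \<Longrightarrow> h < d2 \<Longrightarrow> norm (?T h g - g - h *\<^sub>R k) \<le> 1 * h"
    using generator_difference_quotient[OF gk zero_less_one] by blast
  define d where "d = min (min d1 d2) (\<epsilon> / (2 * (norm k + 1)))"
  have dp: "0 < d" using d1(1) d2(1) \<epsilon> by (simp add: d_def add_nonneg_pos)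
  show ?thesis
  proof (rule that[OF dp])
    fix l t :: real assume l: "0 < l" "l < d" "l \<le> t"
    have tl: "0 \<le> t - l" using l by simp
    have lin: "?T (t - l) (a *\<^sub>R u + b *\<^sub>R v) = a *\<^sub>R ?T (t - l) u + b *\<^sub>R ?T (t - l) v" for a b u v
      by (rule transition_op_linear[OF Fe tl])
    have T: "?T t u = ?T (t - l) (?T l u)" for u
      using transition_op_add[OF Fe tl, of l u] l by simp
    have "?T t f - ?T (t - l) f - l *\<^sub>R ?T t g
        = ?T (t - l) (1 *\<^sub>R (1 *\<^sub>R ?T l f + (-1) *\<^sub>R f) + (- l) *\<^sub>R ?T l g)"
      unfolding lin T by simp
    then have "norm (?T t f - ?T (t - l) f - l *\<^sub>R ?T t g) \<le> norm (1 *\<^sub>R (1 *\<^sub>R ?T l f + (-1) *\<^sub>R f) + (- l) *\<^sub>R ?T l g)"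
      using transition_op_norm_le[OF Fe tl] by simp
    also have "1 *\<^sub>R (1 *\<^sub>R ?T l f + (-1) *\<^sub>R f) + (- l) *\<^sub>R ?T l g
        = (?T l f - f - l *\<^sub>R g) - l *\<^sub>R (?T l g - g)"
      by (simp add: scaleR_diff_right)
    also have "norm \<dots> \<le> norm (?T l f - f - l *\<^sub>R g) + l * norm (?T l g - g)"
      using norm_triangle_ineq4[of "?T l f - f - l *\<^sub>R g" "l *\<^sub>R (?T l g - g)"] l by simp
    also have "\<dots> \<le> \<epsilon> / 2 * l + l * (\<epsilon> / 2)"
    proof (intro add_mono mult_left_mono)
      show "norm (?T l f - f - l *\<^sub>R g) \<le> \<epsilon> / 2 * l" using d1(2) l by (simp add: d_def)
      have "norm (?T l g - g) \<le> norm (?T l g - g - l *\<^sub>R k) + norm (l *\<^sub>R k)"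
        using norm_triangle_ineq[of "?T l g - g - l *\<^sub>R k" "l *\<^sub>R k"] by simp
      also have "\<dots> \<le> 1 * l + l * norm k" using d2(2)[of l] l by (simp add: d_def)
      also have "\<dots> = l * (norm k + 1)" by (simp add: algebra_simps)
      also have "\<dots> \<le> \<epsilon> / (2 * (norm k + 1)) * (norm k + 1)"
        using l by (intro mult_right_mono) (auto simp: d_def)
      also have "\<dots> = \<epsilon> / 2"
        using add_nonneg_pos[OF norm_ge_zero[of k] zero_less_one] by (simp add: field_simps)
      finally show "norm (?T l g - g) \<le> \<epsilon> / 2" .
    qed (use l in simp)
    finally show "norm (?T t f - ?T (t - l) f - l *\<^sub>R ?T t g) \<le> \<epsilon> * l" by (simp add: mult.commute)
  qed
qed

lemma northeast_generator_cylinder: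
  assumes np: "northeast_process p P" and f: "cylinder_function f"
  shows "(Bcontfun f, Bcontfun (northeast_op p f)) \<in> generator_graph P"
proof -
  have "(Bcontfun f, Bcontfun (northeast_op p f)) \<in> {(f, g). cylinder_function (apply_bcontfun f) \<and>
      apply_bcontfun g = northeast_op p (apply_bcontfun f)}"
    using f cylinder_bcontfun[OF f] cylinder_bcontfun[OF northeast_op_cylinder[OF f]]
    by (simp add: Bcontfun_inverse)
  then have "(Bcontfun f, Bcontfun (northeast_op p f)) \<in> closure {(f, g). cylinder_function (apply_bcontfun f) \<and>
      apply_bcontfun g = northeast_op p (apply_bcontfun f)}" by (rule subsetD[OF closure_subset])
  then show ?thesis using np by (simp only: northeast_process_def)
qed

text \<open>The distance of pairs dominates the uniform distance in each component, so closeness of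
  graph points gives both pointwise estimates.\<close>

lemma northeast_generator_in_closure:
  assumes np: "northeast_process p P" and fg: "(f, g) \<in> generator_graph P"
  shows "in_closure p (\<lambda>_. 0) (apply_bcontfun f) (apply_bcontfun g)"
  unfolding in_closure_def
proof (intro allI impI)
  fix \<epsilon> :: real assume "\<epsilon> > 0"
  have "(f, g) \<in> closure {(f, g). cylinder_function (apply_bcontfun f) \<and>
      apply_bcontfun g = northeast_op p (apply_bcontfun f)}"
    using np fg unfolding northeast_process_def by simp
  then obtain z where z: "z \<in> {(f, g). cylinder_function (apply_bcontfun f) \<and>
      apply_bcontfun g = northeast_op p (apply_bcontfun f)}" "dist z (f, g) < \<epsilon>"
    using \<open>\<epsilon> > 0\<close> unfolding closure_approachable by meson
  obtain c h where "z = (c, h)" by (cases z)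
  with z have c: "cylinder_function (apply_bcontfun c)" "apply_bcontfun h = northeast_op p (apply_bcontfun c)"
    and d: "dist (c, h) (f, g) < \<epsilon>" by simp_all
  have "dist c f \<le> \<epsilon>" "dist h g \<le> \<epsilon>"
    using dist_fst_le[of "(c, h)" "(f, g)"] dist_snd_le[of "(c, h)" "(f, g)"] d by auto
  then have "\<bar>c \<sigma> - f \<sigma>\<bar> \<le> \<epsilon>" "\<bar>h \<sigma> - g \<sigma>\<bar> \<le> \<epsilon>" for \<sigma>
    using dist_bounded[of c \<sigma> f] dist_bounded[of h \<sigma> g] by (auto simp: dist_real_def)
  then show "\<exists>c. cylinder_function c \<and> (\<forall>\<sigma>. \<bar>c \<sigma> - f \<sigma>\<bar> \<le> \<epsilon>) \<and>
      (\<forall>\<sigma>. \<bar>northeast_op p c \<sigma> - 0 * c \<sigma> - g \<sigma>\<bar> \<le> \<epsilon>)"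
    using c by (intro exI[of _ "apply_bcontfun c"]) simp
qed

text \<open>Cylinder functions lie in the domain twice over, as their images under the generator are
  again cylinder functions; this gives the uniform backward differences.\<close>

lemma northeast_evolution:
  assumes np: "northeast_process p P" and f: "cylinder_function f"
  shows "evolution p (\<lambda>_. 0) (\<lambda>t. mean P t f) (\<lambda>t. mean P t (northeast_op p f))"
proof -
  have Fe: "feller_process P" using np by (simp add: northeast_process_def)
  note Lf = northeast_op_cylinder[OF f, of p]
  let ?f = "Bcontfun f" and ?g = "Bcontfun (northeast_op p f)"
  have gen: "(?f, ?g) \<in> generator_graph P" "(?g, Bcontfun (northeast_op p (northeast_op p f))) \<in> generator_graph P"
    by (rule northeast_generator_cylinder[OF np f], rule northeast_generator_cylinder[OF np Lf])
  have ap: "apply_bcontfun (transition_op P t ?f) = mean P t f"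
    "apply_bcontfun (transition_op P t ?g) = mean P t (northeast_op p f)" if "0 \<le> t" for t
    using that by (simp_all add: transition_op_apply[OF Fe] Bcontfun_inverse cylinder_bcontfun f Lf)
  show ?thesis
    unfolding evolution_def
  proof (intro conjI allI impI)
    fix t :: real assume t: "0 \<le> t"
    show "in_closure p (\<lambda>_. 0) (mean P t f) (mean P t (northeast_op p f))"
      unfolding ap[OF t, symmetric]
      by (rule northeast_generator_in_closure[OF np transition_op_generator[OF Fe t gen(1)]])
  next
    fix \<epsilon> :: real assume "0 < \<epsilon>"
    then obtain d where d: "0 < d" "\<And>l t. 0 < l \<Longrightarrow> l < d \<Longrightarrow> l \<le> t \<Longrightarrow>
        norm (transition_op P t ?f - transition_op P (t - l) ?f - l *\<^sub>R transition_op P t ?g) \<le> \<epsilon> * l"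
      using transition_op_backward_difference[OF Fe gen] by metis
    have "\<bar>mean P t f \<sigma> - mean P (t - l) f \<sigma> - l * mean P t (northeast_op p f) \<sigma>\<bar> \<le> \<epsilon> * l"
      if l: "0 < l" "l < d" "l \<le> t" for l t \<sigma>
    proof -
      have "\<bar>mean P t f \<sigma> - mean P (t - l) f \<sigma> - l * mean P t (northeast_op p f) \<sigma>\<bar>
          = norm (apply_bcontfun (transition_op P t ?f - transition_op P (t - l) ?f - l *\<^sub>R transition_op P t ?g) \<sigma>)"
        using l by (simp add: ap minus_bcontfun.rep_eq scaleR_bcontfun.rep_eq)
      also have "\<dots> \<le> \<epsilon> * l" using norm_bounded d(2)[OF l] by (rule order_trans)
      finally show ?thesis .
    qed
    with d(1) show "\<exists>d>0. \<forall>l t \<sigma>. 0 < l \<longrightarrow> l < d \<longrightarrow> l \<le> t \<longrightarrow>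
        \<bar>mean P t f \<sigma> - mean P (t - l) f \<sigma> - l * mean P t (northeast_op p f) \<sigma>\<bar> \<le> \<epsilon> * l" by blast
  qed
qed

section \<open>Mixing\<close>

text \<open>The only place where null sets arise: one for each site.\<close>

lemma AE_mean_spin_dev_tendsto_zero:
  assumes p: "p \<in> {0..1}" "1 - beta_c < p" and np: "northeast_process p P"
  shows "AE \<sigma> in \<nu> p. ((\<lambda>t. mean P t (spin_dev p x) \<sigma>) \<longlongrightarrow> 0) at_top"
proof -
  have Fe: "feller_process P" using np by (simp add: northeast_process_def)
  have M: "markov_process P" using Fe by (simp add: feller_process_def)
  note h = spin_dev_cylinder[of p x]
  define u where "u t = mean P t (spin_dev p x)" for t
  have ev: "evolution p (\<lambda>_. 0) u (\<lambda>t. mean P t (northeast_op p (spin_dev p x)))"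
    unfolding u_def by (rule northeast_evolution[OF np h])
  have u0: "u 0 = spin_dev p x"
    unfolding u_def by (rule ext) (rule mean_zero[OF M cylinder_bcontfun[OF h]])
  then have u01: "u 0 = (\<lambda>\<sigma>. spin_dev p x \<sigma> * 1)" by simp
  have factor: "u t \<sigma> = spin_dev p x \<sigma> * slope p x (u t) \<sigma>" if "0 \<le> t" for t \<sigma>
    by (rule evolution_factor[OF p(1) ev u01 depends_on_const that])
  define \<phi> where "\<phi> \<sigma> = (INF t\<in>{0..}. slope p x (u t) \<sigma>)" for \<sigma>
  have bdd: "bdd_below ((\<lambda>t. slope p x (u t) \<sigma>) ` {0..})" for \<sigma>
    using evolution_slope_decreasing(2)[OF p(1) ev u0 _ order_refl] by (intro bdd_belowI2[of _ 0]) auto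
  have lim: "((\<lambda>t. slope p x (u t) \<sigma>) \<longlongrightarrow> \<phi> \<sigma>) at_top" for \<sigma>
  proof (rule decreasing_tendsto)
    show "\<forall>\<^sub>F t in at_top. \<phi> \<sigma> \<le> slope p x (u t) \<sigma>"
      using eventually_ge_at_top[of 0]
      by eventually_elim (auto simp: \<phi>_def intro!: cINF_lower bdd)
    fix a assume "\<phi> \<sigma> < a"
    then obtain r where r: "0 \<le> r" "slope p x (u r) \<sigma> < a"
      unfolding \<phi>_def using cINF_less_iff[OF _ bdd[of \<sigma>], of a] by auto
    show "\<forall>\<^sub>F t in at_top. slope p x (u t) \<sigma> < a"
      using eventually_ge_at_top[of r]
    proof eventually_elim
      case (elim t)
      then show ?case
        using evolution_slope_decreasing(3)[OF p(1) ev u0 r(1), of "t - r" \<sigma>] r(2) by simp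
    qed
  qed
  have limu: "((\<lambda>t. u t \<sigma>) \<longlongrightarrow> spin_dev p x \<sigma> * \<phi> \<sigma>) at_top" for \<sigma>
  proof (rule Lim_transform_eventually)
    show "((\<lambda>t. spin_dev p x \<sigma> * slope p x (u t) \<sigma>) \<longlongrightarrow> spin_dev p x \<sigma> * \<phi> \<sigma>) at_top"
      by (intro tendsto_intros lim)
    show "\<forall>\<^sub>F t in at_top. spin_dev p x \<sigma> * slope p x (u t) \<sigma> = u t \<sigma>"
      using eventually_ge_at_top[of 0] by eventually_elim (rule factor[symmetric])
  qed
  have "AE \<sigma> in \<nu> p. spin_dev p x \<sigma> * \<phi> \<sigma> = 0"
  \<comment> \<open>At \<open>p = 1\<close> the centred spin itself vanishes almost surely, while
    forcing a spin to 0 is not absolutely continuous.\<close>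
  proof (cases "p = 1")
    case True
    interpret product_prob_space "\<lambda>_::site. measure_pmf (bernoulli_pmf 1)" UNIV ..
    have "b" if "b \<in> set_pmf (bernoulli_pmf 1)" for b
      using that by (cases b) (auto simp: set_pmf_iff)
    then have "AE b in measure_pmf (bernoulli_pmf 1). b" unfolding AE_measure_pmf_iff by blast
    then have "AE \<sigma> in \<nu> 1. \<sigma> x" unfolding bernoulli_field_def by (intro AE_component) auto
    then show ?thesis unfolding True by eventually_elim (simp add: spin_dev_def)
  next
    case False
    \<comment> \<open>A parameter in the unit interval above \<open>1 - p\<close> shows that
      \<open>p\<close> is positive.\<close>
    obtain \<beta> where "1 - p < \<beta>" "\<beta> \<in> {0..1}" using beta_c_less_obtain[of "1 - p"] p by auto
    then have p': "0 < p" "p < 1" using p False by auto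
    have "\<bar>u t \<sigma>\<bar> \<le> 1" if "0 \<le> t" for t \<sigma>
      unfolding u_def by (rule mean_abs_le[OF M that cylinder_bcontfun[OF h] spin_dev_abs_le[OF p(1)]])
    from evolution_limit_jump_zero[OF p' ev this limu]
    have "AE \<sigma> in \<nu> p. y \<in> flippable \<sigma> \<longrightarrow> spin_dev p x (\<sigma>(y := True)) * \<phi> (\<sigma>(y := True))
        = spin_dev p x (\<sigma>(y := False)) * \<phi> (\<sigma>(y := False))" for y .
    from AE_flip_invariant[where F = "\<lambda>\<sigma>. spin_dev p x \<sigma> * \<phi> \<sigma>" and x = x, OF p' p(2) this]
    show ?thesis
    proof eventually_elim
      case (elim \<sigma>)
      have "slope p x f (\<sigma>(x := b)) = slope p x f \<sigma>" for f b
        by (rule depends_onD[OF slope_depends]) auto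
      then have "\<phi> (\<sigma>(x := b)) = \<phi> \<sigma>" for b by (simp add: \<phi>_def)
      \<comment> \<open>The centred spin takes the values \<open>1 - p\<close> and
        \<open>- p\<close> on the two sides of the flip; adding \<open>p * \<phi> \<sigma>\<close>
        gives \<open>\<phi> \<sigma> = 0\<close>.\<close>
      with elim have "(1 - p) * \<phi> \<sigma> = - p * \<phi> \<sigma>" by (simp add: spin_dev_def)
      then have "\<phi> \<sigma> = 0" by (simp add: algebra_simps)
      then show ?case by simp
    qed
  qed
  then show ?thesis
  proof eventually_elim
    case (elim \<sigma>)
    then show ?case using limu[of \<sigma>] unfolding u_def by (simp only:)
  qed
qed

text \<open>Deterministic in \<open>\<sigma>\<close>: domination by the single spin at an extremal
  site introduces no further exceptional set.\<close>

lemma spin_product_tendsto_zero: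
  assumes p: "p \<in> {0..1}" and np: "northeast_process p P" and A: "finite A" "A \<noteq> {}"
    and lim: "\<And>x. ((\<lambda>t. mean P t (spin_dev p x) \<sigma>) \<longlongrightarrow> 0) at_top"
  shows "((\<lambda>t. mean P t (\<lambda>\<tau>. \<Prod>y\<in>A. spin_dev p y \<tau>) \<sigma>) \<longlongrightarrow> 0) at_top"
proof -
  have M: "markov_process P" using np by (simp add: northeast_process_def feller_process_def)
  \<comment> \<open>A maximiser of the coordinate sum is extremal: a different site that is at least
    \<open>x\<close> in both coordinates would have a larger sum.\<close>
  let ?l = "\<lambda>y::site. fst y + snd y"
  have "Max (?l ` A) \<in> ?l ` A" using A by (intro Max_in) auto
  then obtain x where x: "x \<in> A" "?l x = Max (?l ` A)" by auto
  have max: "?l y \<le> ?l x" if "y \<in> A" for y using that A(1) x(2) by simp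
  let ?g = "\<lambda>\<tau>. \<Prod>y\<in>A - {x}. spin_dev p y \<tau>"
  have dep: "depends_on (past x) ?g"
  proof (rule depends_on_prod)
    fix y assume y: "y \<in> A - {x}"
    then have "y \<in> past x" using max[of y] by (auto simp: past_def prod_eq_iff)
    then show "depends_on (past x) (spin_dev p y)" by (auto simp: depends_on_def spin_dev_def)
  qed
  have g1: "\<bar>?g \<tau>\<bar> \<le> 1" for \<tau>
    unfolding abs_prod by (rule prod_le_1) (simp add: spin_dev_abs_le[OF p])
  have eq: "(\<lambda>\<tau>. \<Prod>y\<in>A. spin_dev p y \<tau>) = (\<lambda>\<tau>. spin_dev p x \<tau> * ?g \<tau>)"
    using A(1) x(1) by (simp add: prod.remove)
  have cyl: "cylinder_function (\<lambda>\<tau>. \<Prod>y\<in>A. spin_dev p y \<tau>)"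
    by (rule cylinder_function_prod[OF A(1) spin_dev_cylinder])
  have i1: "mean P 0 (\<lambda>\<tau>. \<Prod>y\<in>A. spin_dev p y \<tau>) = (\<lambda>\<tau>. spin_dev p x \<tau> * ?g \<tau>)"
    unfolding eq[symmetric] by (rule ext) (rule mean_zero[OF M cylinder_bcontfun[OF cyl]])
  have i2: "mean P 0 (spin_dev p x) = spin_dev p x"
    by (rule ext) (rule mean_zero[OF M cylinder_bcontfun[OF spin_dev_cylinder]])
  show ?thesis
  proof (rule Lim_null_comparison)
    show "((\<lambda>t. \<bar>mean P t (spin_dev p x) \<sigma>\<bar>) \<longlongrightarrow> 0) at_top" by (rule tendsto_rabs_zero[OF lim])
    show "\<forall>\<^sub>F t in at_top. norm (mean P t (\<lambda>\<tau>. \<Prod>y\<in>A. spin_dev p y \<tau>) \<sigma>) \<le> \<bar>mean P t (spin_dev p x) \<sigma>\<bar>"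
      using eventually_ge_at_top[of 0]
    proof eventually_elim
      case (elim t)
      show ?case
        unfolding real_norm_def
        by (rule evolution_dominated(1)[OF p northeast_evolution[OF np cyl]
            northeast_evolution[OF np spin_dev_cylinder] i1 dep g1 i2 elim])
    qed
  qed
qed

text \<open>Each single-site indicator is its mean plus or minus the centred spin. Expanding the
  product, \<open>A\<close> collects the sites contributing a centred spin, and
  \<open>A = {}\<close> gives the product probability of \<open>\<zeta>\<close>.\<close>

lemma cylinder_event_expansion:
  assumes \<Lambda>: "finite \<Lambda>" and \<zeta>: "\<zeta> \<in> \<Lambda> \<rightarrow>\<^sub>E UNIV"
  shows "of_bool (restrict \<tau> \<Lambda> = \<zeta>) =
    (\<Sum>A\<in>Pow \<Lambda>. ((\<Prod>y\<in>A. if \<zeta> y then 1 else - 1) * (\<Prod>y\<in>\<Lambda> - A. if \<zeta> y then p else 1 - p)) *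
      (\<Prod>y\<in>A. spin_dev p y \<tau>))"
proof -
  have "restrict \<tau> \<Lambda> = \<zeta> \<longleftrightarrow> (\<forall>y\<in>\<Lambda>. \<tau> y = \<zeta> y)"
    using \<zeta> by (auto simp: fun_eq_iff restrict_def PiE_def extensional_def)
  then have "of_bool (restrict \<tau> \<Lambda> = \<zeta>) = (\<Prod>y\<in>\<Lambda>. of_bool (\<tau> y = \<zeta> y) :: real)"
    using \<Lambda> by (auto simp: prod_zero_iff)
  also have "\<dots> = (\<Prod>y\<in>\<Lambda>. (if \<zeta> y then 1 else - 1) * spin_dev p y \<tau> + (if \<zeta> y then p else 1 - p))"
    by (rule prod.cong) (auto simp: spin_dev_def)
  also have "\<dots> = (\<Sum>A\<in>Pow \<Lambda>. (\<Prod>y\<in>A. (if \<zeta> y then 1 else - 1) * spin_dev p y \<tau>) *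
      (\<Prod>y\<in>\<Lambda> - A. if \<zeta> y then p else 1 - p))"
    by (rule prod_add[OF \<Lambda>])
  finally show ?thesis by (simp add: prod.distrib mult_ac)
qed

lemma bernoulli_field_singleton:
  assumes p: "p \<in> {0..1}" and \<Lambda>: "finite \<Lambda>" and \<zeta>: "\<zeta> \<in> \<Lambda> \<rightarrow>\<^sub>E UNIV"
  shows "measure (bernoulli_field \<Lambda> p) {\<zeta>} = (\<Prod>y\<in>\<Lambda>. if \<zeta> y then p else 1 - p)"
proof -
  interpret finite_product_prob_space "\<lambda>_::site. measure_pmf (bernoulli_pmf p)" \<Lambda>
    by standard (rule \<Lambda>)
  have "{\<zeta>} = (\<Pi>\<^sub>E y\<in>\<Lambda>. {\<zeta> y})"
    using \<zeta> by (intro PiE_singleton[symmetric]) (simp add: PiE_def)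
  then have "measure (bernoulli_field \<Lambda> p) {\<zeta>} = (\<Prod>y\<in>\<Lambda>. measure (measure_pmf (bernoulli_pmf p)) {\<zeta> y})"
    unfolding bernoulli_field_def by (simp add: prob_times)
  also have "\<dots> = (\<Prod>y\<in>\<Lambda>. if \<zeta> y then p else 1 - p)"
    using p by (intro prod.cong) (auto simp: measure_pmf_single)
  finally show ?thesis .
qed

theorem theorem2:
  fixes p :: real and P :: "config \<Rightarrow> (real \<Rightarrow> config) measure"
  assumes "p \<in> {0..1}" and "p > 1 - beta_c"
    and "northeast_process p P"
  shows "AE \<sigma> in \<nu> p. \<forall>\<Lambda>. finite \<Lambda> \<longrightarrow> (\<forall>\<zeta> \<in> \<Lambda> \<rightarrow>\<^sub>E UNIV.
           ((\<lambda>t. measure (P \<sigma>) {\<omega> \<in> space (P \<sigma>). restrict (\<omega> t) \<Lambda> = \<zeta>})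
              \<longlongrightarrow> measure (bernoulli_field \<Lambda> p) {\<zeta>}) at_top)"
proof -
  have M: "markov_process P" using assms(3) by (simp add: northeast_process_def feller_process_def)
  have "AE \<sigma> in \<nu> p. \<forall>x. ((\<lambda>t. mean P t (spin_dev p x) \<sigma>) \<longlongrightarrow> 0) at_top"
    \<comment> \<open>The null sets are united over the countably many sites before any
      \<open>\<Lambda>\<close> or \<open>\<zeta>\<close> is chosen.\<close>
    unfolding AE_all_countable by (intro allI AE_mean_spin_dev_tendsto_zero assms)
  then show ?thesis
  proof eventually_elim
    case (elim \<sigma>)
    show ?case
    proof (intro allI impI ballI)
      fix \<Lambda> :: "site set" and \<zeta> assume \<Lambda>: "finite \<Lambda>" and \<zeta>: "\<zeta> \<in> \<Lambda> \<rightarrow>\<^sub>E (UNIV :: bool set)"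
      define c where "c A = (\<Prod>y\<in>A. if \<zeta> y then 1 else - 1) * (\<Prod>y\<in>\<Lambda> - A. if \<zeta> y then p else 1 - p)" for A
      define f where "f A \<tau> = (\<Prod>y\<in>A. spin_dev p y \<tau>)" for A \<tau>
      have fb: "f A \<in> bcontfun" if "A \<in> Pow \<Lambda>" for A
        unfolding f_def[abs_def] using that \<Lambda>
        by (intro cylinder_bcontfun cylinder_function_prod spin_dev_cylinder) (auto intro: finite_subset)
      \<comment> \<open>Only the empty product, which is constantly 1, survives in the
        limit.\<close>
      have lim: "((\<lambda>t. mean P t (f A) \<sigma>) \<longlongrightarrow> of_bool (A = {})) at_top" if "A \<in> Pow \<Lambda>" for A
      proof (cases "A = {}")
        case True
        then show ?thesis by (simp add: f_def[abs_def] mean_const[OF M])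
      next
        case False
        have "finite A" using that \<Lambda> finite_subset by auto
        then have "((\<lambda>t. mean P t (f A) \<sigma>) \<longlongrightarrow> 0) at_top"
          unfolding f_def[abs_def]
          by (rule spin_product_tendsto_zero[OF assms(1,3) _ False]) (rule elim[rule_format])
        with False show ?thesis by simp
      qed
      have meas: "measure (P \<sigma>) {\<omega> \<in> space (P \<sigma>). restrict (\<omega> t) \<Lambda> = \<zeta>} = (\<Sum>A\<in>Pow \<Lambda>. c A * mean P t (f A) \<sigma>)"
        if t: "0 \<le> t" for t
      proof -
        have int: "integrable (P \<sigma>) (\<lambda>\<omega>. c A * f A (\<omega> t))" if "A \<in> Pow \<Lambda>" for A
          using mean_integrable_bcontfun[OF M t fb[OF that]] by simp
        have "measure (P \<sigma>) {\<omega> \<in> space (P \<sigma>). restrict (\<omega> t) \<Lambda> = \<zeta>}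
            = (\<integral>\<omega>. indicator {\<omega> \<in> space (P \<sigma>). restrict (\<omega> t) \<Lambda> = \<zeta>} \<omega> \<partial>P \<sigma>)"
          by (auto intro!: arg_cong2[where f = measure])
        also have "\<dots> = (\<integral>\<omega>. (\<Sum>A\<in>Pow \<Lambda>. c A * f A (\<omega> t)) \<partial>P \<sigma>)"
          unfolding c_def f_def cylinder_event_expansion[OF \<Lambda> \<zeta>, symmetric]
          by (rule Bochner_Integration.integral_cong) (auto simp: indicator_def)
        also have "\<dots> = (\<Sum>A\<in>Pow \<Lambda>. \<integral>\<omega>. c A * f A (\<omega> t) \<partial>P \<sigma>)"
          by (rule Bochner_Integration.integral_sum[OF int])
        finally show ?thesis by (simp add: mean_def)
      qed
      have "((\<lambda>t. \<Sum>A\<in>Pow \<Lambda>. c A * mean P t (f A) \<sigma>) \<longlongrightarrow> (\<Sum>A\<in>Pow \<Lambda>. c A * of_bool (A = {}))) at_top"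
        by (intro tendsto_sum tendsto_mult tendsto_const lim)
      moreover have "(\<Sum>A\<in>Pow \<Lambda>. c A * of_bool (A = {})) = measure (bernoulli_field \<Lambda> p) {\<zeta>}"
      proof -
        have "(\<Sum>A\<in>Pow \<Lambda>. c A * of_bool (A = {})) = (\<Sum>A\<in>{{}}. c A * of_bool (A = {}))"
          using \<Lambda> by (intro sum.mono_neutral_right) auto
        then show ?thesis
          unfolding bernoulli_field_singleton[OF assms(1) \<Lambda> \<zeta>] by (simp add: c_def)
      qed
      ultimately have "((\<lambda>t. \<Sum>A\<in>Pow \<Lambda>. c A * mean P t (f A) \<sigma>) \<longlongrightarrow> measure (bernoulli_field \<Lambda> p) {\<zeta>}) at_top"
        by simp
      then show "((\<lambda>t. measure (P \<sigma>) {\<omega> \<in> space (P \<sigma>). restrict (\<omega> t) \<Lambda> = \<zeta>})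
          \<longlongrightarrow> measure (bernoulli_field \<Lambda> p) {\<zeta>}) at_top"
      proof (rule Lim_transform_eventually)
        show "\<forall>\<^sub>F t in at_top. (\<Sum>A\<in>Pow \<Lambda>. c A * mean P t (f A) \<sigma>)
            = measure (P \<sigma>) {\<omega> \<in> space (P \<sigma>). restrict (\<omega> t) \<Lambda> = \<zeta>}"
          using eventually_ge_at_top[of 0] by eventually_elim (simp add: meas)
      qed
    qed
  qed
qed

end
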